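(* Let $\mathbb{F}$ be a field. A finite simplicial complex $K$ is tight (over $\mathbb{F}$) if and only if $K$ is (up to simplicial isomorphism) of the form $\partial\Delta^{[n_1]}*\cdots*\partial\Delta^{[n_k]}$ or $\Delta^{[r]}*\partial\Delta^{[n_1]}*\cdots*\partial\Delta^{[n_k]}$ for some positive integers $n_1,\dots,n_k$ and $r$.
   Context: Let $K$ be a $d$-dimensional simplicial complex with vertex set $[m]=\{1,\dots,m\}$ (every $i\in[m]$ is a vertex of $K$). For $J\subseteq[m]$, $K|_J$ is the full subcomplex of $K$ on $J$. The reduced total Betti number is $\widetilde{tb}(X;\mathbb{F})=\sum_i\dim_{\mathbb{F}}\widetilde H_i(X;\mathbb{F})$, with the convention that the empty complex has $\widetilde H_{-1}(\varnothing;\mathbb{F})=\mathbb{F}$ and no other reduced homology, so $\widetilde{tb}(\varnothing)=1$. The total bigraded Betti number of $K$ is $\widetilde D(K;\mathbb{F})=\dim_{\mathbb{F}}\mathrm{Tor}_{\mathbb{F}[v_1,\dots,v_m]}(\mathbb{F}[K],\mathbb{F})$, where $\mathbb{F}[K]$ is the Stanley-Reisner ring of $K$; by Hochster's formula, $\widetilde D(K;\mathbb{F})=\sum_{J\subseteq[m]}\widetilde{tb}(K|_J;\mathbb{F})$. $K$ is called tight (over $\mathbb{F}$) if $\widetilde D(K;\mathbb{F})=2^{m-d-1}$. $\Delta^{[n]}$ denotes the $(n-1)$-dimensional simplex on $n$ vertices and $\partial\Delta^{[n]}$ its boundary; $*$ is the simplicial join (factors taken on disjoint vertex sets). Convention: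 $\partial\Delta^{[1]}=\varnothing$ (with no vertices) and $K*\varnothing=K$. *)

theory Defs
  imports Complex_Main "HOL-Library.Poly_Mapping" "HOL-Library.Function_Algebras"
begin

section \<open>Simplicial complexes\<close>

definition abstract_simplicial_complex :: "'v set set \<Rightarrow> bool" where
  "abstract_simplicial_complex K \<longleftrightarrow>
     {} \<in> K \<and> (\<forall>\<sigma>\<in>K. finite \<sigma>) \<and> (\<forall>\<sigma>\<in>K. \<forall>\<tau>. \<tau> \<subseteq> \<sigma> \<longrightarrow> \<tau> \<in> K)"

text \<open>For the empty complex \<open>{{}}\<close> this is \<open>-1\<close>.\<close>

definition sc_dimension :: "'v set set \<Rightarrow> int" where
  "sc_dimension K = int (Max (card ` K)) - 1"

definition simplicially_isomorphic :: "'v set set \<Rightarrow> 'w set set \<Rightarrow> bool" where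
  "simplicially_isomorphic K L \<longleftrightarrow> (\<exists>f. bij_betw f (\<Union>K) (\<Union>L) \<and> (image f) ` K = L)"

definition full_simplex :: "nat \<Rightarrow> nat set set" where
  "full_simplex n = Pow {1..n}"

text \<open>\<open>boundary_simplex 1 = {{}}\<close> is the empty complex without vertices, which is neutral for
  the join.\<close>

definition boundary_simplex :: "nat \<Rightarrow> nat set set" where
  "boundary_simplex n = Pow {1..n} - {{1..n}}"

text \<open>The vertex sets are made disjoint by tagging the vertices of the \<open>i\<close>-th factor with \<open>i\<close>.\<close>

definition simplicial_join :: "'v set set list \<Rightarrow> (nat \<times> 'v) set set" where
  "simplicial_join Ks = {\<Union>i<length Ks. {i} \<times> \<sigma> i | \<sigma>. \<forall>i<length Ks. \<sigma> i \<in> Ks ! i}"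

section \<open>Stanley--Reisner ideals\<close>

text \<open>Polynomials in the countably many variables \<open>v\<^sub>0, v\<^sub>1, \<dots>\<close>; an exponent vector is a finitely
  supported function.\<close>

type_synonym 'k mpoly = "(nat \<Rightarrow>\<^sub>0 nat) \<Rightarrow>\<^sub>0 'k"

definition const :: "'k::field \<Rightarrow> 'k mpoly" where
  "const a = Poly_Mapping.single 0 a"

definition var :: "nat \<Rightarrow> 'k::field mpoly" where
  "var i = Poly_Mapping.single (Poly_Mapping.single i 1) 1"

definition polyring :: "nat \<Rightarrow> 'k::field mpoly set" where
  "polyring m = {p. \<forall>t\<in>Poly_Mapping.keys p. Poly_Mapping.keys t \<subseteq> {1..m}}"

text \<open>The ideal of \<open>polyring m\<close> generated by the squarefree monomials of the non-faces of \<open>K\<close>; the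
  Stanley--Reisner ring is the quotient.\<close>

definition SR_ideal :: "nat \<Rightarrow> nat set set \<Rightarrow> 'k::field mpoly set" where
  "SR_ideal m K =
     {\<Sum>\<sigma>\<in>Pow {1..m} - K. q \<sigma> * (\<Prod>i\<in>\<sigma>. var i) | q. \<forall>\<sigma>. q \<sigma> \<in> polyring m}"

section \<open>Dimension of a quotient space\<close>

text \<open>For subspaces \<open>B \<subseteq> Z\<close>: the elements of \<open>X\<close> represent pairwise different classes, which form
  a basis of \<open>Z / B\<close>.\<close>

definition quotient_basis ::
    "('k::field \<Rightarrow> 'b::ab_group_add \<Rightarrow> 'b) \<Rightarrow> 'b set \<Rightarrow> 'b set \<Rightarrow> 'b set \<Rightarrow> bool" where
  "quotient_basis scale Z B X \<longleftrightarrow>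
     X \<subseteq> Z \<and> \<not> module.dependent scale X \<and> module.span scale X \<inter> B = {0} \<and>
     module.span scale (X \<union> B) = Z"

definition quotient_dim ::
    "('k::field \<Rightarrow> 'b::ab_group_add \<Rightarrow> 'b) \<Rightarrow> 'b set \<Rightarrow> 'b set \<Rightarrow> nat" where
  "quotient_dim scale Z B = card (SOME X. quotient_basis scale Z B X)"

section \<open>Tor\<close>

text \<open>
  Let \<open>S = polyring m\<close>. For an ideal \<open>I\<close> of \<open>S\<close>, \<open>Tor\<^sub>i(S/I, k)\<close> is computed by tensoring a free
  resolution of the \<open>S\<close>-module \<open>k = S/(v\<^sub>1,\<dots>,v\<^sub>m)\<close> with \<open>S/I\<close> and taking homology. The resolution
  is the Koszul complex: in degree \<open>i\<close> it is free on symbols \<open>u J\<close> with \<open>J \<subseteq> {1..m}\<close> and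
  \<open>card J = i\<close>, and \<open>u J\<close> is mapped to \<open>\<Sum>j\<in>J. (-1) ^ card {l\<in>J. l < j} * var j * u (J - {j})\<close>.
  A chain \<open>\<Sum>J. c J * u J\<close> is given by its coefficient function \<open>c\<close>. That this is indeed
  a free resolution of \<open>k\<close> is proved in \<open>koszul_exact\<close> and \<open>koszul_augmentation\<close> below.

  Chains with coefficients in \<open>S/I\<close> are represented by chains with coefficients in \<open>S\<close>, so that
  \<open>koszul_cycles m I i\<close> and \<open>koszul_boundaries m I i\<close> are the preimages, in the chains over \<open>S\<close>, of
  the cycles and boundaries over \<open>S/I\<close>. Both contain the chains of degree \<open>i\<close> with
  coefficients in \<open>I\<close>.
\<close>

type_synonym 'k chain = "nat set \<Rightarrow> 'k mpoly"

definition koszul_diff :: "nat \<Rightarrow> 'k::field chain \<Rightarrow> 'k chain" where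
  "koszul_diff m c J =
     (\<Sum>j\<in>{1..m} - J. (-1) ^ card {l\<in>J. l < j} * var j * c (insert j J))"

definition koszul_chains :: "nat \<Rightarrow> nat \<Rightarrow> 'k::field chain set" where
  "koszul_chains m i =
     {c. \<forall>J. (if J \<subseteq> {1..m} \<and> card J = i then c J \<in> polyring m else c J = 0)}"

definition koszul_cycles :: "nat \<Rightarrow> 'k::field mpoly set \<Rightarrow> nat \<Rightarrow> 'k chain set" where
  "koszul_cycles m I i = {c \<in> koszul_chains m i. \<forall>J. koszul_diff m c J \<in> I}"

definition koszul_boundaries :: "nat \<Rightarrow> 'k::field mpoly set \<Rightarrow> nat \<Rightarrow> 'k chain set" where
  "koszul_boundaries m I i =
     {c \<in> koszul_chains m i. \<exists>b \<in> koszul_chains m (Suc i). \<forall>J. c J - koszul_diff m b J \<in> I}"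

definition scale_chain :: "'k::field \<Rightarrow> 'k chain \<Rightarrow> 'k chain" where
  "scale_chain a c J = const a * c J"

interpretation chain: vector_space scale_chain
  by standard
    (simp_all add: scale_chain_def const_def fun_eq_iff algebra_simps single_add mult_single
      flip: mult.assoc)

definition Tor_dim :: "nat \<Rightarrow> 'k::field mpoly set \<Rightarrow> nat \<Rightarrow> nat" where
  "Tor_dim m I i = quotient_dim scale_chain (koszul_cycles m I i) (koszul_boundaries m I i)"

subsection \<open>The Koszul complex resolves the ground field\<close>

lemma lookup_var_mult:
  fixes q :: "'k::field mpoly"
  shows "Poly_Mapping.lookup (var i * q) t =
    (if Poly_Mapping.lookup t i > 0 then Poly_Mapping.lookup q (t - Poly_Mapping.single i 1) else 0)"
proof -
  have iff: "t = Poly_Mapping.single i 1 + s \<longleftrightarrow>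
      Poly_Mapping.lookup t i > 0 \<and> s = t - Poly_Mapping.single i 1" for s
  proof
    assume "t = Poly_Mapping.single i 1 + s"
    then show "Poly_Mapping.lookup t i > 0 \<and> s = t - Poly_Mapping.single i 1"
      by (simp add: lookup_add)
  next
    assume *: "Poly_Mapping.lookup t i > 0 \<and> s = t - Poly_Mapping.single i 1"
    show "t = Poly_Mapping.single i 1 + s"
      by (rule poly_mapping_eqI)
        (use * in \<open>auto simp: lookup_add lookup_minus lookup_single when_def\<close>)
  qed
  have "Poly_Mapping.lookup (var i * q) t =
      Sum_any (\<lambda>l. Poly_Mapping.lookup (var i :: 'k mpoly) l *
        Sum_any (\<lambda>s. Poly_Mapping.lookup q s when t = l + s))"
    by (simp add: lookup_mult)
  also have "\<dots> = Sum_any (\<lambda>l. Sum_any (\<lambda>s. Poly_Mapping.lookup q s when t = l + s)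
      when l = Poly_Mapping.single i 1)"
    by (rule Sum_any.cong) (auto simp: var_def lookup_single when_def)
  also have "\<dots> = Sum_any (\<lambda>s. Poly_Mapping.lookup q s when t = Poly_Mapping.single i 1 + s)"
    by simp
  also have "\<dots> = Sum_any (\<lambda>s.
      (if Poly_Mapping.lookup t i > 0 then Poly_Mapping.lookup q s else 0)
      when s = t - Poly_Mapping.single i 1)"
    by (rule Sum_any.cong) (simp only: iff, simp add: when_def)
  finally show ?thesis by simp
qed

text \<open>The contracting homotopy: on \<open>v\<^sup>a u\<^sub>J\<close> of nonzero multidegree, trade \<open>v\<^sub>p\<close> for \<open>u\<^sub>p\<close>, where
  \<open>p\<close> is the least index occurring in the multidegree.\<close>

definition koszul_contract :: "'k::field chain \<Rightarrow> 'k chain" where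
  "koszul_contract c J = Poly_Mapping.Abs_poly_mapping (\<lambda>a.
     let p = Min (Poly_Mapping.keys a \<union> J) in
     if finite J \<and> p \<in> J then Poly_Mapping.lookup (c (J - {p})) (a + Poly_Mapping.single p 1) else 0)"

lemma lookup_koszul_contract:
  "Poly_Mapping.lookup (koszul_contract c J) a =
     (let p = Min (Poly_Mapping.keys a \<union> J) in
      if finite J \<and> p \<in> J then Poly_Mapping.lookup (c (J - {p})) (a + Poly_Mapping.single p 1) else 0)"
proof -
  have "{a. (let p = Min (Poly_Mapping.keys a \<union> J) in
      if finite J \<and> p \<in> J then Poly_Mapping.lookup (c (J - {p})) (a + Poly_Mapping.single p 1) else 0) \<noteq> 0}
      \<subseteq> (\<Union>p\<in>(if finite J then J else {}).
            (\<lambda>b. b - Poly_Mapping.single p 1) ` Poly_Mapping.keys (c (J - {p})))"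
    (is "?A \<subseteq> ?B")
  proof
    fix a assume "a \<in> ?A"
    define p where "p = Min (Poly_Mapping.keys a \<union> J)"
    have "finite J" "p \<in> J" "Poly_Mapping.lookup (c (J - {p})) (a + Poly_Mapping.single p 1) \<noteq> 0"
      using \<open>a \<in> ?A\<close> by (auto simp: p_def Let_def split: if_splits)
    moreover have "a = (a + Poly_Mapping.single p 1) - Poly_Mapping.single p 1" by simp
    ultimately have "a \<in> (\<lambda>b. b - Poly_Mapping.single p 1) ` Poly_Mapping.keys (c (J - {p}))"
      by (metis image_eqI in_keys_iff)
    with \<open>finite J\<close> \<open>p \<in> J\<close> show "a \<in> ?B" by auto
  qed
  moreover have "finite ?B" by auto
  ultimately have "finite ?A" by (rule finite_subset)
  then show ?thesis unfolding koszul_contract_def by (subst lookup_Abs_poly_mapping) auto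
qed

lemma lookup_koszul_diff:
  "Poly_Mapping.lookup (koszul_diff m c J) a =
    (\<Sum>j\<in>{1..m} - J. if Poly_Mapping.lookup a j > 0
       then (-1) ^ card {l\<in>J. l < j} * Poly_Mapping.lookup (c (insert j J)) (a - Poly_Mapping.single j 1)
       else 0)"
proof -
  have sign: "Poly_Mapping.lookup ((-1) ^ n * p) a = (-1) ^ n * Poly_Mapping.lookup p a"
    for n :: nat and p :: "'b::field mpoly" and a
    by (cases "even n") simp_all
  show ?thesis
    unfolding koszul_diff_def lookup_sum mult.assoc sign lookup_var_mult
    by (rule sum.cong) auto
qed

lemma koszul_homotopy:
  assumes J: "J \<subseteq> {1..m}" and a: "Poly_Mapping.keys a \<subseteq> {1..m}"
    and nonzero: "Poly_Mapping.keys a \<union> J \<noteq> {}"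
  shows "Poly_Mapping.lookup (koszul_diff m (koszul_contract c) J) a +
    Poly_Mapping.lookup (koszul_contract (koszul_diff m c) J) a = Poly_Mapping.lookup (c J) a"
proof -
  define p where "p = Min (Poly_Mapping.keys a \<union> J)"
  have fin: "finite J" using J finite_subset by blast
  then have finU: "finite (Poly_Mapping.keys a \<union> J)" by simp
  have p_in: "p \<in> Poly_Mapping.keys a \<union> J" unfolding p_def using Min_in[OF finU nonzero] .
  have p_min: "p \<le> j" if "j \<in> Poly_Mapping.keys a \<union> J" for j
    unfolding p_def using Min_le[OF finU that] .
  have pm: "p \<in> {1..m}" using p_in J a by auto
  have supp: "Poly_Mapping.keys (a - Poly_Mapping.single j 1) \<union> insert j J = Poly_Mapping.keys a \<union> J"
    if "Poly_Mapping.lookup a j > 0" for j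
    using that by (auto simp: in_keys_iff lookup_minus lookup_single when_def split: if_splits)
  have dh: "Poly_Mapping.lookup (koszul_diff m (koszul_contract c) J) a =
    (\<Sum>j\<in>{1..m} - J. if Poly_Mapping.lookup a j > 0 \<and> p \<in> insert j J
       then (-1) ^ card {l\<in>J. l < j} * Poly_Mapping.lookup (c (insert j J - {p}))
         (a - Poly_Mapping.single j 1 + Poly_Mapping.single p 1)
       else 0)"
    unfolding lookup_koszul_diff
  proof (rule sum.cong[OF refl])
    fix j
    show "(if Poly_Mapping.lookup a j > 0
       then (-1) ^ card {l\<in>J. l < j} *
         Poly_Mapping.lookup (koszul_contract c (insert j J)) (a - Poly_Mapping.single j 1)
       else 0) =
      (if Poly_Mapping.lookup a j > 0 \<and> p \<in> insert j J
       then (-1) ^ card {l\<in>J. l < j} * Poly_Mapping.lookup (c (insert j J - {p}))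
         (a - Poly_Mapping.single j 1 + Poly_Mapping.single p 1)
       else 0)"
    proof (cases "Poly_Mapping.lookup a j > 0")
      case True
      show ?thesis
        unfolding lookup_koszul_contract supp[OF True] p_def[symmetric] Let_def
        using fin True by (simp del: insert_iff)
    qed simp
  qed
  show ?thesis
  proof (cases "p \<in> J")
    case True
    have "Poly_Mapping.lookup (koszul_contract (koszul_diff m c) J) a =
        Poly_Mapping.lookup (koszul_diff m c (J - {p})) (a + Poly_Mapping.single p 1)"
      using True fin by (simp add: lookup_koszul_contract Let_def flip: p_def)
    also have "\<dots> = (\<Sum>j\<in>insert p ({1..m} - J).
      if Poly_Mapping.lookup (a + Poly_Mapping.single p 1) j > 0
       then (-1) ^ card {l\<in>J - {p}. l < j} * Poly_Mapping.lookup (c (insert j (J - {p})))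
         (a + Poly_Mapping.single p 1 - Poly_Mapping.single j 1)
       else 0)"
      unfolding lookup_koszul_diff by (rule sum.cong) (use True pm in auto)
    also have "\<dots> = Poly_Mapping.lookup (c J) a + (\<Sum>j\<in>{1..m} - J.
      if Poly_Mapping.lookup (a + Poly_Mapping.single p 1) j > 0
       then (-1) ^ card {l\<in>J - {p}. l < j} * Poly_Mapping.lookup (c (insert j (J - {p})))
         (a + Poly_Mapping.single p 1 - Poly_Mapping.single j 1)
       else 0)"
    proof -
      have "{l \<in> J - {p}. l < p} = {}" using p_min by fastforce
      then have "card {l \<in> J - {p}. l < p} = 0" by (simp only: card.empty)
      then show ?thesis
        using True
        by (subst sum.insert) (simp, simp, simp add: lookup_add insert_absorb del: card_0_eq card_eq_0_iff Diff_iff)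
    qed
    also have "(\<Sum>j\<in>{1..m} - J.
      if Poly_Mapping.lookup (a + Poly_Mapping.single p 1) j > 0
       then (-1) ^ card {l\<in>J - {p}. l < j} * Poly_Mapping.lookup (c (insert j (J - {p})))
         (a + Poly_Mapping.single p 1 - Poly_Mapping.single j 1)
       else 0) = - Poly_Mapping.lookup (koszul_diff m (koszul_contract c) J) a"
      unfolding dh sum_negf[symmetric]
    proof (rule sum.cong[OF refl])
      fix j assume j: "j \<in> {1..m} - J"
      then have pj: "p \<noteq> j" using True by auto
      show "(if Poly_Mapping.lookup (a + Poly_Mapping.single p 1) j > 0
         then (-1) ^ card {l\<in>J - {p}. l < j} * Poly_Mapping.lookup (c (insert j (J - {p})))
           (a + Poly_Mapping.single p 1 - Poly_Mapping.single j 1)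
         else 0) =
        - (if Poly_Mapping.lookup a j > 0 \<and> p \<in> insert j J
         then (-1) ^ card {l\<in>J. l < j} * Poly_Mapping.lookup (c (insert j J - {p}))
           (a - Poly_Mapping.single j 1 + Poly_Mapping.single p 1)
         else 0)"
      proof (cases "Poly_Mapping.lookup a j > 0")
        case pos: True
        then have "p < j" using p_min[of j] pj by (auto simp: in_keys_iff)
        then have "{l\<in>J. l < j} = insert p {l\<in>J - {p}. l < j}" using True by auto
        then have card: "card {l\<in>J. l < j} = Suc (card {l\<in>J - {p}. l < j})"
          using fin by simp
        have exp: "a + Poly_Mapping.single p 1 - Poly_Mapping.single j 1 =
            a - Poly_Mapping.single j 1 + Poly_Mapping.single p 1"
          by (rule poly_mapping_eqI)
            (use pj pos in \<open>auto simp: lookup_add lookup_minus lookup_single when_def\<close>)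
        have ins: "insert j (J - {p}) = insert j J - {p}" using pj by auto
        show ?thesis
          using pos True pj by (simp only: card exp ins) (simp add: lookup_add)
      next
        case False
        then show ?thesis using pj by (simp add: lookup_add lookup_single_not_eq)
      qed
    qed
    finally show ?thesis by simp
  next
    case False
    have pos: "Poly_Mapping.lookup a p > 0" using p_in False by (auto simp: in_keys_iff)
    have hd: "Poly_Mapping.lookup (koszul_contract (koszul_diff m c) J) a = 0"
      using False by (simp add: lookup_koszul_contract Let_def flip: p_def)
    have none: "{l \<in> J. l < p} = {}" using p_min by fastforce
    have exp: "a - Poly_Mapping.single p 1 + Poly_Mapping.single p 1 = a"
      by (rule poly_mapping_eqI)
        (use pos in \<open>auto simp: lookup_add lookup_minus lookup_single when_def\<close>)
    have "Poly_Mapping.lookup (koszul_diff m (koszul_contract c) J) a =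
      (\<Sum>j\<in>{1..m} - J. if j = p then Poly_Mapping.lookup (c J) a else 0)"
      unfolding dh
    proof (rule sum.cong[OF refl])
      fix j assume "j \<in> {1..m} - J"
      show "(if Poly_Mapping.lookup a j > 0 \<and> p \<in> insert j J
         then (-1) ^ card {l\<in>J. l < j} * Poly_Mapping.lookup (c (insert j J - {p}))
           (a - Poly_Mapping.single j 1 + Poly_Mapping.single p 1)
         else 0) = (if j = p then Poly_Mapping.lookup (c J) a else 0)"
      proof (cases "j = p")
        case True
        have "insert p J - {p} = J" using False by auto
        then show ?thesis using True pos none by (simp only: exp none) simp
      qed (use False in auto)
    qed
    also have "\<dots> = Poly_Mapping.lookup (c J) a"
      using pm False by (simp add: sum.delta)
    finally show ?thesis using hd by simp
  qed
qed

lemma koszul_contract_chain: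
  assumes c: "c \<in> koszul_chains m i"
  shows "koszul_contract c \<in> koszul_chains m (Suc i)"
proof -
  have *: "J \<subseteq> {1..m} \<and> card J = Suc i \<and> Poly_Mapping.keys a \<subseteq> {1..m}"
    if nz: "Poly_Mapping.lookup (koszul_contract c J) a \<noteq> 0" for J a
  proof -
    define p where "p = Min (Poly_Mapping.keys a \<union> J)"
    have J: "finite J" "p \<in> J"
      and l: "Poly_Mapping.lookup (c (J - {p})) (a + Poly_Mapping.single p 1) \<noteq> 0"
      using nz by (auto simp: lookup_koszul_contract Let_def p_def split: if_splits)
    from l have "c (J - {p}) \<noteq> 0" by auto
    with c have sub: "J - {p} \<subseteq> {1..m}" "card (J - {p}) = i" "c (J - {p}) \<in> polyring m"
      by (auto simp: koszul_chains_def split: if_splits)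
    have "a + Poly_Mapping.single p 1 \<in> Poly_Mapping.keys (c (J - {p}))"
      using l by (simp add: in_keys_iff)
    with sub(3) have "Poly_Mapping.keys (a + Poly_Mapping.single p 1) \<subseteq> {1..m}"
      by (auto simp: polyring_def)
    moreover have "Poly_Mapping.keys (a + Poly_Mapping.single p 1) = insert p (Poly_Mapping.keys a)"
      by (auto simp: in_keys_iff lookup_add lookup_single when_def split: if_splits)
    moreover have "card J = Suc i" using sub(2) card.remove[OF J] by simp
    ultimately show ?thesis using sub(1) by auto
  qed
  have "koszul_contract c J \<in> polyring m" for J
    unfolding polyring_def using * by (blast dest: in_keys_iff[THEN iffD1])
  moreover have "koszul_contract c J = 0" if "\<not> (J \<subseteq> {1..m} \<and> card J = Suc i)" for J
    by (rule poly_mapping_eqI) (use * that in auto)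
  ultimately show ?thesis by (simp add: koszul_chains_def)
qed

lemma koszul_diff_contract:
  assumes c: "c \<in> koszul_chains m i"
    and cyc: "\<And>J. koszul_diff m c J = 0"
    and aug: "Poly_Mapping.lookup (c {}) 0 = 0"
  shows "koszul_diff m (koszul_contract c) = c"
proof
  fix J
  note h = koszul_contract_chain[OF c]
  show "koszul_diff m (koszul_contract c) J = c J"
  proof (rule poly_mapping_eqI)
    fix a
    have contract_0: "Poly_Mapping.lookup (koszul_contract (koszul_diff m c) J) a = 0"
      by (simp add: lookup_koszul_contract cyc Let_def)
    show "Poly_Mapping.lookup (koszul_diff m (koszul_contract c) J) a = Poly_Mapping.lookup (c J) a"
    proof (cases "J \<subseteq> {1..m} \<and> Poly_Mapping.keys a \<subseteq> {1..m}")
      case True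
      show ?thesis
      proof (cases "Poly_Mapping.keys a \<union> J = {}")
        case True
        then show ?thesis using aug by (simp add: lookup_koszul_diff)
      next
        case False
        with True show ?thesis using koszul_homotopy[of J m a c] contract_0 by simp
      qed
    next
      case False
      have cz: "Poly_Mapping.lookup (d L) b = 0"
        if "d \<in> koszul_chains m k" "\<not> (L \<subseteq> {1..m} \<and> Poly_Mapping.keys b \<subseteq> {1..m})"
        for d :: "'a chain" and k L b
        using that by (auto simp: koszul_chains_def polyring_def in_keys_iff
            dest!: spec[of _ L] split: if_splits)
      have "Poly_Mapping.lookup (koszul_contract c (insert j J)) (a - Poly_Mapping.single j 1) = 0"
        if j: "j \<in> {1..m}" "Poly_Mapping.lookup a j > 0" for j
      proof (rule cz[OF h])
        have "Poly_Mapping.keys a \<subseteq> insert j (Poly_Mapping.keys (a - Poly_Mapping.single j 1))"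
          by (auto simp: in_keys_iff lookup_minus lookup_single when_def split: if_splits)
        then show "\<not> (insert j J \<subseteq> {1..m} \<and>
            Poly_Mapping.keys (a - Poly_Mapping.single j 1) \<subseteq> {1..m})"
          using False j by auto
      qed
      then have "Poly_Mapping.lookup (koszul_diff m (koszul_contract c) J) a = 0"
        unfolding lookup_koszul_diff by (intro sum.neutral) auto
      then show ?thesis using cz[OF c False] by simp
    qed
  qed
qed

lemma koszul_diff_diff: "koszul_diff m (koszul_diff m b) J = 0"
proof -
  define A where "A = {1..m} - J"
  define F where "F i j = (-1) ^ card {l\<in>J. l < i} * var i *
    ((-1) ^ card {l\<in>insert i J. l < j} * var j * b (insert j (insert i J)))" for i j
  have finA: "finite A" by (simp add: A_def)
  have anti: "F j i = - F i j" if "i \<in> A" "j \<in> A" "i < j" for i j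
  proof -
    have eq: "{l\<in>insert j J. l < i} = {l\<in>J. l < i}"
      "{l\<in>insert i J. l < j} = insert i {l\<in>J. l < j}"
      using that by auto
    have "card (insert i {l\<in>J. l < j}) = Suc (card {l\<in>J. l < j})"
      using that by (subst card_insert_disjoint) (auto simp: A_def)
    then show ?thesis
      unfolding F_def eq by (simp add: insert_commute mult_ac)
  qed
  have "koszul_diff m (koszul_diff m b) J = (\<Sum>i\<in>A. \<Sum>j\<in>{1..m} - insert i J. F i j)"
    by (simp add: koszul_diff_def A_def F_def sum_distrib_left mult.assoc)
  also have "\<dots> = (\<Sum>i\<in>A. (\<Sum>j\<in>{j\<in>A. i < j}. F i j) + (\<Sum>j\<in>{j\<in>A. j < i}. F i j))"
  proof (rule sum.cong[OF refl])
    fix i assume "i \<in> A"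
    have split: "{1..m} - insert i J = {j\<in>A. i < j} \<union> {j\<in>A. j < i}"
      by (auto simp: A_def)
    show "(\<Sum>j\<in>{1..m} - insert i J. F i j) =
        (\<Sum>j\<in>{j\<in>A. i < j}. F i j) + (\<Sum>j\<in>{j\<in>A. j < i}. F i j)"
      unfolding split by (rule sum.union_disjoint) (use finA in auto)
  qed
  also have "\<dots> = (\<Sum>i\<in>A. \<Sum>j\<in>{j\<in>A. i < j}. F i j) + (\<Sum>i\<in>A. \<Sum>j\<in>{j\<in>A. j < i}. F i j)"
    by (rule sum.distrib)
  also have "(\<Sum>i\<in>A. \<Sum>j\<in>{j\<in>A. j < i}. F i j) = (\<Sum>j\<in>A. \<Sum>i\<in>{i\<in>A. j < i}. F i j)"
    by (rule sum.swap_restrict[OF finA finA])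
  also have "\<dots> = (\<Sum>j\<in>A. \<Sum>i\<in>{i\<in>A. j < i}. - F j i)"
  proof (rule sum.cong[OF refl], rule sum.cong[OF refl])
    fix i j assume "j \<in> A" "i \<in> {i\<in>A. j < i}"
    then show "F i j = - F j i" by (intro anti) auto
  qed
  finally show ?thesis by (simp add: sum_negf)
qed

text \<open>With \<open>I = {0}\<close> one obtains the Koszul complex over \<open>S\<close> itself. It is a complex, it is exact in
  positive degrees, and the image in degree \<open>0\<close> is the kernel of the augmentation \<open>S \<rightarrow> k\<close>.\<close>

theorem koszul_exact:
  assumes "i > 0"
  shows "koszul_cycles m {0} i = koszul_boundaries m {0} i"
proof (intro set_eqI iffI)
  fix c :: "'a::field chain"
  assume "c \<in> koszul_cycles m {0} i"
  then have c: "c \<in> koszul_chains m i" "\<And>J. koszul_diff m c J = 0"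
    by (auto simp: koszul_cycles_def)
  have "c {} = 0" using c(1) assms by (auto simp: koszul_chains_def dest!: spec[of _ "{}"])
  then have "koszul_diff m (koszul_contract c) = c"
    using c by (intro koszul_diff_contract) auto
  then show "c \<in> koszul_boundaries m {0} i"
    using c(1) koszul_contract_chain[OF c(1)]
    by (auto simp: koszul_boundaries_def intro!: bexI[of _ "koszul_contract c"])
next
  fix c :: "'a::field chain"
  assume "c \<in> koszul_boundaries m {0} i"
  then obtain b where c: "c \<in> koszul_chains m i" and b: "\<And>J. c J = koszul_diff m b J"
    by (auto simp: koszul_boundaries_def)
  then have "c = koszul_diff m b" by auto
  with c show "c \<in> koszul_cycles m {0} i"
    by (simp add: koszul_cycles_def koszul_diff_diff)
qed

theorem koszul_augmentation:
  "koszul_boundaries m {0} 0 = {c \<in> koszul_chains m 0. Poly_Mapping.lookup (c {}) 0 = 0}"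
proof (intro set_eqI iffI)
  fix c :: "'a::field chain"
  assume "c \<in> koszul_boundaries m {0} 0"
  then obtain b where "c \<in> koszul_chains m 0" "\<And>J. c J = koszul_diff m b J"
    by (auto simp: koszul_boundaries_def)
  then show "c \<in> {c \<in> koszul_chains m 0. Poly_Mapping.lookup (c {}) 0 = 0}"
    by (simp add: lookup_koszul_diff)
next
  fix c :: "'a::field chain"
  assume "c \<in> {c \<in> koszul_chains m 0. Poly_Mapping.lookup (c {}) 0 = 0}"
  then have c: "c \<in> koszul_chains m 0" "Poly_Mapping.lookup (c {}) 0 = 0" by auto
  have "koszul_diff m c J = 0" for J
    unfolding koszul_diff_def
  proof (rule sum.neutral, rule ballI)
    fix j assume j: "j \<in> {1..m} - J"
    have "\<not> (insert j J \<subseteq> {1..m} \<and> card (insert j J) = 0)"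
      by (metis card_0_eq finite_atLeastAtMost finite_subset insert_not_empty)
    then have "c (insert j J) = 0" using c(1) unfolding koszul_chains_def by auto
    then show "(-1) ^ card {l \<in> J. l < j} * var j * c (insert j J) = 0" by simp
  qed
  then have "koszul_diff m (koszul_contract c) = c"
    using c by (intro koszul_diff_contract) auto
  then show "c \<in> koszul_boundaries m {0} 0"
    using c(1) koszul_contract_chain[OF c(1)]
    by (auto simp: koszul_boundaries_def intro!: bexI[of _ "koszul_contract c"])
qed

section \<open>Tightness\<close>

text \<open>\<open>Tor\<^sub>i\<close> vanishes for \<open>i > m\<close>, so this is the dimension of all of Tor of the Stanley--Reisner
  ring of the complex \<open>K\<close> with vertex set \<open>{1..m}\<close>. The first argument only carries the field.\<close>

definition total_bigraded_betti :: "'k::field itself \<Rightarrow> nat \<Rightarrow> nat set set \<Rightarrow> nat" where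
  "total_bigraded_betti _ m K = (\<Sum>i\<le>m. Tor_dim m (SR_ideal m K :: 'k mpoly set) i)"

text \<open>A complex on \<open>m\<close> vertices has dimension at most \<open>m - 1\<close>, so the conversion to \<open>nat\<close> does not
  truncate.\<close>

definition tight_complex :: "'k::field itself \<Rightarrow> nat \<Rightarrow> nat set set \<Rightarrow> bool" where
  "tight_complex F m K \<longleftrightarrow>
     total_bigraded_betti F m K = 2 ^ nat (int m - sc_dimension K - 1)"

end

theory Submission
  imports Defs
begin

text \<open>
  In squarefree multidegree \<open>W\<close> the Koszul complex of the Stanley--Reisner ring is, up to signs, the
  simplicial cochain complex of \<open>K\<^sub>W\<close>, and in the other multidegrees it is contractible; hence the
  total Betti number \<open>D(K)\<close> is the sum of the total Betti numbers of all \<open>K\<^sub>W\<close> (Hochster). The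
  exact triangle of \<open>lk(v)\<^sub>W\<close>, \<open>K\<^sub>W\<^sub>\<union>\<^sub>v\<close> and \<open>K\<^sub>W\<close> gives \<open>D(lk v) \<le> D(K)\<close>, with equality only if all
  restrictions \<open>H(K\<^sub>W\<^sub>\<union>\<^sub>v) \<rightarrow> H(K\<^sub>W)\<close> vanish. Passing to links along a facet with \<open>d + 1\<close> vertices
  leaves only the empty face on \<open>m - d - 1\<close> ghost vertices, so \<open>D(K) \<ge> 2\<^bsup>m-d-1\<^esup>\<close>.

  A complex is of the required form iff its minimal non-faces are pairwise disjoint. If \<open>K\<close> is tight
  and two minimal non-faces \<open>A \<noteq> B\<close> meet, take \<open>v \<in> B - A\<close>. The link of \<open>v\<close> is tight, and by the
  equality case \<open>A\<close> and \<open>B - v\<close> are minimal non-faces of it, which is impossible by induction.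
  Conversely, for pairwise disjoint minimal non-faces, \<open>K\<^sub>W\<close> is a cone unless \<open>W\<close> is a union of minimal
  non-faces, and then its total Betti number is at most \<open>1\<close>, again by passing to a link.
\<close>

section \<open>Dimensions of quotient spaces\<close>

text \<open>The obstacle is that the link of \<open>v\<close> lives on the ground set M - v, where
  vertices not joined to \<open>v\<close> survive as ghost vertices: they occur in the subsets W and
  are singleton minimal non-faces. Hence everything after Hochster's formula concerns a complex
  together with a ground set M containing its vertices. In exchange, the number of ground vertices
  outside a face is unchanged on passing to the link of one of its vertices, so the exponent m - d -
  1 is stable under the induction. Cohomology appears because the Koszul differential trades u_j for
  v_j and so enlarges the support of the monomial. The triangle is used without its grading: with
  ranks r1, r2, r3, the link contributes r1 + r3, the two full subcomplexes contribute (r1 + r2) +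
  (r2 + r3), and the gap is exactly twice the rank r2 of the restriction. Only A needs the equality
  case: B - v is a minimal non-face of the link directly from the definitions. For A, the full
  subcomplex on A is the boundary of a simplex, and the class that would survive restriction is the
  top class of that sphere.\<close>

definition has_qdim ::
    "('k::field \<Rightarrow> 'b::ab_group_add \<Rightarrow> 'b) \<Rightarrow> 'b set \<Rightarrow> 'b set \<Rightarrow> nat \<Rightarrow> bool" where
  "has_qdim scale Z B n \<longleftrightarrow> module.subspace scale Z \<and> module.subspace scale B \<and> B \<subseteq> Z \<and>
     (\<exists>X. finite X \<and> card X = n \<and> quotient_basis scale Z B X)"

context vector_space
begin

lemma independent_Un_of_span_Int:
  assumes "independent X" "independent Y" "span X \<inter> span Y \<subseteq> {0}"
  shows "independent (X \<union> Y)"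
proof -
  have *: "a \<notin> span (P \<union> Q - {a})"
    if "a \<in> P" "independent P" "span P \<inter> span Q \<subseteq> {0}" for a P Q
  proof
    assume "a \<in> span (P \<union> Q - {a})"
    also have "\<dots> \<subseteq> span ((P - {a}) \<union> Q)" by (rule span_mono) auto
    finally obtain u w where uw: "u \<in> span (P - {a})" "w \<in> span Q" "a = u + w"
      by (auto simp: span_Un)
    have "u \<in> span P" using uw(1) span_mono[of "P - {a}" P] by auto
    then have "a - u \<in> span P" using that(1) by (simp add: span_base span_diff)
    then have "a = u" using uw that(3) by auto
    then show False using uw(1) that(1,2) by (auto simp: dependent_def)
  qed
  show ?thesis
    unfolding dependent_def using *[of _ X Y] *[of _ Y X] assms
    by (metis Un_commute Un_iff inf_commute)
qed

text \<open>The linear map that fixes \<open>X\<close> and kills \<open>Y\<close> acts on a common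
  element of both spans as the identity and as zero.\<close>

lemma independent_Un_span_Int:
  assumes "independent (X \<union> Y)" "X \<inter> Y = {}"
  shows "span X \<inter> span Y = {0}"
proof -
  interpret vp: vector_space_pair scale scale by unfold_locales
  obtain g where g: "Vector_Spaces.linear scale scale g" "\<forall>x\<in>X \<union> Y. g x = (if x \<in> X then x else 0)"
    using vp.linear_independent_extend[OF assms(1), of "\<lambda>x. if x \<in> X then x else 0"] by blast
  have "x = 0" if "x \<in> span X" "x \<in> span Y" for x
  proof -
    have "g x = x"
      by (rule vp.linear_eq_on[OF g(1) linear_ident that(1)]) (use g(2) in auto)
    moreover have "g x = 0"
      by (rule vp.linear_eq_on[OF g(1) _ that(2)])
        (use g(2) assms(2) vp.module_hom_zero in \<open>auto simp: linear_iff_module_hom\<close>)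
    ultimately show ?thesis by simp
  qed
  then show ?thesis using span_zero by auto
qed

text \<open>A basis of \<open>B\<close> is extended to one of \<open>Z\<close>; the added vectors
  represent a basis of the quotient.\<close>

lemma quotient_basis_exists:
  assumes "subspace Z" "subspace B" "B \<subseteq> Z"
  obtains X where "quotient_basis scale Z B X"
proof -
  obtain Y where Y: "Y \<subseteq> B" "independent Y" "B \<subseteq> span Y"
    using maximal_independent_subset by blast
  obtain Y' where Y': "Y \<subseteq> Y'" "Y' \<subseteq> Z" "independent Y'" "Z \<subseteq> span Y'"
    using maximal_independent_subset_extend[OF _ Y(2), of Z] Y assms by blast
  have B: "span Y = B" using Y assms by (intro span_subspace)
  have "independent ((Y' - Y) \<union> Y)" using Y' by (simp add: Un_absorb2)
  then have "span (Y' - Y) \<inter> span Y = {0}" by (rule independent_Un_span_Int) auto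
  moreover have "independent (Y' - Y)" using independent_mono Y' by blast
  moreover have "span ((Y' - Y) \<union> B) = Z"
  proof (rule antisym)
    show "span ((Y' - Y) \<union> B) \<subseteq> Z" using Y' assms by (intro span_minimal) auto
    have "Y' \<subseteq> (Y' - Y) \<union> B" using Y by auto
    then show "Z \<subseteq> span ((Y' - Y) \<union> B)" using Y' span_mono by blast
  qed
  ultimately have "quotient_basis scale Z B (Y' - Y)"
    unfolding quotient_basis_def using Y' B by auto
  then show thesis using that by blast
qed

lemma quotient_basis_decompose:
  assumes "quotient_basis scale Z B X" "subspace B" "z \<in> Z"
  obtains x b where "x \<in> span X" "b \<in> B" "z = x + b"
proof -
  have "z \<in> span (X \<union> B)" using assms unfolding quotient_basis_def by simp
  then obtain x b where "x \<in> span X" "b \<in> span B" "z = x + b" by (auto simp: span_Un)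
  moreover have "span B = B" using assms(2) by (simp add: span_eq_iff)
  ultimately show thesis using that by simp
qed

text \<open>The linear map \<open>g\<close> that fixes \<open>X\<close> and kills a basis of
  \<open>B\<close> has kernel \<open>B\<close> on \<open>Z\<close> and maps \<open>Z\<close> into
  the span of \<open>X\<close>. It is therefore injective on the span of \<open>X'\<close>, and
  independence of the image of \<open>X'\<close> gives the bound.\<close>

lemma quotient_basis_card_le:
  assumes B: "subspace B" and X: "quotient_basis scale Z B X" "finite X"
    and X': "quotient_basis scale Z B X'"
  shows "finite X' \<and> card X' \<le> card X"
proof -
  interpret vp: vector_space_pair scale scale by unfold_locales
  obtain Y where Y: "Y \<subseteq> B" "independent Y" "B \<subseteq> span Y"
    using maximal_independent_subset by blast
  have spY: "span Y = B" using Y B by (intro span_subspace)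
  have ind: "independent (X \<union> Y)"
    using X Y(2) by (intro independent_Un_of_span_Int) (auto simp: quotient_basis_def spY)
  have disj: "X \<inter> Y = {}"
  proof -
    have "x \<notin> Y" if "x \<in> X" for x
    proof
      assume "x \<in> Y"
      then have "x \<in> span X \<inter> B" using that Y span_base by auto
      then have "x = 0" using X by (auto simp: quotient_basis_def)
      then show False using Y(2) \<open>x \<in> Y\<close> dependent_zero by blast
    qed
    then show ?thesis by auto
  qed
  obtain g where g: "Vector_Spaces.linear scale scale g" "\<forall>x\<in>X \<union> Y. g x = (if x \<in> X then x else 0)"
    using vp.linear_independent_extend[OF ind, of "\<lambda>x. if x \<in> X then x else 0"] by blast
  interpret g: Vector_Spaces.linear scale scale g by (rule g(1))
  have gX: "g x = x" if "x \<in> span X" for x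
    by (rule vp.linear_eq_on[OF g(1) linear_ident that]) (use g(2) in auto)
  have gB: "g x = 0" if "x \<in> B" for x
    by (rule vp.linear_eq_on[OF g(1) _ that[folded spY]])
        (use g(2) disj vp.module_hom_zero in \<open>auto simp: linear_iff_module_hom\<close>)
  have X'Z: "span X' \<subseteq> Z"
    using X' span_mono[of X' "X' \<union> B"] by (auto simp: quotient_basis_def)
  have dec: "g z \<in> span X \<and> (g z = 0 \<longrightarrow> z \<in> B)" if "z \<in> Z" for z
  proof -
    obtain x b where "x \<in> span X" "b \<in> B" "z = x + b"
      using quotient_basis_decompose[OF X(1) B \<open>z \<in> Z\<close>] .
    then show ?thesis using gX gB by (auto simp: g.add)
  qed
  have "inj_on g (span X')"
    unfolding g.inj_on_iff_eq_0[OF subspace_span]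
    using dec X'Z X' by (fastforce simp: quotient_basis_def)
  then have "independent (g ` X')"
    using X' by (intro g.independent_injective_image) (auto simp: quotient_basis_def)
  moreover have "g ` X' \<subseteq> span X" using dec X'Z span_base by blast
  ultimately have "finite (g ` X') \<and> card (g ` X') \<le> card X"
    using X(2) by (intro independent_span_bound)
  moreover have "inj_on g X'" using \<open>inj_on g (span X')\<close> span_superset inj_on_subset by blast
  ultimately show ?thesis by (simp add: card_image finite_image_iff)
qed

lemma has_qdim_unique:
  assumes "has_qdim scale Z B m" "has_qdim scale Z B n"
  shows "m = n"
  using assms unfolding has_qdim_def by (metis quotient_basis_card_le le_antisym)

text \<open>\<open>quotient_dim\<close> is the cardinality of a chosen set and would be 0 for an
  infinite basis. The dimension counts are therefore made with \<open>has_qdim\<close>, which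
  carries finiteness along, and are transferred through this lemma.\<close>

lemma has_qdim_quotient_dim:
  assumes "has_qdim scale Z B n"
  shows "quotient_dim scale Z B = n"
proof -
  obtain X where X: "finite X" "card X = n" "quotient_basis scale Z B X" "subspace B"
    using assms unfolding has_qdim_def by blast
  define X' where "X' = (SOME X. quotient_basis scale Z B X)"
  have X': "quotient_basis scale Z B X'" unfolding X'_def by (rule someI[of _ X]) (rule X)
  then have "card X' = n"
    using X quotient_basis_card_le[OF X(4)] by (metis le_antisym)
  then show ?thesis unfolding quotient_dim_def X'_def .
qed

text \<open>Behind the additivity of dimension along a chain of subspaces: since \<open>Y\<close>
  and \<open>B\<close> together span \<open>C\<close>, adjoining them to \<open>X\<close> has the
  same effect as adjoining \<open>C\<close>.\<close>

lemma quotient_basis_Un: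
  assumes sub: "subspace B" "subspace C" "B \<subseteq> C"
    and X: "quotient_basis scale Z C X" and Y: "quotient_basis scale C B Y"
  shows "quotient_basis scale Z B (X \<union> Y)" "X \<inter> Y = {}"
proof -
  have Y_C: "span Y \<subseteq> C" using Y span_mono[of Y "Y \<union> B"] by (auto simp: quotient_basis_def)
  have CZ: "C \<subseteq> Z" and XZ: "X \<subseteq> Z"
    using X span_superset[of "X \<union> C"] by (auto simp: quotient_basis_def)
  have X0: "span X \<inter> C = {0}" and Y0: "span Y \<inter> B = {0}"
    using X Y by (auto simp: quotient_basis_def)
  have "independent (X \<union> Y)"
    using X Y Y_C X0 by (intro independent_Un_of_span_Int) (auto simp: quotient_basis_def)
  moreover have "span (X \<union> Y) \<inter> B = {0}"
  proof -
    have "z = 0" if z: "z \<in> span (X \<union> Y)" "z \<in> B" for z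
    proof -
      obtain x y where xy: "x \<in> span X" "y \<in> span Y" "z = x + y"
        using z(1) by (auto simp: span_Un)
      have "z - y \<in> C" using xy Y_C z sub by (intro subspace_diff) auto
      then have "x \<in> span X \<inter> C" using xy by auto
      then have "x = 0" using X0 by auto
      then show ?thesis using xy z Y0 by auto
    qed
    then show ?thesis using sub subspace_0 span_zero by blast
  qed
  moreover have "span (X \<union> Y \<union> B) = Z"
  proof -
    have "span (X \<union> (Y \<union> B)) = {x + y |x y. x \<in> span X \<and> y \<in> span (Y \<union> B)}"
      by (rule span_Un)
    also have "span (Y \<union> B) = span C"
      using Y sub(2) by (metis quotient_basis_def span_eq_iff)
    also have "{x + y |x y. x \<in> span X \<and> y \<in> span C} = span (X \<union> C)"
      by (rule span_Un[symmetric])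
    also have "\<dots> = Z" using X by (simp add: quotient_basis_def)
    finally show ?thesis by (simp add: Un_assoc)
  qed
  moreover have "X \<union> Y \<subseteq> Z" using XZ CZ Y by (auto simp: quotient_basis_def)
  ultimately show "quotient_basis scale Z B (X \<union> Y)" by (simp add: quotient_basis_def)
  have "x \<notin> Y" if "x \<in> X" for x
  proof
    assume "x \<in> Y"
    then have "x \<in> span X \<inter> C" using that Y by (auto simp: quotient_basis_def intro: span_base)
    then show False using X0 \<open>x \<in> X\<close> X dependent_zero by (auto simp: quotient_basis_def)
  qed
  then show "X \<inter> Y = {}" by auto
qed

lemma has_qdim_trans:
  assumes "has_qdim scale Z C m" "has_qdim scale C B n"
  shows "has_qdim scale Z B (m + n)"
proof -
  obtain X Y where X: "finite X" "card X = m" "quotient_basis scale Z C X"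
    and Y: "finite Y" "card Y = n" "quotient_basis scale C B Y"
    using assms unfolding has_qdim_def by blast
  have "subspace B" "subspace C" "B \<subseteq> C" using assms unfolding has_qdim_def by auto
  from quotient_basis_Un[OF this X(3) Y(3)] X Y assms show ?thesis
    unfolding has_qdim_def by (intro conjI exI[of _ "X \<union> Y"]) (auto simp: card_Un_disjoint)
qed

text \<open>Finite dimension of the whole forces it for both pieces. In the exact triangle this
  produces the ranks.\<close>

lemma has_qdim_split:
  assumes "has_qdim scale Z B n" "subspace C" "B \<subseteq> C" "C \<subseteq> Z"
  obtains p q where "has_qdim scale Z C p" "has_qdim scale C B q" "n = p + q"
proof -
  have s: "subspace Z" "subspace B" using assms unfolding has_qdim_def by auto
  obtain X where X: "quotient_basis scale Z C X"
    using quotient_basis_exists[OF s(1) assms(2,4)] .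
  obtain Y where Y: "quotient_basis scale C B Y"
    using quotient_basis_exists[OF assms(2) s(2) assms(3)] .
  note Un = quotient_basis_Un[OF s(2) assms(2,3) X Y]
  obtain V where V: "finite V" "card V = n" "quotient_basis scale Z B V"
    using assms unfolding has_qdim_def by blast
  have "finite (X \<union> Y)" using quotient_basis_card_le[OF s(2) V(3,1) Un(1)] by auto
  then have "has_qdim scale Z C (card X)" "has_qdim scale C B (card Y)"
    unfolding has_qdim_def using X Y s assms by auto
  moreover from this have "n = card X + card Y"
    using has_qdim_unique[OF assms(1) has_qdim_trans] by blast
  ultimately show thesis using that by blast
qed

lemma has_qdim_0_iff:
  "has_qdim scale Z B 0 \<longleftrightarrow> subspace Z \<and> Z = B"
proof
  assume "has_qdim scale Z B 0"
  then have "subspace Z" "subspace B" "quotient_basis scale Z B {}"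
    unfolding has_qdim_def by (auto simp: card_eq_0_iff)
  then show "subspace Z \<and> Z = B"
    using span_eq_iff[of B] by (simp add: quotient_basis_def)
next
  assume *: "subspace Z \<and> Z = B"
  then have "quotient_basis scale Z B {}"
    using subspace_0[of B] span_eq_iff[of B] independent_empty by (auto simp: quotient_basis_def)
  with * show "has_qdim scale Z B 0"
    unfolding has_qdim_def by (intro conjI exI[of _ "{}"]) auto
qed

lemma has_qdim_of_finite_span:
  assumes "subspace Z" "subspace B" "B \<subseteq> Z" "Z \<subseteq> span T" "finite T"
  obtains n where "has_qdim scale Z B n" "n \<le> card T"
proof -
  obtain X where X: "quotient_basis scale Z B X"
    using quotient_basis_exists[OF assms(1-3)] .
  then have "finite X \<and> card X \<le> card T"
    using assms by (intro independent_span_bound) (auto simp: quotient_basis_def)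
  then show thesis using X assms that[of "card X"] unfolding has_qdim_def by auto
qed

end

text \<open>The hypotheses say that \<open>f\<close> induces an isomorphism of Z/B with Z'/B': the
  equivalence for membership in \<open>B'\<close> gives well-definedness and injectivity, and
  \<open>onto\<close> is surjectivity modulo \<open>B'\<close>.\<close>

lemma quotient_basis_map:
  assumes lin: "Vector_Spaces.linear s1 s2 f"
    and X: "quotient_basis s1 Z B X"
    and sB: "module.subspace s1 B" "B \<subseteq> Z"
    and Z': "module.subspace s2 Z'" "module.subspace s2 B'" "B' \<subseteq> Z'"
    and f: "\<And>z. z \<in> Z \<Longrightarrow> f z \<in> Z'" "\<And>z. z \<in> Z \<Longrightarrow> f z \<in> B' \<longleftrightarrow> z \<in> B"
    and onto: "\<And>z'. z' \<in> Z' \<Longrightarrow> \<exists>z\<in>Z. z' - f z \<in> B'"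
  shows "quotient_basis s2 Z' B' (f ` X)" "inj_on f X"
proof -
  interpret f: Vector_Spaces.linear s1 s2 f by (rule lin)
  have XZ: "f.vs1.span X \<subseteq> Z"
    using X f.vs1.span_mono[of X "X \<union> B"] by (auto simp: quotient_basis_def)
  have X0: "f.vs1.span X \<inter> B = {0}" using X by (auto simp: quotient_basis_def)
  have zB': "0 \<in> B'" using Z'(2) f.vs2.subspace_0 by blast
  have inj: "inj_on f (f.vs1.span X)"
    unfolding f.inj_on_iff_eq_0[OF f.vs1.subspace_span]
  proof (intro ballI impI)
    fix x assume x: "x \<in> f.vs1.span X" "f x = 0"
    then have "x \<in> B" using f(2)[of x] XZ zB' by auto
    then show "x = 0" using x X0 by auto
  qed
  have "f.vs2.independent (f ` X)"
    using X inj by (intro f.independent_injective_image) (auto simp: quotient_basis_def)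
  moreover have "f.vs2.span (f ` X) \<inter> B' = {0}"
  proof (rule antisym)
    show "f.vs2.span (f ` X) \<inter> B' \<subseteq> {0}"
    proof
      fix y assume "y \<in> f.vs2.span (f ` X) \<inter> B'"
      then obtain x where x: "x \<in> f.vs1.span X" "y = f x" "f x \<in> B'"
        by (auto simp: f.span_image)
      then have "x \<in> B" using f(2)[of x] XZ by auto
      then have "x = 0" using x X0 by auto
      then show "y \<in> {0}" using x f.zero by auto
    qed
  qed (use zB' f.vs2.span_zero in auto)
  moreover have fXZ: "f ` X \<subseteq> Z'" using f(1) XZ f.vs1.span_superset by blast
  moreover have "f.vs2.span (f ` X \<union> B') = Z'"
  proof (rule antisym)
    show "f.vs2.span (f ` X \<union> B') \<subseteq> Z'" using fXZ Z' by (intro f.vs2.span_minimal) auto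
    show "Z' \<subseteq> f.vs2.span (f ` X \<union> B')"
    proof
      fix z' assume "z' \<in> Z'"
      then obtain z where z: "z \<in> Z" "z' - f z \<in> B'" using onto by blast
      obtain x b where xb: "x \<in> f.vs1.span X" "b \<in> B" "z = x + b"
        using f.vs1.quotient_basis_decompose[OF X sB(1) z(1)] .
      have "b \<in> Z" using \<open>b \<in> B\<close> sB by auto
      then have "f b \<in> B'" using f(2) xb by auto
      then have "f b + (z' - f z) \<in> B'" using z Z' f.vs2.subspace_add by blast
      moreover have "z' = f x + (f b + (z' - f z))" using xb by (simp add: f.add)
      moreover have "f x \<in> f.vs2.span (f ` X)" using xb by (simp add: f.span_image)
      ultimately show "z' \<in> f.vs2.span (f ` X \<union> B')"
        unfolding f.vs2.span_Un using f.vs2.span_base by blast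
    qed
  qed
  ultimately show "quotient_basis s2 Z' B' (f ` X)" unfolding quotient_basis_def by simp
  show "inj_on f X" using inj f.vs1.span_superset inj_on_subset by blast
qed

lemma has_qdim_map_iff:
  assumes lin: "Vector_Spaces.linear s1 s2 f"
    and Z: "module.subspace s1 Z" "module.subspace s1 B" "B \<subseteq> Z"
    and Z': "module.subspace s2 Z'" "module.subspace s2 B'" "B' \<subseteq> Z'"
    and f: "\<And>z. z \<in> Z \<Longrightarrow> f z \<in> Z'" "\<And>z. z \<in> Z \<Longrightarrow> f z \<in> B' \<longleftrightarrow> z \<in> B"
    and onto: "\<And>z'. z' \<in> Z' \<Longrightarrow> \<exists>z\<in>Z. z' - f z \<in> B'"
  shows "has_qdim s1 Z B n \<longleftrightarrow> has_qdim s2 Z' B' n"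
proof -
  interpret f: Vector_Spaces.linear s1 s2 f by (rule lin)
  note map = quotient_basis_map[OF lin _ Z(2,3) Z' f onto]
  show ?thesis
  proof
    assume "has_qdim s1 Z B n"
    then obtain X where "finite X" "card X = n" "quotient_basis s1 Z B X"
      unfolding has_qdim_def by blast
    with map[of X] show "has_qdim s2 Z' B' n"
      unfolding has_qdim_def using Z' by (intro conjI exI[of _ "f ` X"]) (auto simp: card_image)
  next
    assume *: "has_qdim s2 Z' B' n"
    obtain X where X: "quotient_basis s1 Z B X" using f.vs1.quotient_basis_exists[OF Z] .
    obtain Y where "finite Y" "quotient_basis s2 Z' B' Y"
      using * unfolding has_qdim_def by blast
    then have "finite (f ` X)" using f.vs2.quotient_basis_card_le[OF Z'(2)] map(1)[OF X] by blast
    then have "finite X" using map(2)[OF X] finite_imageD by blast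
    then have "has_qdim s2 Z' B' (card X)"
      unfolding has_qdim_def using Z' map[OF X]
      by (intro conjI exI[of _ "f ` X"]) (auto simp: card_image)
    then have "card X = n" using * f.vs2.has_qdim_unique by blast
    then show "has_qdim s1 Z B n" unfolding has_qdim_def using X Z \<open>finite X\<close> by auto
  qed
qed

text \<open>For maps that jointly identify Z/B with a direct sum of quotients. It serves twice: for
  cochains split by degree and for Koszul chains split by multidegree. The induction splits off one
  summand, \<open>C\<close> being the subspace whose component at \<open>s\<close> is
  trivial.\<close>

lemma has_qdim_direct_sum:
  assumes fin: "finite S" and v1: "vector_space s1" and v2: "vector_space s2"
    and lin: "\<And>s. s \<in> S \<Longrightarrow> Vector_Spaces.linear s1 s2 (f s)"
    and Z: "module.subspace s1 Z" and B: "module.subspace s1 B" "B \<subseteq> Z"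
    and Z': "\<And>s. s \<in> S \<Longrightarrow> has_qdim s2 (Z' s) (B' s) (n s)"
    and f: "\<And>s z. s \<in> S \<Longrightarrow> z \<in> Z \<Longrightarrow> f s z \<in> Z' s"
      "\<And>z. z \<in> Z \<Longrightarrow> z \<in> B \<longleftrightarrow> (\<forall>s\<in>S. f s z \<in> B' s)"
    and onto: "\<And>y. (\<And>s. s \<in> S \<Longrightarrow> y s \<in> Z' s) \<Longrightarrow> \<exists>z\<in>Z. \<forall>s\<in>S. f s z - y s \<in> B' s"
  shows "has_qdim s1 Z B (\<Sum>s\<in>S. n s)"
  using assms
proof (induction S arbitrary: Z rule: finite_induct)
  case empty
  interpret vector_space s1 by (rule v1)
  have "Z = B" using empty by auto
  then show ?case using empty by (simp add: has_qdim_0_iff)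
next
  case (insert s S)
  interpret v1: vector_space s1 by (rule v1)
  interpret v2: vector_space s2 by (rule v2)
  interpret f: Vector_Spaces.linear s1 s2 "f s" using insert by simp
  note Z's = insert.prems(7)
  have sub: "v2.subspace (Z' t)" "v2.subspace (B' t)" "B' t \<subseteq> Z' t" if "t \<in> insert s S" for t
    using Z's[OF that] by (auto simp: has_qdim_def)
  define C where "C = {z \<in> Z. f s z \<in> B' s}"
  have sC: "v1.subspace C"
    unfolding C_def
    using v1.subspace_inter[OF insert.prems(4) f.subspace_linear_preimage[OF sub(2)[of s]]]
    by (simp add: Collect_conj_eq)
  have "has_qdim s2 (Z' s) (B' s) (n s)" using Z's by simp
  then have "has_qdim s1 Z C (n s)"
  proof (subst has_qdim_map_iff[of s1 s2 "f s" Z C "Z' s" "B' s"])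
    show "\<exists>z\<in>Z. y - f s z \<in> B' s" if y: "y \<in> Z' s" for y
    proof -
      have "\<exists>z\<in>Z. \<forall>t\<in>insert s S. f t z - (if t = s then y else 0) \<in> B' t"
        by (rule insert.prems(10)) (use y sub v2.subspace_0 in auto)
      then obtain z where "z \<in> Z" "f s z - y \<in> B' s" by auto
      then show ?thesis using v2.subspace_neg[OF sub(2), of s "f s z - y"] by auto
    qed
  qed (use insert.prems sub[of s] sC f.linear_axioms in \<open>auto simp: C_def\<close>)
  moreover have "has_qdim s1 C B (\<Sum>t\<in>S. n t)"
  proof (rule insert.IH)
    fix y assume y: "\<And>t. t \<in> S \<Longrightarrow> y t \<in> Z' t"
    have "\<exists>z\<in>Z. \<forall>t\<in>insert s S. f t z - (if t = s then 0 else y t) \<in> B' t"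
      by (rule insert.prems(10)) (use y sub v2.subspace_0 in auto)
    then obtain z where z: "z \<in> Z" "\<forall>t\<in>insert s S. f t z - (if t = s then 0 else y t) \<in> B' t"
      by blast
    then show "\<exists>z\<in>C. \<forall>t\<in>S. f t z - y t \<in> B' t"
      using insert.hyps by (intro bexI[of _ z]) (auto simp: C_def split: if_splits)
  qed (use insert.prems sC in \<open>auto simp: C_def\<close>)
  ultimately show ?case using insert.hyps v1.has_qdim_trans by simp
qed

text \<open>Dimension form of the exact triangle \<open>H(L) \<rightarrow> H(X) \<rightarrow> H(Q) \<rightarrow> H(L)\<close> of a subcomplex \<open>L\<close>
  of \<open>X\<close> with a complement \<open>Q\<close>, onto which \<open>P\<close> projects; \<open>r\<^sub>1\<close>, \<open>r\<^sub>2\<close>, \<open>r\<^sub>3\<close> are the ranks of the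
  three maps.\<close>

lemma exact_triangle:
  assumes v: "vector_space s"
    and lin: "Vector_Spaces.linear s s d" "Vector_Spaces.linear s s P"
    and sub: "module.subspace s X" "module.subspace s L" "module.subspace s Q"
    and LX: "L \<subseteq> X" and QX: "Q \<subseteq> X"
    and d: "d ` X \<subseteq> X" "d ` L \<subseteq> L" "\<And>x. x \<in> X \<Longrightarrow> d (d x) = 0"
    and P: "\<And>x. x \<in> X \<Longrightarrow> P x \<in> Q" "\<And>x. x \<in> X \<Longrightarrow> x - P x \<in> L" "\<And>x. x \<in> L \<Longrightarrow> P x = 0"
      "\<And>x. x \<in> Q \<Longrightarrow> P x = x"
    and hX: "has_qdim s {x\<in>X. d x = 0} (d ` X) hX"
    and hL: "has_qdim s {x\<in>L. d x = 0} (d ` L) hL"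
    and hQ: "has_qdim s {x\<in>Q. P (d x) = 0} ((\<lambda>x. P (d x)) ` Q) hQ"
  obtains r1 r2 r3 where "hX = r1 + r2" "hQ = r2 + r3" "hL = r1 + r3"
    "r2 = 0 \<longleftrightarrow> P ` {x\<in>X. d x = 0} \<subseteq> (\<lambda>x. P (d x)) ` Q"
proof -
  interpret vector_space s by (rule v)
  interpret d: Vector_Spaces.linear s s d by (rule lin)
  interpret P: Vector_Spaces.linear s s P by (rule lin)
  define ZX ZL ZQ where "ZX = {x\<in>X. d x = 0}" and "ZL = {x\<in>L. d x = 0}"
    and "ZQ = {x\<in>Q. P (d x) = 0}"
  define BX BL BQ where "BX = d ` X" and "BL = d ` L" and "BQ = (\<lambda>x. P (d x)) ` Q"
  note defs = ZX_def ZL_def ZQ_def BX_def BL_def BQ_def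
  \<comment> \<open>\<open>C\<close> modulo \<open>BX\<close> is the image of H(L) in H(X) and, by
    exactness, the kernel of the map to H(Q). Likewise the intersection of \<open>ZL\<close> and
    \<open>BX\<close>, modulo \<open>BL\<close>, is the kernel of H(L) to H(X) and the image of the
    connecting map.\<close>
  define C where "C = {x + y |x y. x \<in> ZL \<and> y \<in> BX}"
  have sB: "subspace ZX" "subspace ZL" "subspace ZQ" "subspace BX" "subspace BL" "subspace BQ"
    using hX hL hQ by (auto simp: has_qdim_def defs)
  have ZB: "BX \<subseteq> ZX" "BL \<subseteq> ZL" "BQ \<subseteq> ZQ"
    using hX hL hQ by (auto simp: has_qdim_def defs)
  have sC: "subspace C" unfolding C_def by (rule subspace_sums[OF sB(2,4)])
  have C0: "0 \<in> ZL" "0 \<in> BX" "0 \<in> BQ" using sB subspace_0 by auto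
  have dL: "d x \<in> L" if "x \<in> L" for x using d(2) that by auto
  \<comment> \<open>The part \<open>x - P x\<close> lies in \<open>L\<close>, which \<open>d\<close>
    preserves and \<open>P\<close> kills. So \<open>P\<close> is a chain map to \<open>Q\<close>
    with differential P d.\<close>
  have Pd: "P (d (P x)) = P (d x)" if "x \<in> X" for x
  proof -
    have "P (d (x - P x)) = 0" using P(2,3) dL that by blast
    then show ?thesis by (simp add: d.diff P.diff)
  qed
  have PZ: "subspace (P ` ZX)" "P ` ZX \<subseteq> ZQ" "BQ \<subseteq> P ` ZX"
  proof -
    show "subspace (P ` ZX)" using P.subspace_image sB by blast
    show "P ` ZX \<subseteq> ZQ" using P(1) Pd P.zero by (auto simp: defs)
    show "BQ \<subseteq> P ` ZX" using d QX by (auto simp: defs intro!: imageI)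
  qed
  have subs: "C \<subseteq> ZX" "BX \<subseteq> C" "ZL \<subseteq> C"
  proof -
    have "ZL \<subseteq> ZX" using LX by (auto simp: defs)
    then show "C \<subseteq> ZX" using ZB sB(1) by (auto simp: C_def intro!: subspace_add)
    show "BX \<subseteq> C" "ZL \<subseteq> C" using C0 by (force simp: C_def)+
  qed
  obtain r2 r1 where r: "has_qdim s ZX C r2" "has_qdim s C BX r1" "hX = r2 + r1"
    using has_qdim_split[OF hX[folded defs] sC] subs by blast
  have sI: "subspace (ZL \<inter> BX)" using sB subspace_inter by blast
  have BLI: "BL \<subseteq> ZL \<inter> BX" using ZB LX by (auto simp: defs)
  obtain r1' r3 where r3: "has_qdim s ZL (ZL \<inter> BX) r1'" "has_qdim s (ZL \<inter> BX) BL r3" "hL = r1' + r3"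
    using has_qdim_split[OF hL[folded defs] sI] BLI by blast
  obtain r3' r2' where r2: "has_qdim s ZQ (P ` ZX) r3'" "has_qdim s (P ` ZX) BQ r2'" "hQ = r3' + r2'"
    using has_qdim_split[OF hQ[folded defs] PZ(1)] PZ by blast
  \<comment> \<open>Second isomorphism theorem: the rank of H(L) to H(X), read off at either
    end.\<close>
  have "has_qdim s ZL (ZL \<inter> BX) n \<longleftrightarrow> has_qdim s C BX n" for n
  proof (rule has_qdim_map_iff[OF linear_ident])
    fix z' assume "z' \<in> C"
    then obtain x y where "x \<in> ZL" "y \<in> BX" "z' = x + y" unfolding C_def by blast
    then show "\<exists>z\<in>ZL. z' - z \<in> BX" by (intro bexI[of _ x]) auto
  qed (use sB sC sI subs in auto)
  then have r1_eq: "r1' = r1" using r r3 has_qdim_unique by blast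
  \<comment> \<open>Exactness at H(X): if \<open>P z = P (d x)\<close>, then \<open>z - d x\<close>
    is a cycle lying in \<open>L\<close>.\<close>
  have "has_qdim s ZX C n \<longleftrightarrow> has_qdim s (P ` ZX) BQ n" for n
  proof (rule has_qdim_map_iff[OF lin(2)])
    fix z assume z: "z \<in> ZX"
    show "P z \<in> BQ \<longleftrightarrow> z \<in> C"
    proof
      assume "P z \<in> BQ"
      then obtain x where x: "x \<in> Q" "P z = P (d x)" by (auto simp: defs)
      have dx: "d x \<in> BX" "d x \<in> ZX" using x QX d by (auto simp: defs)
      then have zd: "z - d x \<in> ZX" using z sB subspace_diff by blast
      have "P (z - d x) = 0" using x by (simp add: P.diff)
      then have "z - d x \<in> L" using P(2)[of "z - d x"] zd by (auto simp: defs)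
      then have "z - d x \<in> ZL" using zd by (auto simp: defs)
      then have "(z - d x) + d x \<in> C" unfolding C_def using dx by blast
      then show "z \<in> C" by simp
    next
      assume "z \<in> C"
      then obtain l x where "l \<in> ZL" "x \<in> X" "z = l + d x" unfolding C_def defs by blast
      then have "P z = P (d (P x))" using Pd P(3) by (auto simp: P.add defs)
      then show "P z \<in> BQ" using P(1) \<open>x \<in> X\<close> by (auto simp: defs)
    qed
  next
    fix z' assume "z' \<in> P ` ZX"
    then show "\<exists>z\<in>ZX. z' - P z \<in> BQ" using C0 by force
  qed (use sB sC PZ subs in auto)
  then have r2_eq: "r2' = r2" using r r2 has_qdim_unique by blast
  \<comment> \<open>The connecting map is induced by \<open>d\<close> itself, since
    \<open>P (d z) = 0\<close> puts \<open>d z\<close> into \<open>L\<close>.\<close>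
  have "has_qdim s ZQ (P ` ZX) n \<longleftrightarrow> has_qdim s (ZL \<inter> BX) BL n" for n
  proof (rule has_qdim_map_iff[OF lin(1)])
    fix z assume z: "z \<in> ZQ"
    then have zX: "z \<in> X" "P (d z) = 0" using QX by (auto simp: defs)
    then have "d z \<in> X" using d by auto
    then have "d z \<in> L" using P(2)[of "d z"] zX by auto
    then show "d z \<in> ZL \<inter> BX" using zX d by (auto simp: defs)
    show "d z \<in> BL \<longleftrightarrow> z \<in> P ` ZX"
    proof
      assume "d z \<in> BL"
      then obtain l where l: "l \<in> L" "d z = d l" by (auto simp: defs)
      then have "z - l \<in> ZX" using zX LX sub by (auto simp: defs d.diff intro: subspace_diff)
      moreover have "P (z - l) = z" using l P(3,4) z by (auto simp: P.diff defs)
      ultimately show "z \<in> P ` ZX" by (metis imageI)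
    next
      assume "z \<in> P ` ZX"
      then obtain x where x: "x \<in> X" "d x = 0" "z = P x" by (auto simp: defs)
      then have "x - z \<in> L" using P(2) by auto
      moreover have "d z = d (- (x - z))" using x by (simp add: d.diff d.neg)
      ultimately show "d z \<in> BL"
        using subspace_neg[OF sub(2)] unfolding BL_def by (metis imageI)
    qed
  next
    fix y assume y: "y \<in> ZL \<inter> BX"
    then obtain x where x: "x \<in> X" "y = d x" "d x \<in> L" by (auto simp: defs)
    have "P (d (P x)) = 0" using Pd x P(3) by auto
    then have "P x \<in> ZQ" using P(1) x by (auto simp: defs)
    moreover have "y - d (P x) = d (x - P x)" using x by (simp add: d.diff)
    then have "y - d (P x) \<in> BL" using P(2) x by (auto simp: defs)
    ultimately show "\<exists>z\<in>ZQ. y - d z \<in> BL" by blast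
  qed (use sB sI PZ BLI in auto)
  then have r3_eq: "r3' = r3" using r3 r2 has_qdim_unique by blast
  show thesis
  proof (rule that)
    show "r2 = 0 \<longleftrightarrow> P ` {x \<in> X. d x = 0} \<subseteq> (\<lambda>x. P (d x)) ` Q"
      using r2 r2_eq PZ has_qdim_0_iff has_qdim_unique[of "P ` ZX" BQ] unfolding defs
      by (metis (no_types, lifting) subset_antisym order_refl)
  qed (use r r2 r3 r1_eq r2_eq r3_eq in auto)
qed

section \<open>Simplicial cochains\<close>

definition scale_fun :: "'k::field \<Rightarrow> ('a \<Rightarrow> 'k) \<Rightarrow> 'a \<Rightarrow> 'k" where
  "scale_fun a f = (\<lambda>x. a * f x)"

interpretation cochain: vector_space scale_fun
  by standard (simp_all add: scale_fun_def fun_eq_iff algebra_simps)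

text \<open>Convex families instead of complexes: the faces through a fixed vertex are not a
  subcomplex but carry relative cochains, and convexity is what makes the coboundary square to
  zero.\<close>

definition face_family :: "'v set set \<Rightarrow> bool" where
  "face_family X \<longleftrightarrow> finite X \<and> (\<forall>\<sigma>\<in>X. finite \<sigma>) \<and>
     (\<forall>\<sigma>\<in>X. \<forall>\<rho>\<in>X. \<forall>\<tau>. \<sigma> \<subseteq> \<tau> \<longrightarrow> \<tau> \<subseteq> \<rho> \<longrightarrow> \<tau> \<in> X)"

text \<open>The sign of the position of \<open>j\<close> in \<sigma>. It is meaningful also for
  \<open>j\<close> outside \<sigma>, as it occurs in the Koszul homotopy.\<close>

definition incidence :: "'v::linorder set \<Rightarrow> 'v \<Rightarrow> 'k::field" where
  "incidence \<sigma> j = (-1) ^ card {l\<in>\<sigma>. l < j}"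

definition coboundary :: "'v::linorder set set \<Rightarrow> ('v set \<Rightarrow> 'k::field) \<Rightarrow> 'v set \<Rightarrow> 'k" where
  "coboundary X c \<sigma> = (if \<sigma> \<in> X then \<Sum>j\<in>\<sigma>. incidence \<sigma> j * c (\<sigma> - {j}) else 0)"

definition cochains :: "'a set \<Rightarrow> ('a \<Rightarrow> 'k::field) set" where
  "cochains X = {c. \<forall>\<sigma>. \<sigma> \<notin> X \<longrightarrow> c \<sigma> = 0}"

definition cocycles :: "'v::linorder set set \<Rightarrow> ('v set \<Rightarrow> 'k::field) set" where
  "cocycles X = {c \<in> cochains X. coboundary X c = 0}"

definition coboundaries :: "'v::linorder set set \<Rightarrow> ('v set \<Rightarrow> 'k::field) set" where
  "coboundaries X = coboundary X ` cochains X"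

text \<open>The sum over all degrees, where a cochain on the faces with \<open>k\<close> vertices has degree
  \<open>k - 1\<close>.\<close>

definition total_betti :: "'k::field itself \<Rightarrow> 'v::linorder set set \<Rightarrow> nat" where
  "total_betti _ X =
     quotient_dim scale_fun (cocycles X :: ('v set \<Rightarrow> 'k) set) (coboundaries X)"

lemma linear_scale_funI:
  assumes "\<And>x y. f (x + y) = f x + f y" "\<And>a x. f (scale_fun a x) = scale_fun a (f x)"
  shows "Vector_Spaces.linear scale_fun scale_fun f"
  using assms by unfold_locales

lemma incidence_square [simp]: "incidence \<sigma> j * incidence \<sigma> j = 1"
  by (simp add: incidence_def flip: power_add mult_2)

lemma sum_apply: "sum f A x = (\<Sum>a\<in>A. f a x)"
  by (induction A rule: infinite_finite_induct) auto

lemma card_less_Diff: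
  assumes "finite \<sigma>" "i \<in> \<sigma>"
  shows "card {l\<in>\<sigma>. l < j} = card {l\<in>\<sigma> - {i}. l < (j::'v::linorder)} + (if i < j then 1 else 0)"
proof (cases "i < j")
  case True
  then have "{l\<in>\<sigma>. l < j} = insert i {l\<in>\<sigma> - {i}. l < j}" using assms by auto
  then show ?thesis using assms True by simp
next
  case False
  then have "{l\<in>\<sigma>. l < j} = {l\<in>\<sigma> - {i}. l < j}" by auto
  then show ?thesis using False by simp
qed

lemma incidence_Diff:
  assumes "finite \<sigma>" "i \<in> \<sigma>"
  shows "(incidence \<sigma> j :: 'k::field) = (if i < j then -1 else 1) * incidence (\<sigma> - {i}) j"
  unfolding incidence_def card_less_Diff[OF assms, of j] by simp

text \<open>If \<open>i < j\<close>, deleting \<open>i\<close> lowers the position of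
  \<open>j\<close> by one, while deleting \<open>j\<close> leaves that of \<open>i\<close>
  unchanged. So the two orders of deletion differ in exactly one sign.\<close>

lemma incidence_swap:
  assumes "finite \<sigma>" "i \<in> \<sigma>" "j \<in> \<sigma>" "i \<noteq> j"
  shows "(incidence \<sigma> i * incidence (\<sigma> - {i}) j :: 'k::field) = - (incidence \<sigma> j * incidence (\<sigma> - {j}) i)"
  unfolding incidence_Diff[OF assms(1,2), of j] incidence_Diff[OF assms(1,3), of i]
  using assms(4) by auto

lemma linear_coboundary: "Vector_Spaces.linear scale_fun scale_fun (coboundary X)"
  by (rule linear_scale_funI)
    (auto simp: fun_eq_iff coboundary_def scale_fun_def sum.distrib sum_distrib_left algebra_simps)

lemma coboundary_in_cochains: "coboundary X c \<in> cochains X"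
  by (simp add: cochains_def coboundary_def)

lemma subspace_cochains: "module.subspace scale_fun (cochains X)"
  by (rule cochain.subspaceI) (auto simp: cochains_def scale_fun_def)

lemma subspace_cocycles: "module.subspace scale_fun (cocycles X)"
proof -
  interpret d: Vector_Spaces.linear scale_fun scale_fun "coboundary X" by (rule linear_coboundary)
  have "cocycles X = cochains X \<inter> {c. coboundary X c = 0}" by (auto simp: cocycles_def)
  then show ?thesis using cochain.subspace_inter[OF subspace_cochains d.subspace_kernel] by metis
qed

lemma subspace_coboundaries: "module.subspace scale_fun (coboundaries X)"
proof -
  interpret d: Vector_Spaces.linear scale_fun scale_fun "coboundary X" by (rule linear_coboundary)
  show ?thesis unfolding coboundaries_def by (rule d.subspace_image[OF subspace_cochains])
qed

lemma coboundary_coboundary: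
  fixes c :: "'v::linorder set \<Rightarrow> 'k::field"
  assumes X: "face_family X" and c: "c \<in> cochains X"
  shows "coboundary X (coboundary X c) = 0"
proof
  fix \<sigma>
  show "coboundary X (coboundary X c) \<sigma> = 0 \<sigma>"
  proof (cases "\<sigma> \<in> X")
    case True
    then have fin: "finite \<sigma>" using X by (auto simp: face_family_def)
    define F where "F i j = incidence \<sigma> i * (incidence (\<sigma> - {i}) j * c (\<sigma> - {i} - {j}))" for i j
    have anti: "F i j = - F j i" if "i \<in> \<sigma>" "j \<in> \<sigma>" "i \<noteq> j" for i j
      using incidence_swap[OF fin that, where 'k='k]
      by (simp add: F_def Diff_insert2[symmetric] insert_commute flip: mult.assoc)
    \<comment> \<open>The inner coboundary is cut off outside \<open>X\<close>. If \<sigma> without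
      \<open>i\<close> is missing from \<open>X\<close>, convexity also keeps out every face with
      \<open>j\<close> removed in addition, so the formula without the cut-off remains
      valid.\<close>
    have "coboundary X c (\<sigma> - {i}) = (\<Sum>j\<in>\<sigma> - {i}. incidence (\<sigma> - {i}) j * c (\<sigma> - {i} - {j}))"
      for i
    proof (cases "\<sigma> - {i} \<in> X")
      case False
      have "c (\<sigma> - {i} - {j}) = 0" for j
      proof -
        have "\<sigma> - {i} - {j} \<notin> X"
        proof
          assume "\<sigma> - {i} - {j} \<in> X"
          moreover have "\<sigma> - {i} - {j} \<subseteq> \<sigma> - {i}" "\<sigma> - {i} \<subseteq> \<sigma>" by auto
          ultimately show False using X True False unfolding face_family_def by blast
        qed
        then show ?thesis using c by (simp add: cochains_def)
      qed
      then show ?thesis using False by (simp add: coboundary_def)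
    qed (simp add: coboundary_def)
    then have "coboundary X (coboundary X c) \<sigma> = (\<Sum>i\<in>\<sigma>. \<Sum>j\<in>\<sigma> - {i}. F i j)"
      using True by (simp add: coboundary_def F_def sum_distrib_left)
    also have "\<dots> = (\<Sum>i\<in>\<sigma>. (\<Sum>j\<in>{j\<in>\<sigma>. i < j}. F i j) + (\<Sum>j\<in>{j\<in>\<sigma>. j < i}. F i j))"
    proof (rule sum.cong[OF refl])
      fix i assume "i \<in> \<sigma>"
      have split: "\<sigma> - {i} = {j\<in>\<sigma>. i < j} \<union> {j\<in>\<sigma>. j < i}" by auto
      show "(\<Sum>j\<in>\<sigma> - {i}. F i j) = (\<Sum>j\<in>{j\<in>\<sigma>. i < j}. F i j) + (\<Sum>j\<in>{j\<in>\<sigma>. j < i}. F i j)"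
        unfolding split by (rule sum.union_disjoint) (use fin in auto)
    qed
    also have "\<dots> = (\<Sum>i\<in>\<sigma>. \<Sum>j\<in>{j\<in>\<sigma>. i < j}. F i j) + (\<Sum>i\<in>\<sigma>. \<Sum>j\<in>{j\<in>\<sigma>. j < i}. F i j)"
      by (rule sum.distrib)
    also have "(\<Sum>i\<in>\<sigma>. \<Sum>j\<in>{j\<in>\<sigma>. j < i}. F i j) = (\<Sum>j\<in>\<sigma>. \<Sum>i\<in>{i\<in>\<sigma>. j < i}. F i j)"
      by (rule sum.swap_restrict[OF fin fin])
    also have "\<dots> = (\<Sum>j\<in>\<sigma>. \<Sum>i\<in>{i\<in>\<sigma>. j < i}. - F j i)"
      by (intro sum.cong refl anti) auto
    finally show ?thesis by (simp add: sum_negf)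
  qed (simp add: coboundary_def)
qed

lemma coboundaries_subset_cocycles: "face_family X \<Longrightarrow> coboundaries X \<subseteq> cocycles X"
  using coboundary_coboundary coboundary_in_cochains by (fastforce simp: coboundaries_def cocycles_def)

lemma cochains_subset_span:
  assumes "finite X"
  shows "(cochains X :: ('a \<Rightarrow> 'k::field) set) \<subseteq>
    module.span scale_fun ((\<lambda>\<sigma> \<tau>. if \<tau> = \<sigma> then 1 else 0) ` X)" (is "_ \<subseteq> module.span _ (?e ` X)")
proof
  fix c :: "'a \<Rightarrow> 'k" assume c: "c \<in> cochains X"
  have "c = (\<Sum>\<sigma>\<in>X. scale_fun (c \<sigma>) (?e \<sigma>))"
  proof
    fix \<tau>
    have "(\<Sum>\<sigma>\<in>X. scale_fun (c \<sigma>) (?e \<sigma>)) \<tau> = (\<Sum>\<sigma>\<in>X. if \<tau> = \<sigma> then c \<sigma> else 0)"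
      by (simp add: sum_apply scale_fun_def if_distrib cong: if_cong)
    also have "\<dots> = c \<tau>" using assms c by (simp add: cochains_def)
    finally show "c \<tau> = (\<Sum>\<sigma>\<in>X. scale_fun (c \<sigma>) (?e \<sigma>)) \<tau>" by simp
  qed
  also have "\<dots> \<in> module.span scale_fun (?e ` X)"
    by (intro cochain.span_sum cochain.span_scale cochain.span_base) auto
  finally show "c \<in> module.span scale_fun (?e ` X)" .
qed

lemma has_qdim_total_betti:
  assumes X: "face_family X"
  shows "has_qdim scale_fun (cocycles X :: ('v::linorder set \<Rightarrow> 'k::field) set) (coboundaries X)
    (total_betti TYPE('k) X)"
proof -
  have fin: "finite X" using X by (simp add: face_family_def)
  have "(cocycles X :: ('v set \<Rightarrow> 'k) set) \<subseteq> cochains X" by (auto simp: cocycles_def)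
  then obtain n where "has_qdim scale_fun (cocycles X :: ('v set \<Rightarrow> 'k) set) (coboundaries X) n"
    using cochain.has_qdim_of_finite_span[OF subspace_cocycles subspace_coboundaries
        coboundaries_subset_cocycles[OF X], OF order_trans[OF _ cochains_subset_span[OF fin]]] fin
    by blast
  then show ?thesis unfolding total_betti_def using cochain.has_qdim_quotient_dim by metis
qed

lemma total_betti_eqI:
  assumes "face_family X"
    "has_qdim scale_fun (cocycles X :: ('v::linorder set \<Rightarrow> 'k::field) set) (coboundaries X) n"
  shows "total_betti TYPE('k) X = n"
  using has_qdim_total_betti[OF assms(1)] assms(2) cochain.has_qdim_unique by blast

text \<open>Coboundaries go upwards, so the cochains supported on the upward closed part
  \<open>L\<close> form a subcomplex, and restriction to \<open>X - L\<close> is the quotient. Here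
  \<open>r2\<close> is the rank of that restriction on cohomology.\<close>

lemma total_betti_triangle:
  assumes X: "face_family X" and L: "L \<subseteq> X"
    and up: "\<And>\<sigma> \<tau>. \<sigma> \<in> L \<Longrightarrow> \<tau> \<in> X \<Longrightarrow> \<sigma> \<subseteq> \<tau> \<Longrightarrow> \<tau> \<in> L"
  obtains r1 r2 r3 where "total_betti TYPE('k::field) X = r1 + r2"
    "total_betti TYPE('k) (X - L) = r2 + r3" "total_betti TYPE('k) L = r1 + r3"
    "r2 = 0 \<longleftrightarrow> (\<forall>c\<in>cocycles X. (\<lambda>\<sigma>. if \<sigma> \<in> L then 0 else c \<sigma> :: 'k) \<in> coboundaries (X - L))"
proof -
  let ?P = "\<lambda>c \<sigma>. if \<sigma> \<in> X - L then c \<sigma> else 0 :: 'k"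
  let ?d = "coboundary X :: _ \<Rightarrow> _ \<Rightarrow> 'k"
  have ffL: "face_family L"
    unfolding face_family_def
  proof (intro conjI ballI allI impI)
    fix \<sigma> \<rho> \<tau> assume *: "\<sigma> \<in> L" "\<rho> \<in> L" "\<sigma> \<subseteq> \<tau>" "\<tau> \<subseteq> \<rho>"
    then have "\<tau> \<in> X" using X L unfolding face_family_def by blast
    then show "\<tau> \<in> L" using up * by blast
  qed (use X L in \<open>auto simp: face_family_def intro: finite_subset\<close>)
  have ffQ: "face_family (X - L)"
    unfolding face_family_def
  proof (intro conjI ballI allI impI)
    fix \<sigma> \<rho> \<tau> assume *: "\<sigma> \<in> X - L" "\<rho> \<in> X - L" "\<sigma> \<subseteq> \<tau>" "\<tau> \<subseteq> \<rho>"
    then have "\<tau> \<in> X" using X unfolding face_family_def by blast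
    then show "\<tau> \<in> X - L" using up[of \<tau> \<rho>] * by blast
  qed (use X in \<open>auto simp: face_family_def\<close>)
  have dL: "coboundary L c = ?d c" if "c \<in> cochains L" for c
  proof
    fix \<sigma>
    have "c (\<sigma> - {j}) = 0" if "\<sigma> \<in> X - L" for j
    proof -
      have "\<sigma> - {j} \<notin> L" using up[of "\<sigma> - {j}" \<sigma>] that by auto
      then show ?thesis using \<open>c \<in> cochains L\<close> by (simp add: cochains_def)
    qed
    then show "coboundary L c \<sigma> = ?d c \<sigma>" using L by (auto simp: coboundary_def)
  qed
  have dQ: "coboundary (X - L) c = ?P (?d c)" for c
    by (auto simp: coboundary_def fun_eq_iff)
  have Z: "{x\<in>cochains X. ?d x = 0} = cocycles X" "{x\<in>cochains L. ?d x = 0} = cocycles L"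
    "{x\<in>cochains (X - L). ?P (?d x) = 0} = cocycles (X - L)"
    unfolding cocycles_def dQ[symmetric] using dL by auto
  have B: "?d ` cochains X = coboundaries X" "?d ` cochains L = coboundaries L"
    "(\<lambda>x. ?P (?d x)) ` cochains (X - L) = coboundaries (X - L)"
    unfolding coboundaries_def dQ by (auto simp: dL image_iff)
  have linP: "Vector_Spaces.linear scale_fun scale_fun ?P"
    by (rule linear_scale_funI) (auto simp: fun_eq_iff scale_fun_def)
  have sub: "cochains L \<subseteq> cochains X" "cochains (X - L) \<subseteq> cochains X"
    using L by (auto simp: cochains_def)
  have d: "?d ` cochains X \<subseteq> cochains X" "?d ` cochains L \<subseteq> cochains L"
    using coboundary_in_cochains by (auto simp flip: dL)
  have P: "?P x \<in> cochains (X - L)" "x - ?P x \<in> cochains L" if "x \<in> cochains X" for x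
    using that by (auto simp: cochains_def)
  have P': "?P x = 0" if "x \<in> cochains L" for x
    using that by (auto simp: cochains_def fun_eq_iff)
  have P'': "?P x = x" if "x \<in> cochains (X - L)" for x
    using that by (auto simp: cochains_def fun_eq_iff)
  have h: "has_qdim scale_fun {x\<in>cochains X. ?d x = 0} (?d ` cochains X) (total_betti TYPE('k) X)"
    "has_qdim scale_fun {x\<in>cochains L. ?d x = 0} (?d ` cochains L) (total_betti TYPE('k) L)"
    "has_qdim scale_fun {x\<in>cochains (X - L). ?P (?d x) = 0} ((\<lambda>x. ?P (?d x)) ` cochains (X - L))
        (total_betti TYPE('k) (X - L))"
    unfolding Z B using has_qdim_total_betti X ffL ffQ by auto
  obtain r1 r2 r3 where r: "total_betti TYPE('k) X = r1 + r2"
    "total_betti TYPE('k) (X - L) = r2 + r3" "total_betti TYPE('k) L = r1 + r3"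
    "r2 = 0 \<longleftrightarrow> ?P ` {x\<in>cochains X. ?d x = 0} \<subseteq> (\<lambda>x. ?P (?d x)) ` cochains (X - L)"
    by (rule exact_triangle[OF cochain.vector_space_axioms linear_coboundary linP
        subspace_cochains subspace_cochains subspace_cochains sub d
        coboundary_coboundary[OF X] P P' P'' h])
  have "?P c = (\<lambda>\<sigma>. if \<sigma> \<in> L then 0 else c \<sigma> :: 'k)" if "c \<in> cocycles X" for c
    using that by (auto simp: fun_eq_iff cocycles_def cochains_def)
  then have iff: "?P ` cocycles X \<subseteq> coboundaries (X - L) \<longleftrightarrow>
      (\<forall>c\<in>cocycles X. (\<lambda>\<sigma>. if \<sigma> \<in> L then 0 else c \<sigma> :: 'k) \<in> coboundaries (X - L))"
    by (simp add: image_subset_iff)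
  have "r2 = 0 \<longleftrightarrow> ?P ` cocycles X \<subseteq> coboundaries (X - L)"
    using r(4) unfolding Z B .
  then show thesis unfolding iff by (rule that[OF r(1-3)])
qed

lemma total_betti_cone:
  assumes X: "face_family X" and w: "\<And>\<sigma>. \<sigma> \<in> X \<Longrightarrow> insert w \<sigma> \<in> X \<and> \<sigma> - {w} \<in> X"
  shows "total_betti TYPE('k::field) X = 0"
proof (rule total_betti_eqI[OF X])
  have "(z :: _ \<Rightarrow> 'k) \<in> coboundaries X" if z: "z \<in> cocycles X" for z
  proof -
    \<comment> \<open>Cone contraction: the value on the face with \<open>w\<close> added, signed so
      that the summand \<open>j = w\<close> of its coboundary returns \<open>z\<close>.\<close>
    define h where "h \<sigma> = (if \<sigma> \<in> X \<and> w \<notin> \<sigma> then incidence (insert w \<sigma>) w * z (insert w \<sigma>) else 0)"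
      for \<sigma>
    have "h \<in> cochains X" by (simp add: h_def cochains_def)
    moreover have "coboundary X h = z"
    proof
      fix \<sigma>
      show "coboundary X h \<sigma> = z \<sigma>"
      proof (cases "\<sigma> \<in> X")
        case False
        then show ?thesis using z by (simp add: coboundary_def cocycles_def cochains_def)
      next
        case True
        then have fin: "finite \<sigma>" using X by (auto simp: face_family_def)
        show ?thesis
        proof (cases "w \<in> \<sigma>")
          case w\<sigma>: True
          have "(\<Sum>j\<in>\<sigma>. incidence \<sigma> j * h (\<sigma> - {j})) = (\<Sum>j\<in>\<sigma>. if j = w then z \<sigma> else 0)"
          proof (rule sum.cong[OF refl])
            fix j assume "j \<in> \<sigma>"
            show "incidence \<sigma> j * h (\<sigma> - {j}) = (if j = w then z \<sigma> else 0)"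
            proof (cases "j = w")
              case True
              then show ?thesis using w\<sigma> w[OF \<open>\<sigma> \<in> X\<close>]
                by (simp add: h_def insert_absorb flip: mult.assoc)
            qed (use w\<sigma> in \<open>simp add: h_def\<close>)
          qed
          then show ?thesis using True w\<sigma> fin by (simp add: coboundary_def)
        next
          case w\<sigma>: False
          let ?\<tau> = "insert w \<sigma>"
          \<comment> \<open>On a face without \<open>w\<close>, the cocycle condition at the face
            enlarged by \<open>w\<close> expresses \<open>z\<close> through faces containing
            \<open>w\<close>, which is exactly what \<open>h\<close> records.\<close>
          have "coboundary X z ?\<tau> = 0" using z by (simp add: cocycles_def)
          then have "0 = (\<Sum>j\<in>?\<tau>. incidence ?\<tau> j * z (?\<tau> - {j}))"
            using w[OF True] by (simp add: coboundary_def)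
          also have "\<dots> = incidence ?\<tau> w * z \<sigma> + (\<Sum>j\<in>\<sigma>. incidence ?\<tau> j * z (?\<tau> - {j}))"
            using fin w\<sigma> by simp
          finally have z\<sigma>: "incidence ?\<tau> w * z \<sigma> = - (\<Sum>j\<in>\<sigma>. incidence ?\<tau> j * z (?\<tau> - {j}))"
            by (simp add: eq_neg_iff_add_eq_0)
          have "z \<sigma> = incidence ?\<tau> w * (incidence ?\<tau> w * z \<sigma>)" by (simp flip: mult.assoc)
          also have "\<dots> = (\<Sum>j\<in>\<sigma>. - (incidence ?\<tau> w * incidence ?\<tau> j) * z (?\<tau> - {j}))"
            unfolding z\<sigma> by (simp add: sum_distrib_left sum_negf algebra_simps)
          also have "\<dots> = (\<Sum>j\<in>\<sigma>. incidence \<sigma> j * h (\<sigma> - {j}))"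
          proof (rule sum.cong[OF refl])
            fix j assume j: "j \<in> \<sigma>"
            then have jw: "j \<noteq> w" using w\<sigma> by auto
            have sub: "insert w (\<sigma> - {j}) = ?\<tau> - {j}" "?\<tau> - {w} = \<sigma>" using jw w\<sigma> by auto
            show "- (incidence ?\<tau> w * incidence ?\<tau> j) * z (?\<tau> - {j}) = incidence \<sigma> j * h (\<sigma> - {j})"
            proof (cases "\<sigma> - {j} \<in> X")
              case True
              then have h: "h (\<sigma> - {j}) = incidence (?\<tau> - {j}) w * z (?\<tau> - {j})"
                using w\<sigma> by (simp add: h_def sub)
              have "incidence ?\<tau> w * incidence \<sigma> j = - (incidence ?\<tau> j * incidence (?\<tau> - {j}) w :: 'k)"
                using incidence_swap[of ?\<tau> w j, where 'k='k] fin j jw by (simp add: sub)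
              then have "incidence ?\<tau> w * incidence ?\<tau> w * (incidence \<sigma> j * incidence (?\<tau> - {j}) w) =
                  - (incidence ?\<tau> w * incidence ?\<tau> j) * (incidence (?\<tau> - {j}) w * incidence (?\<tau> - {j}) w :: 'k)"
                by algebra
              then have "incidence \<sigma> j * incidence (?\<tau> - {j}) w = - (incidence ?\<tau> w * incidence ?\<tau> j :: 'k)"
                by simp
              then show ?thesis unfolding h by (simp flip: mult.assoc)
            next
              case False
              have "?\<tau> - {j} \<notin> X"
              proof
                assume "?\<tau> - {j} \<in> X"
                then have "?\<tau> - {j} - {w} \<in> X" using w by blast
                moreover have "?\<tau> - {j} - {w} = \<sigma> - {j}" using w\<sigma> by auto
                ultimately show False using False by simp
              qed
              then have "z (?\<tau> - {j}) = 0" using z by (simp add: cocycles_def cochains_def)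
              then show ?thesis using False by (simp add: h_def)
            qed
          qed
          finally show ?thesis using True by (simp add: coboundary_def)
        qed
      qed
    qed
    ultimately show ?thesis unfolding coboundaries_def by (metis imageI)
  qed
  then show "has_qdim scale_fun (cocycles X :: (_ \<Rightarrow> 'k) set) (coboundaries X) 0"
    using coboundaries_subset_cocycles[OF X] subspace_cocycles
    unfolding cochain.has_qdim_0_iff by blast
qed

lemma total_betti_iso:
  fixes f :: "('v::linorder set \<Rightarrow> 'k::field) \<Rightarrow> 'w::linorder set \<Rightarrow> 'k"
  assumes X: "face_family X" "face_family Y"
    and lin: "Vector_Spaces.linear scale_fun scale_fun f"
    and f: "\<And>c. c \<in> cochains X \<Longrightarrow> f c \<in> cochains Y"
    and g: "\<And>c. c \<in> cochains Y \<Longrightarrow> g c \<in> cochains X"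
    and inv: "\<And>c. c \<in> cochains X \<Longrightarrow> g (f c) = c" "\<And>c. c \<in> cochains Y \<Longrightarrow> f (g c) = c"
    and comm: "\<And>c. c \<in> cochains X \<Longrightarrow> f (coboundary X c) = coboundary Y (f c)"
  shows "total_betti TYPE('k) X = total_betti TYPE('k) Y"
proof -
  interpret f: Vector_Spaces.linear scale_fun scale_fun f by (rule lin)
  have 0: "0 \<in> coboundaries Y" using subspace_coboundaries cochain.subspace_0 by blast
  have "has_qdim scale_fun (cocycles X :: ('v set \<Rightarrow> 'k) set) (coboundaries X) n \<longleftrightarrow>
      has_qdim scale_fun (cocycles Y :: ('w set \<Rightarrow> 'k) set) (coboundaries Y) n" for n
  proof (rule has_qdim_map_iff[OF lin])
    fix z :: "'v set \<Rightarrow> 'k" assume z: "z \<in> cocycles X"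
    then have zX: "z \<in> cochains X" "coboundary X z = 0" by (auto simp: cocycles_def)
    then show "f z \<in> cocycles Y" using f comm f.zero by (metis (mono_tags) cocycles_def mem_Collect_eq)
    show "f z \<in> coboundaries Y \<longleftrightarrow> z \<in> coboundaries X"
    proof
      assume "f z \<in> coboundaries Y"
      then obtain y where "y \<in> cochains Y" "f z = coboundary Y y" by (auto simp: coboundaries_def)
      then have "f z = f (coboundary X (g y))" "g y \<in> cochains X" using comm[of "g y"] g inv by auto
      then have "z = coboundary X (g y)" using inv(1) zX coboundary_in_cochains by metis
      then show "z \<in> coboundaries X" using \<open>g y \<in> cochains X\<close> by (auto simp: coboundaries_def)
    next
      assume "z \<in> coboundaries X"
      then show "f z \<in> coboundaries Y" using comm f by (auto simp: coboundaries_def)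
    qed
  next
    fix z' :: "'w set \<Rightarrow> 'k" assume z': "z' \<in> cocycles Y"
    then have *: "z' \<in> cochains Y" "coboundary Y z' = 0" by (auto simp: cocycles_def)
    then have "f (coboundary X (g z')) = f 0" using comm[of "g z'"] g inv f.zero by auto
    moreover have "0 \<in> cochains X" by (simp add: cochains_def)
    ultimately have "coboundary X (g z') = 0" using inv(1) coboundary_in_cochains by metis
    then have "g z' \<in> cocycles X" using g * by (auto simp: cocycles_def)
    then show "\<exists>z\<in>cocycles X. z' - f z \<in> coboundaries Y" using inv * 0 by force
  qed (use X subspace_cocycles subspace_coboundaries coboundaries_subset_cocycles in auto)
  then show ?thesis using total_betti_eqI[OF X(1)] has_qdim_total_betti[OF X(2)] by blast
qed

lemma face_family_insert_image:
  assumes Y: "face_family Y" and v: "\<And>\<sigma>. \<sigma> \<in> Y \<Longrightarrow> v \<notin> \<sigma>"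
  shows "face_family (insert v ` Y)"
  unfolding face_family_def
proof (intro conjI ballI allI impI)
  fix \<sigma> \<rho> \<tau> assume "\<sigma> \<in> insert v ` Y" "\<rho> \<in> insert v ` Y" and sub: "\<sigma> \<subseteq> \<tau>" "\<tau> \<subseteq> \<rho>"
  then obtain \<sigma>' \<rho>' where *: "\<sigma>' \<in> Y" "\<rho>' \<in> Y" "\<sigma> = insert v \<sigma>'" "\<rho> = insert v \<rho>'" by auto
  then have "\<sigma>' \<subseteq> \<tau> - {v}" "\<tau> - {v} \<subseteq> \<rho>'" using sub v by auto
  then have "\<tau> - {v} \<in> Y" using Y * unfolding face_family_def by blast
  moreover have "\<tau> = insert v (\<tau> - {v})" using * sub by auto
  ultimately show "\<tau> \<in> insert v ` Y" by blast
qed (use Y in \<open>auto simp: face_family_def\<close>)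

text \<open>The sign is chosen such that adding \<open>v\<close> to all faces commutes with the coboundary.\<close>

lemma total_betti_insert_image:
  fixes v :: "'v::linorder"
  assumes Y: "face_family Y" and v: "\<And>\<sigma>. \<sigma> \<in> Y \<Longrightarrow> v \<notin> \<sigma>"
  shows "total_betti TYPE('k::field) (insert v ` Y) = total_betti TYPE('k) Y"
proof -
  define s :: "'v set \<Rightarrow> 'k" where "s \<sigma> = (-1) ^ card {l\<in>\<sigma>. v < l}" for \<sigma>
  have ss: "s \<sigma> * s \<sigma> = 1" for \<sigma> by (simp add: s_def flip: power_add mult_2)
  have s_Diff: "s \<sigma> = (if v < j then -1 else 1) * s (\<sigma> - {j})" if "finite \<sigma>" "j \<in> \<sigma>" for \<sigma> j
  proof (cases "v < j")
    case True
    then have "{l\<in>\<sigma>. v < l} = insert j {l\<in>\<sigma> - {j}. v < l}" using that by auto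
    then show ?thesis using that True by (simp add: s_def)
  next
    case False
    then have "{l\<in>\<sigma>. v < l} = {l\<in>\<sigma> - {j}. v < l}" by auto
    then show ?thesis using False by (simp add: s_def)
  qed
  define f :: "('v set \<Rightarrow> 'k) \<Rightarrow> 'v set \<Rightarrow> 'k"
    where "f c \<sigma> = (if \<sigma> \<in> Y then s \<sigma> * c (insert v \<sigma>) else 0)" for c \<sigma>
  define g :: "('v set \<Rightarrow> 'k) \<Rightarrow> 'v set \<Rightarrow> 'k"
    where "g c \<sigma> = (if \<sigma> \<in> insert v ` Y then s (\<sigma> - {v}) * c (\<sigma> - {v}) else 0)" for c \<sigma>
  show ?thesis
  proof (rule total_betti_iso[where f = f and g = g])
    show "Vector_Spaces.linear scale_fun scale_fun f"
      by (rule linear_scale_funI) (auto simp: fun_eq_iff scale_fun_def f_def algebra_simps)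
    fix c :: "'v set \<Rightarrow> 'k"
    show "f c \<in> cochains Y" "g c \<in> cochains (insert v ` Y)" by (simp_all add: f_def g_def cochains_def)
    show "f (g c) = c" if "c \<in> cochains Y"
      using that v by (auto simp: f_def g_def fun_eq_iff cochains_def ss simp flip: mult.assoc)
    show "g (f c) = c" if "c \<in> cochains (insert v ` Y)"
      using that v by (auto simp: f_def g_def fun_eq_iff cochains_def ss simp flip: mult.assoc)
    assume c: "c \<in> cochains (insert v ` Y)"
    show "f (coboundary (insert v ` Y) c) = coboundary Y (f c)"
    proof
      fix \<sigma>
      show "f (coboundary (insert v ` Y) c) \<sigma> = coboundary Y (f c) \<sigma>"
      proof (cases "\<sigma> \<in> Y")
        case True
        have fin: "finite \<sigma>" using Y True by (simp add: face_family_def)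
        have v\<sigma>: "v \<notin> \<sigma>" using v True by blast
        have "\<sigma> \<notin> insert v ` Y" using v\<sigma> by auto
        \<comment> \<open>This removes the summand \<open>j = v\<close> from the coboundary at
          \<open>insert v \<sigma>\<close>: the face without \<open>v\<close> is outside the
          family.\<close>
        then have c0: "c \<sigma> = 0" using c by (simp add: cochains_def)
        have "f (coboundary (insert v ` Y) c) \<sigma> =
            s \<sigma> * (\<Sum>j\<in>\<sigma>. incidence (insert v \<sigma>) j * c (insert v \<sigma> - {j}))"
          using True fin v\<sigma> c0 by (simp add: f_def coboundary_def)
        also have "\<dots> = (\<Sum>j\<in>\<sigma>. incidence \<sigma> j * f c (\<sigma> - {j}))"
          unfolding sum_distrib_left
        proof (rule sum.cong[OF refl])
          fix j assume j: "j \<in> \<sigma>"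
          then have ins: "insert v \<sigma> - {j} = insert v (\<sigma> - {j})" using v\<sigma> by auto
          have "insert v (\<sigma> - {j}) \<in> insert v ` Y \<longleftrightarrow> \<sigma> - {j} \<in> Y"
          proof
            assume "insert v (\<sigma> - {j}) \<in> insert v ` Y"
            then obtain \<rho> where \<rho>: "\<rho> \<in> Y" "insert v (\<sigma> - {j}) = insert v \<rho>" by auto
            then have "\<sigma> - {j} = \<rho>" using v[OF \<rho>(1)] v\<sigma> insert_ident[of v "\<sigma> - {j}" \<rho>] by auto
            then show "\<sigma> - {j} \<in> Y" using \<rho> by simp
          qed simp
          then have "s (\<sigma> - {j}) * c (insert v (\<sigma> - {j})) = f c (\<sigma> - {j})"
            using c by (auto simp: f_def cochains_def)
          moreover have "s \<sigma> * incidence (insert v \<sigma>) j = incidence \<sigma> j * s (\<sigma> - {j})"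
            unfolding s_Diff[OF fin j] using incidence_Diff[of "insert v \<sigma>" v j, where 'k='k] fin v\<sigma> by simp
          ultimately show "s \<sigma> * (incidence (insert v \<sigma>) j * c (insert v \<sigma> - {j})) =
              incidence \<sigma> j * f c (\<sigma> - {j})"
            unfolding ins by (metis mult.assoc)
        qed
        finally show ?thesis using True by (simp add: coboundary_def)
      qed (simp add: f_def coboundary_def)
    qed
  qed (use Y face_family_insert_image[OF Y v] in auto)
qed

text \<open>The empty face carries a class in degree -1. This is where the reduced convention
  enters, and the lower bound by a power of two counts subsets that each contribute this 1.\<close>

lemma total_betti_empty_face: "total_betti TYPE('k::field) {{} :: 'v::linorder set} = 1"
proof (rule total_betti_eqI)
  show ff: "face_family {{} :: 'v set}" by (auto simp: face_family_def)
  let ?e = "\<lambda>\<sigma> :: 'v set. if \<sigma> = {} then 1 else 0 :: 'k"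
  have d: "coboundary {{}} c = 0" for c :: "'v set \<Rightarrow> 'k"
    by (auto simp: coboundary_def fun_eq_iff)
  have "0 \<in> cochains {{}}" by (simp add: cochains_def)
  then have B: "coboundaries {{}} = {0 :: 'v set \<Rightarrow> 'k}"
    unfolding coboundaries_def by (auto simp: d)
  have Z: "cocycles {{}} = (cochains {{}} :: ('v set \<Rightarrow> 'k) set)" by (auto simp: cocycles_def d)
  have "?e \<noteq> 0" by (auto simp: fun_eq_iff)
  moreover have "module.span scale_fun {?e} = cochains {{}}"
    using cochains_subset_span[of "{{} :: 'v set}", where 'k='k] subspace_cochains
    by (intro antisym cochain.span_minimal[OF _ subspace_cochains]) (auto simp: cochains_def)
  ultimately have "quotient_basis scale_fun (cocycles {{}}) (coboundaries {{}}) {?e}"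
    unfolding quotient_basis_def B Z
    by (simp add: insert_commute[of _ 0] cochain.span_insert_0 insert_is_Un[of 0 "{?e}", symmetric] cochains_def)
  then show "has_qdim scale_fun (cocycles {{}} :: ('v set \<Rightarrow> 'k) set) (coboundaries {{}}) 1"
    unfolding has_qdim_def using subspace_cocycles subspace_coboundaries
      coboundaries_subset_cocycles[OF ff] by (intro conjI exI[of _ "{?e}"]) auto
qed

section \<open>The grading of cochains by the number of vertices\<close>

definition homogeneous :: "nat \<Rightarrow> ('v set \<Rightarrow> 'k::field) set" where
  "homogeneous k = {c. \<forall>\<sigma>. card \<sigma> \<noteq> k \<longrightarrow> c \<sigma> = 0}"

definition component :: "nat \<Rightarrow> ('v set \<Rightarrow> 'k::field) \<Rightarrow> 'v set \<Rightarrow> 'k" where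
  "component k c \<sigma> = (if card \<sigma> = k then c \<sigma> else 0)"

text \<open>The index is shifted: \<open>k\<close> counts vertices, so this is the reduced Betti
  number in degree k - 1, and \<open>k = 0\<close> belongs to the empty face.\<close>

definition betti :: "'k::field itself \<Rightarrow> 'v::linorder set set \<Rightarrow> nat \<Rightarrow> nat" where
  "betti _ X k = quotient_dim scale_fun (cocycles X \<inter> homogeneous k :: ('v set \<Rightarrow> 'k) set)
     (coboundaries X \<inter> homogeneous k)"

lemma linear_component: "Vector_Spaces.linear scale_fun scale_fun (component k)"
  by (rule linear_scale_funI) (auto simp: fun_eq_iff scale_fun_def component_def)

lemma subspace_homogeneous: "module.subspace scale_fun (homogeneous k)"
  by (rule cochain.subspaceI) (auto simp: homogeneous_def scale_fun_def)

lemma component_in_homogeneous: "component k c \<in> homogeneous k"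
  by (simp add: component_def homogeneous_def)

lemma component_of_homogeneous: "c \<in> homogeneous l \<Longrightarrow> component k c = (if k = l then c else 0)"
  by (auto simp: component_def homogeneous_def fun_eq_iff)

lemma component_in_cochains: "c \<in> cochains X \<Longrightarrow> component k c \<in> cochains X"
  by (simp add: component_def cochains_def)

lemma coboundary_component:
  assumes "face_family X"
  shows "coboundary X (component k c) = component (Suc k) (coboundary X c)"
proof
  fix \<sigma>
  show "coboundary X (component k c) \<sigma> = component (Suc k) (coboundary X c) \<sigma>"
  proof (cases "\<sigma> \<in> X")
    case True
    then have "card (\<sigma> - {j}) = k \<longleftrightarrow> card \<sigma> = Suc k" if "j \<in> \<sigma>" for j
      using assms that card_Suc_Diff1[of \<sigma> j] by (auto simp: face_family_def)
    then show ?thesis using True by (simp add: coboundary_def component_def)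
  qed (simp add: coboundary_def component_def)
qed

lemma component_in_cocycles:
  assumes "face_family X" "c \<in> cocycles X"
  shows "component k c \<in> cocycles X"
proof -
  have "component l 0 = (0 :: 'a set \<Rightarrow> 'b)" for l by (auto simp: component_def)
  then show ?thesis
    using assms by (simp add: cocycles_def coboundary_component component_in_cochains)
qed

lemma component_in_coboundaries:
  assumes "face_family X" "c \<in> coboundaries X"
  shows "component k c \<in> coboundaries X"
proof -
  obtain b where b: "b \<in> cochains X" "c = coboundary X b" using assms by (auto simp: coboundaries_def)
  show ?thesis
  proof (cases k)
    \<comment> \<open>A coboundary vanishes on the empty face, where its defining sum is
      empty.\<close>
    case 0
    have "component 0 c = 0"
      using assms(1) b by (auto simp: component_def coboundary_def face_family_def)
    then show ?thesis using 0 subspace_coboundaries cochain.subspace_0 by metis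
  next
    case (Suc l)
    then have "component k c = coboundary X (component l b)"
      using coboundary_component[OF assms(1)] b by metis
    then show ?thesis using b component_in_cochains by (auto simp: coboundaries_def)
  qed
qed

lemma has_qdim_betti:
  assumes X: "face_family X"
  shows "has_qdim scale_fun (cocycles X \<inter> homogeneous k :: ('v::linorder set \<Rightarrow> 'k::field) set)
    (coboundaries X \<inter> homogeneous k) (betti TYPE('k) X k)"
proof -
  have fin: "finite X" using X by (simp add: face_family_def)
  have *: "(cocycles X \<inter> homogeneous k :: ('v set \<Rightarrow> 'k) set) \<subseteq> cochains X" by (auto simp: cocycles_def)
  obtain n where "has_qdim scale_fun (cocycles X \<inter> homogeneous k :: ('v set \<Rightarrow> 'k) set)
      (coboundaries X \<inter> homogeneous k) n"
    by (rule cochain.has_qdim_of_finite_span[OF cochain.subspace_inter[OF subspace_cocycles subspace_homogeneous]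
        cochain.subspace_inter[OF subspace_coboundaries subspace_homogeneous] _
        order_trans[OF * cochains_subset_span[OF fin]]])
      (use fin coboundaries_subset_cocycles[OF X] in auto)
  then show ?thesis unfolding betti_def using cochain.has_qdim_quotient_dim by metis
qed

lemma total_betti_eq_sum_betti:
  assumes X: "face_family X" and n: "\<And>\<sigma>. \<sigma> \<in> X \<Longrightarrow> card \<sigma> \<le> n"
  shows "total_betti TYPE('k::field) X = (\<Sum>k\<le>n. betti TYPE('k) X k)"
proof (rule total_betti_eqI[OF X])
  let ?Z = "cocycles X :: ('a set \<Rightarrow> 'k) set" and ?B = "coboundaries X :: ('a set \<Rightarrow> 'k) set"
  show "has_qdim scale_fun ?Z ?B (\<Sum>k\<le>n. betti TYPE('k) X k)"
  proof (rule has_qdim_direct_sum[where f = component and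
        Z' = "\<lambda>k. ?Z \<inter> homogeneous k" and B' = "\<lambda>k. ?B \<inter> homogeneous k"])
    fix z assume z: "z \<in> ?Z"
    show "z \<in> ?B \<longleftrightarrow> (\<forall>k\<in>{..n}. component k z \<in> ?B \<inter> homogeneous k)"
    proof
      assume *: "\<forall>k\<in>{..n}. component k z \<in> ?B \<inter> homogeneous k"
      have "z = (\<Sum>k\<le>n. component k z)"
      proof
        fix \<sigma>
        have "card \<sigma> \<le> n" if "z \<sigma> \<noteq> 0" using that n z by (auto simp: cocycles_def cochains_def)
        then show "z \<sigma> = (\<Sum>k\<le>n. component k z) \<sigma>" by (auto simp: sum_apply component_def)
      qed
      then show "z \<in> ?B" using * cochain.subspace_sum[OF subspace_coboundaries] by (metis Int_iff)
    qed (use component_in_coboundaries[OF X] component_in_homogeneous in auto)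
  next
    fix y :: "nat \<Rightarrow> 'a set \<Rightarrow> 'k" assume y: "\<And>k. k \<in> {..n} \<Longrightarrow> y k \<in> ?Z \<inter> homogeneous k"
    have "component k (\<Sum>l\<le>n. y l) = y k" if "k \<le> n" for k
    proof -
      interpret c: Vector_Spaces.linear scale_fun scale_fun "component k :: ('a set \<Rightarrow> 'k) \<Rightarrow> _"
        by (rule linear_component)
      have "component k (\<Sum>l\<le>n. y l) = (\<Sum>l\<le>n. if k = l then y l else 0)"
        unfolding c.sum by (rule sum.cong) (use y in \<open>auto simp: component_of_homogeneous\<close>)
      then show ?thesis using that by simp
    qed
    moreover have "(\<Sum>l\<le>n. y l) \<in> ?Z" using y by (intro cochain.subspace_sum[OF subspace_cocycles]) auto
    ultimately show "\<exists>z\<in>?Z. \<forall>k\<in>{..n}. component k z - y k \<in> ?B \<inter> homogeneous k"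
      using cochain.subspace_0[OF subspace_coboundaries] cochain.subspace_0[OF subspace_homogeneous]
      by (intro bexI[of _ "\<Sum>l\<le>n. y l"]) auto
  qed (use subspace_cocycles subspace_coboundaries coboundaries_subset_cocycles[OF X] has_qdim_betti[OF X]
      component_in_cocycles[OF X] component_in_homogeneous linear_component cochain.vector_space_axioms in auto)
qed

section \<open>Tor of a Stanley--Reisner ring\<close>

definition sqfree :: "nat set \<Rightarrow> nat \<Rightarrow>\<^sub>0 nat" where
  "sqfree \<sigma> = (\<Sum>i\<in>\<sigma>. Poly_Mapping.single i 1)"

lemma lookup_sqfree:
  "finite \<sigma> \<Longrightarrow> Poly_Mapping.lookup (sqfree \<sigma>) i = (if i \<in> \<sigma> then 1 else 0)"
  by (simp add: sqfree_def lookup_sum lookup_single when_def)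

lemma keys_sqfree: "finite \<sigma> \<Longrightarrow> Poly_Mapping.keys (sqfree \<sigma>) = \<sigma>"
  by (auto simp: in_keys_iff lookup_sqfree split: if_splits)

lemma sqfree_Diff:
  assumes "finite \<sigma>" "j \<in> \<sigma>"
  shows "sqfree \<sigma> - Poly_Mapping.single j 1 = sqfree (\<sigma> - {j})"
  by (rule poly_mapping_eqI)
    (use assms in \<open>auto simp: lookup_minus lookup_sqfree lookup_single when_def\<close>)

lemma prod_var: "finite \<sigma> \<Longrightarrow> (\<Prod>i\<in>\<sigma>. var i) = Poly_Mapping.single (sqfree \<sigma>) (1 :: 'k::field)"
  by (induction \<sigma> rule: finite_induct) (simp_all add: sqfree_def var_def mult_single)

lemma sum_single_keys:
  assumes "finite A" "Poly_Mapping.keys p \<subseteq> A"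
  shows "(\<Sum>t\<in>A. Poly_Mapping.single t (Poly_Mapping.lookup p t)) = p"
  by (rule poly_mapping_eqI)
    (use assms in \<open>auto simp: lookup_sum lookup_single when_def in_keys_iff\<close>)

lemma polyring_iff:
  "p \<in> polyring m \<longleftrightarrow> (\<forall>t. Poly_Mapping.lookup p t \<noteq> 0 \<longrightarrow> Poly_Mapping.keys t \<subseteq> {1..m})"
  by (auto simp: polyring_def in_keys_iff)

text \<open>The ideal is spanned by monomials: a monomial lies in it as soon as its support is a
  non-face, being a multiple of the generator of that support. Exponents above 1 do not affect
  membership.\<close>

lemma SR_ideal_iff:
  fixes p :: "'k::field mpoly"
  assumes K: "abstract_simplicial_complex K"
  shows "p \<in> SR_ideal m K \<longleftrightarrow>
    p \<in> polyring m \<and> (\<forall>t. Poly_Mapping.keys t \<in> K \<longrightarrow> Poly_Mapping.lookup p t = 0)"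
proof
  assume "p \<in> SR_ideal m K"
  then obtain q :: "nat set \<Rightarrow> 'k mpoly" where q: "\<And>\<sigma>. q \<sigma> \<in> polyring m"
    and p: "p = (\<Sum>\<sigma>\<in>Pow {1..m} - K. q \<sigma> * (\<Prod>i\<in>\<sigma>. var i))"
    unfolding SR_ideal_def by blast
  have *: "Poly_Mapping.keys t \<subseteq> {1..m} \<and> Poly_Mapping.keys t \<notin> K"
    if t: "Poly_Mapping.lookup p t \<noteq> 0" for t
  proof -
    have "t \<in> (\<Union>\<sigma>\<in>Pow {1..m} - K. Poly_Mapping.keys (q \<sigma> * (\<Prod>i\<in>\<sigma>. var i)))"
      using t keys_sum[of "\<lambda>\<sigma>. q \<sigma> * (\<Prod>i\<in>\<sigma>. var i)" "Pow {1..m} - K"]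
      unfolding p[symmetric] in_keys_iff[symmetric] by (rule subsetD[rotated])
    then obtain \<sigma> where \<sigma>: "\<sigma> \<subseteq> {1..m}" "\<sigma> \<notin> K"
      and t\<sigma>: "t \<in> Poly_Mapping.keys (q \<sigma> * (\<Prod>i\<in>\<sigma>. var i))"
      by blast
    have fin: "finite \<sigma>" using \<sigma> finite_subset by blast
    obtain a where a: "a \<in> Poly_Mapping.keys (q \<sigma>)" "t = a + sqfree \<sigma>"
      using t\<sigma> keys_mult[of "q \<sigma>" "Poly_Mapping.single (sqfree \<sigma>) 1"] unfolding prod_var[OF fin]
      by auto
    have "Poly_Mapping.keys t = Poly_Mapping.keys a \<union> \<sigma>"
      using a fin by (auto simp: in_keys_iff lookup_add lookup_sqfree split: if_splits)
    moreover have "Poly_Mapping.keys a \<subseteq> {1..m}" using a q[of \<sigma>] by (auto simp: polyring_def)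
    ultimately show ?thesis using \<sigma> K unfolding abstract_simplicial_complex_def
      by (metis Un_least Un_upper2)
  qed
  then show "p \<in> polyring m \<and> (\<forall>t. Poly_Mapping.keys t \<in> K \<longrightarrow> Poly_Mapping.lookup p t = 0)"
    unfolding polyring_iff by blast
next
  assume p: "p \<in> polyring m \<and> (\<forall>t. Poly_Mapping.keys t \<in> K \<longrightarrow> Poly_Mapping.lookup p t = 0)"
  \<comment> \<open>The terms of \<open>p\<close> are grouped by support. Every support that occurs
    is a non-face, and one generator divides the whole group.\<close>
  define T where "T \<sigma> = {t \<in> Poly_Mapping.keys p. Poly_Mapping.keys t = \<sigma>}" for \<sigma>
  define q where "q \<sigma> = (\<Sum>t\<in>T \<sigma>. Poly_Mapping.single (t - sqfree \<sigma>) (Poly_Mapping.lookup p t))"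
    for \<sigma>
  have "q \<sigma> \<in> polyring m" for \<sigma>
    unfolding polyring_iff
  proof (intro allI impI)
    fix s assume "Poly_Mapping.lookup (q \<sigma>) s \<noteq> 0"
    then obtain t where t: "t \<in> T \<sigma>" "s = t - sqfree \<sigma>"
      unfolding q_def lookup_sum by (auto simp: lookup_single when_def elim: sum.not_neutral_contains_not_neutral split: if_splits)
    then have "Poly_Mapping.keys s \<subseteq> Poly_Mapping.keys t"
      by (auto simp: in_keys_iff lookup_minus)
    also have "\<dots> \<subseteq> {1..m}" using t p by (auto simp: T_def polyring_def)
    finally show "Poly_Mapping.keys s \<subseteq> {1..m}" .
  qed
  moreover have "p = (\<Sum>\<sigma>\<in>Pow {1..m} - K. q \<sigma> * (\<Prod>i\<in>\<sigma>. var i))"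
  proof -
    have "q \<sigma> * (\<Prod>i\<in>\<sigma>. var i) = (\<Sum>t\<in>T \<sigma>. Poly_Mapping.single t (Poly_Mapping.lookup p t))"
      if "\<sigma> \<in> Pow {1..m} - K" for \<sigma>
    proof -
      have fin: "finite \<sigma>" using that finite_subset by blast
      have "t - sqfree \<sigma> + sqfree \<sigma> = t" if "t \<in> T \<sigma>" for t
        by (rule poly_mapping_eqI)
          (use that fin in \<open>auto simp: T_def lookup_add lookup_minus lookup_sqfree in_keys_iff Suc_leI\<close>)
      then show ?thesis unfolding q_def prod_var[OF fin] sum_distrib_right
        by (intro sum.cong refl) (simp add: mult_single)
    qed
    then have "(\<Sum>\<sigma>\<in>Pow {1..m} - K. q \<sigma> * (\<Prod>i\<in>\<sigma>. var i)) =
        (\<Sum>\<sigma>\<in>Pow {1..m} - K. \<Sum>t\<in>T \<sigma>. Poly_Mapping.single t (Poly_Mapping.lookup p t))" by simp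
    also have "\<dots> = (\<Sum>t\<in>Poly_Mapping.keys p. Poly_Mapping.single t (Poly_Mapping.lookup p t))"
      unfolding T_def
      by (rule sum.group) (use p in \<open>auto simp: polyring_def in_keys_iff\<close>)
    also have "\<dots> = p" by (rule sum_single_keys) auto
    finally show ?thesis by simp
  qed
  ultimately show "p \<in> SR_ideal m K" unfolding SR_ideal_def by blast
qed

section \<open>Koszul cycles and boundaries modulo the ideal, coefficient by coefficient\<close>

lemma koszul_chainsD:
  assumes "c \<in> koszul_chains m i" "Poly_Mapping.lookup (c J) a \<noteq> 0"
  shows "J \<subseteq> {1..m}" "card J = i" "Poly_Mapping.keys a \<subseteq> {1..m}"
proof -
  have "c J \<noteq> 0" using assms(2) by auto
  then show "J \<subseteq> {1..m}" "card J = i" "Poly_Mapping.keys a \<subseteq> {1..m}"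
    using assms by (auto simp: koszul_chains_def polyring_iff dest!: spec[of _ J] split: if_splits)
qed

lemma koszul_chainsI:
  assumes "\<And>J a. Poly_Mapping.lookup (c J) a \<noteq> 0 \<Longrightarrow>
    J \<subseteq> {1..m} \<and> card J = i \<and> Poly_Mapping.keys a \<subseteq> {1..m}"
  shows "c \<in> koszul_chains m i"
proof -
  have "Poly_Mapping.lookup (c J) a = 0" if "\<not> (J \<subseteq> {1..m} \<and> card J = i)" for J a
    using assms that by blast
  then have "c J = 0" if "\<not> (J \<subseteq> {1..m} \<and> card J = i)" for J
    using that by (intro poly_mapping_eqI) simp
  moreover have "c J \<in> polyring m" for J unfolding polyring_iff using assms by blast
  ultimately show ?thesis by (simp add: koszul_chains_def)
qed

lemma koszul_diffD:
  assumes "c \<in> koszul_chains m i" "Poly_Mapping.lookup (koszul_diff m c J) a \<noteq> 0"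
  shows "J \<subseteq> {1..m}" "Suc (card J) = i" "Poly_Mapping.keys a \<subseteq> {1..m}"
proof -
  obtain j where j1: "j \<in> {1..m} - J" and j2: "(if Poly_Mapping.lookup a j > 0
       then (-1) ^ card {l\<in>J. l < j} * Poly_Mapping.lookup (c (insert j J)) (a - Poly_Mapping.single j 1)
       else 0) \<noteq> 0"
    using sum.not_neutral_contains_not_neutral[OF assms(2)[unfolded lookup_koszul_diff]] .
  then have j: "j \<in> {1..m} - J" "Poly_Mapping.lookup a j > 0"
    "Poly_Mapping.lookup (c (insert j J)) (a - Poly_Mapping.single j 1) \<noteq> 0"
    by (simp_all split: if_splits)
  note c = koszul_chainsD[OF assms(1) j(3)]
  have "finite J" using finite_subset[OF c(1)] by simp
  then show "J \<subseteq> {1..m}" "Suc (card J) = i" using c j by auto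
  have "Poly_Mapping.keys a \<subseteq> insert j (Poly_Mapping.keys (a - Poly_Mapping.single j 1))"
    by (auto simp: in_keys_iff lookup_minus lookup_single when_def split: if_splits)
  then show "Poly_Mapping.keys a \<subseteq> {1..m}" using c j by auto
qed

lemma koszul_diff_in_polyring: "c \<in> koszul_chains m i \<Longrightarrow> koszul_diff m c J \<in> polyring m"
  unfolding polyring_iff using koszul_diffD by blast

text \<open>Modulo the ideal only the monomials supported on faces survive, so being a cycle or
  boundary becomes a condition on those coefficients alone.\<close>

lemma koszul_cycles_SR_ideal:
  assumes "abstract_simplicial_complex K"
  shows "koszul_cycles m (SR_ideal m K) i = {c \<in> koszul_chains m i.
    \<forall>J a. Poly_Mapping.keys a \<in> K \<longrightarrow> Poly_Mapping.lookup (koszul_diff m c J) a = 0}"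
  unfolding koszul_cycles_def SR_ideal_iff[OF assms] using koszul_diff_in_polyring by blast

lemma koszul_boundaries_SR_ideal:
  assumes "abstract_simplicial_complex K"
  shows "koszul_boundaries m (SR_ideal m K) i =
    {c \<in> koszul_chains m i. \<exists>b \<in> koszul_chains m (Suc i). \<forall>J a. Poly_Mapping.keys a \<in> K \<longrightarrow>
      Poly_Mapping.lookup (c J) a = Poly_Mapping.lookup (koszul_diff m b J) a}"
proof -
  have "c J - koszul_diff m b J \<in> polyring m"
    if "c \<in> koszul_chains m i" "b \<in> koszul_chains m (Suc i)" for c b :: "'a chain" and J
    using koszul_chainsD(3)[OF that(1)] koszul_diffD(3)[OF that(2)]
    unfolding polyring_iff lookup_minus by (metis diff_0_right)
  then show ?thesis
    unfolding koszul_boundaries_def SR_ideal_iff[OF assms] lookup_minus by (auto; blast)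
qed

lemma koszul_diff_add: "koszul_diff m (b + c) J = koszul_diff m b J + koszul_diff m c J"
  by (simp add: koszul_diff_def sum.distrib algebra_simps)

lemma koszul_diff_minus: "koszul_diff m (b - c) J = koszul_diff m b J - koszul_diff m c J"
  by (simp add: koszul_diff_def sum_subtractf algebra_simps)

lemma koszul_diff_scale: "koszul_diff m (scale_chain x c) J = const x * koszul_diff m c J"
  by (simp add: koszul_diff_def scale_chain_def sum_distrib_left algebra_simps)

lemma lookup_const_mult:
  "Poly_Mapping.lookup (const x * p) t = x * Poly_Mapping.lookup p t"
proof -
  have "const x * p = (\<Sum>s\<in>Poly_Mapping.keys p. const x * Poly_Mapping.single s (Poly_Mapping.lookup p s))"
    by (simp add: sum_single_keys flip: sum_distrib_left)
  also have "\<dots> = (\<Sum>s\<in>Poly_Mapping.keys p. Poly_Mapping.single s (x * Poly_Mapping.lookup p s))"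
    by (simp add: const_def mult_single)
  finally show ?thesis
    by (simp add: lookup_sum lookup_single when_def in_keys_iff)
qed

lemma subspace_koszul_chains: "module.subspace scale_chain (koszul_chains m i)"
proof (rule chain.subspaceI)
  fix b c :: "'a chain" assume bc: "b \<in> koszul_chains m i" "c \<in> koszul_chains m i"
  show "b + c \<in> koszul_chains m i"
    by (rule koszul_chainsI)
      (use koszul_chainsD[OF bc(1)] koszul_chainsD[OF bc(2)] in \<open>metis add.right_neutral lookup_add plus_fun_apply\<close>)
next
  fix x and c :: "'a chain" assume c: "c \<in> koszul_chains m i"
  show "scale_chain x c \<in> koszul_chains m i"
  proof (rule koszul_chainsI)
    fix J a assume "Poly_Mapping.lookup (scale_chain x c J) a \<noteq> 0"
    then have "Poly_Mapping.lookup (c J) a \<noteq> 0" by (auto simp: scale_chain_def lookup_const_mult)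
    then show "J \<subseteq> {1..m} \<and> card J = i \<and> Poly_Mapping.keys a \<subseteq> {1..m}"
      using koszul_chainsD[OF c] by blast
  qed
qed (simp add: koszul_chains_def polyring_def)

lemma subspace_koszul_cycles:
  assumes "abstract_simplicial_complex K"
  shows "module.subspace scale_chain (koszul_cycles m (SR_ideal m K) i)"
  unfolding koszul_cycles_SR_ideal[OF assms]
  by (intro chain.subspaceI)
    (simp_all add: chain.subspace_add[OF subspace_koszul_chains]
      chain.subspace_scale[OF subspace_koszul_chains] chain.subspace_0[OF subspace_koszul_chains]
      koszul_diff_add koszul_diff_scale lookup_add lookup_const_mult koszul_diff_def[of _ 0])

lemma subspace_koszul_boundaries:
  assumes K: "abstract_simplicial_complex K"
  shows "module.subspace scale_chain (koszul_boundaries m (SR_ideal m K) i)"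
proof (rule chain.subspaceI)
  note B = koszul_boundaries_SR_ideal[OF K]
  show "0 \<in> koszul_boundaries m (SR_ideal m K) i"
    using chain.subspace_0[OF subspace_koszul_chains]
    by (auto simp: B koszul_diff_def[of _ 0] intro!: bexI[of _ 0])
  fix c :: "'a chain" assume "c \<in> koszul_boundaries m (SR_ideal m K) i"
  then obtain b where c: "c \<in> koszul_chains m i" and b: "b \<in> koszul_chains m (Suc i)"
    "\<And>J a. Poly_Mapping.keys a \<in> K \<Longrightarrow>
      Poly_Mapping.lookup (c J) a = Poly_Mapping.lookup (koszul_diff m b J) a"
    unfolding B by blast
  show "scale_chain x c \<in> koszul_boundaries m (SR_ideal m K) i" for x
    using c b chain.subspace_scale[OF subspace_koszul_chains] unfolding B
    by (intro CollectI conjI bexI[of _ "scale_chain x b"])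
      (simp_all add: koszul_diff_scale lookup_const_mult scale_chain_def[of x c])
  fix c' :: "'a chain" assume "c' \<in> koszul_boundaries m (SR_ideal m K) i"
  then obtain b' where c': "c' \<in> koszul_chains m i" and b': "b' \<in> koszul_chains m (Suc i)"
    "\<And>J a. Poly_Mapping.keys a \<in> K \<Longrightarrow>
      Poly_Mapping.lookup (c' J) a = Poly_Mapping.lookup (koszul_diff m b' J) a"
    unfolding B by blast
  show "c + c' \<in> koszul_boundaries m (SR_ideal m K) i"
    using c b c' b' chain.subspace_add[OF subspace_koszul_chains] unfolding B
    by (intro CollectI conjI bexI[of _ "b + b'"]) (simp_all add: koszul_diff_add lookup_add)
qed

lemma koszul_boundaries_subset_cycles:
  assumes "abstract_simplicial_complex K"
  shows "koszul_boundaries m (SR_ideal m K) i \<subseteq> koszul_cycles m (SR_ideal m K) i"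
proof
  fix c :: "'a chain" assume "c \<in> koszul_boundaries m (SR_ideal m K) i"
  then obtain b where c: "c \<in> koszul_chains m i" and b: "b \<in> koszul_chains m (Suc i)"
    "\<And>J a. Poly_Mapping.keys a \<in> K \<Longrightarrow>
      Poly_Mapping.lookup (c J) a = Poly_Mapping.lookup (koszul_diff m b J) a"
    unfolding koszul_boundaries_SR_ideal[OF assms] by blast
  have "Poly_Mapping.lookup (koszul_diff m c J) a = 0" if a: "Poly_Mapping.keys a \<in> K" for J a
  proof -
    \<comment> \<open>At \<open>a\<close>, the differential reads \<open>c\<close> only at divisors
      of \<open>a\<close>. Their supports are again faces, and there \<open>c\<close> agrees with
      the differential of \<open>b\<close>.\<close>
    have "Poly_Mapping.keys (a - Poly_Mapping.single j 1) \<in> K" for j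
    proof -
      have "Poly_Mapping.keys (a - Poly_Mapping.single j 1) \<subseteq> Poly_Mapping.keys a"
        by (auto simp: in_keys_iff lookup_minus)
      then show ?thesis using a assms unfolding abstract_simplicial_complex_def by blast
    qed
    then have eq: "Poly_Mapping.lookup (c J') (a - Poly_Mapping.single j 1) =
        Poly_Mapping.lookup (koszul_diff m b J') (a - Poly_Mapping.single j 1)" for J' j
      by (rule b(2))
    have "Poly_Mapping.lookup (koszul_diff m c J) a =
        Poly_Mapping.lookup (koszul_diff m (koszul_diff m b) J) a"
      unfolding lookup_koszul_diff[of m c] lookup_koszul_diff[of m "koszul_diff m b"] eq ..
    then show ?thesis by (simp add: koszul_diff_diff)
  qed
  then show "c \<in> koszul_cycles m (SR_ideal m K) i"
    using c unfolding koszul_cycles_SR_ideal[OF assms] by blast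
qed

section \<open>The squarefree multidegrees\<close>

definition restrict_complex :: "'v set set \<Rightarrow> 'v set \<Rightarrow> 'v set set" where
  "restrict_complex K W = {\<sigma>\<in>K. \<sigma> \<subseteq> W}"

lemma face_family_restrict:
  assumes "abstract_simplicial_complex K" "finite W"
  shows "face_family (restrict_complex K W)"
proof -
  have "restrict_complex K W \<subseteq> Pow W" by (auto simp: restrict_complex_def)
  then have "finite (restrict_complex K W)" using assms(2) finite_subset by blast
  then show ?thesis
    using assms unfolding face_family_def restrict_complex_def abstract_simplicial_complex_def
    by blast
qed

text \<open>With this sign the Koszul differential on \<open>v\<^sup>\<sigma> u\<^sub>W\<^sub>-\<^sub>\<sigma>\<close> becomes the simplicial coboundary
  on \<open>\<sigma>\<close>.\<close>

definition koszul_sign :: "nat set \<Rightarrow> nat set \<Rightarrow> 'k::field" where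
  "koszul_sign W \<sigma> = (-1) ^ (\<Sum>l\<in>\<sigma>. card {i\<in>W. i < l})"

lemma koszul_sign_square [simp]: "koszul_sign W \<sigma> * koszul_sign W \<sigma> = 1"
  by (simp add: koszul_sign_def flip: power_add mult_2)

lemma koszul_sign_square' [simp]: "koszul_sign W \<sigma> * (koszul_sign W \<sigma> * x) = x"
  by (simp flip: mult.assoc)

text \<open>The elements of \<open>W\<close> below \<open>j\<close> split between \<sigma> and its
  complement, so the exponent that \<open>j\<close> contributes to \<open>koszul_sign\<close> is the
  sum of the two positions of \<open>j\<close>.\<close>

lemma incidence_koszul_sign:
  assumes "finite W" "\<sigma> \<subseteq> W" "j \<in> \<sigma>"
  shows "incidence \<sigma> j * koszul_sign W (\<sigma> - {j}) =
    (koszul_sign W \<sigma> * (-1) ^ card {l\<in>W - \<sigma>. l < j} :: 'k::field)"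
proof -
  have "{l\<in>W. l < j} = {l\<in>W - \<sigma>. l < j} \<union> {l\<in>\<sigma>. l < j}" using assms by auto
  then have "card {l\<in>W. l < j} = card {l\<in>W - \<sigma>. l < j} + card {l\<in>\<sigma>. l < j}"
    using assms finite_subset[OF assms(2,1)] by (simp add: card_Un_disjoint disjoint_iff)
  moreover have "(\<Sum>l\<in>\<sigma>. card {i\<in>W. i < l}) = card {l\<in>W. l < j} + (\<Sum>l\<in>\<sigma> - {j}. card {i\<in>W. i < l})"
    by (rule sum.remove[OF finite_subset[OF assms(2,1)] assms(3)])
  ultimately have "koszul_sign W \<sigma> * (-1) ^ card {l\<in>W - \<sigma>. l < j} =
      ((-1) ^ (card {l\<in>W - \<sigma>. l < j} + card {l\<in>W - \<sigma>. l < j}) :: 'k) *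
      (incidence \<sigma> j * koszul_sign W (\<sigma> - {j}))"
    by (simp add: koszul_sign_def incidence_def power_add)
  then show ?thesis by (simp flip: mult_2)
qed

text \<open>The signed coefficients of the monomials v^\<sigma> u_(W-\<sigma>), which are those of
  squarefree multidegree \<open>W\<close>. Restricting \<sigma> to faces amounts to passing to the
  quotient by the ideal.\<close>

definition sqfree_part :: "nat set set \<Rightarrow> nat set \<Rightarrow> 'k::field chain \<Rightarrow> nat set \<Rightarrow> 'k" where
  "sqfree_part K W c \<sigma> =
     (if \<sigma> \<in> restrict_complex K W
      then koszul_sign W \<sigma> * Poly_Mapping.lookup (c (W - \<sigma>)) (sqfree \<sigma>) else 0)"

lemma linear_sqfree_part: "Vector_Spaces.linear scale_chain scale_fun (sqfree_part K W)"
  by unfold_locales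
    (auto simp: sqfree_part_def scale_fun_def fun_eq_iff scale_chain_def lookup_add lookup_const_mult
      algebra_simps)

lemma sqfree_part_in_cochains: "sqfree_part K W c \<in> cochains (restrict_complex K W)"
  by (simp add: sqfree_part_def cochains_def)

lemma coboundary_sqfree_part:
  assumes K: "abstract_simplicial_complex K" and W: "W \<subseteq> {1..m}"
  shows "coboundary (restrict_complex K W) (sqfree_part K W c) =
    sqfree_part K W (koszul_diff m (c :: 'k::field chain))"
proof
  fix \<sigma>
  show "coboundary (restrict_complex K W) (sqfree_part K W c) \<sigma> =
      sqfree_part K W (koszul_diff m c) \<sigma>"
  proof (cases "\<sigma> \<in> restrict_complex K W")
    case True
    have finW: "finite W" using W finite_subset by blast
    have \<sigma>: "\<sigma> \<in> K" "\<sigma> \<subseteq> W" using True by (auto simp: restrict_complex_def)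
    have fin: "finite \<sigma>" using finW \<sigma> finite_subset by blast
    \<comment> \<open>The differential creates v_j, so only those \<open>j\<close> contribute for
      which v_j divides v^\<sigma>.\<close>
    have "Poly_Mapping.lookup (koszul_diff m c (W - \<sigma>)) (sqfree \<sigma>) =
      (\<Sum>j\<in>\<sigma>. (-1) ^ card {l\<in>W - \<sigma>. l < j} *
        Poly_Mapping.lookup (c (W - (\<sigma> - {j}))) (sqfree (\<sigma> - {j})))"
      unfolding lookup_koszul_diff
    proof (rule sum.mono_neutral_cong_right)
      show "\<sigma> \<subseteq> {1..m} - (W - \<sigma>)" using \<sigma> W by auto
      fix j assume j: "j \<in> \<sigma>"
      have "insert j (W - \<sigma>) = W - (\<sigma> - {j})" using j \<sigma> by auto
      then show "(if Poly_Mapping.lookup (sqfree \<sigma>) j > 0 then (-1) ^ card {l\<in>W - \<sigma>. l < j} *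
          Poly_Mapping.lookup (c (insert j (W - \<sigma>))) (sqfree \<sigma> - Poly_Mapping.single j 1) else 0) =
        (-1) ^ card {l\<in>W - \<sigma>. l < j} * Poly_Mapping.lookup (c (W - (\<sigma> - {j}))) (sqfree (\<sigma> - {j}))"
        unfolding sqfree_Diff[OF fin j] using j fin by (simp add: lookup_sqfree)
    qed (use fin in \<open>auto simp: lookup_sqfree\<close>)
    then have "sqfree_part K W (koszul_diff m c) \<sigma> =
      (\<Sum>j\<in>\<sigma>. (koszul_sign W \<sigma> * (-1) ^ card {l\<in>W - \<sigma>. l < j}) *
        Poly_Mapping.lookup (c (W - (\<sigma> - {j}))) (sqfree (\<sigma> - {j})))"
      using True by (simp add: sqfree_part_def sum_distrib_left mult.assoc)
    also have "\<dots> = (\<Sum>j\<in>\<sigma>. incidence \<sigma> j * sqfree_part K W c (\<sigma> - {j}))"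
    proof (rule sum.cong[OF refl])
      fix j assume j: "j \<in> \<sigma>"
      have "\<sigma> - {j} \<in> restrict_complex K W"
        using \<sigma> K unfolding restrict_complex_def abstract_simplicial_complex_def by blast
      then show "(koszul_sign W \<sigma> * (-1) ^ card {l\<in>W - \<sigma>. l < j}) *
        Poly_Mapping.lookup (c (W - (\<sigma> - {j}))) (sqfree (\<sigma> - {j})) =
        incidence \<sigma> j * sqfree_part K W c (\<sigma> - {j})"
        unfolding incidence_koszul_sign[OF finW \<sigma>(2) j, symmetric]
        by (simp add: sqfree_part_def mult.assoc)
    qed
    finally show ?thesis using True by (simp add: coboundary_def)
  qed (simp add: coboundary_def sqfree_part_def)
qed

text \<open>Koszul degree \<open>i\<close> is the size of W - \<sigma>, so \<sigma> has
  \<open>card W - i\<close> elements. Natural subtraction would allow the empty face when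
  \<open>card W < i\<close>, hence the separate vanishing claim.\<close>

lemma sqfree_part_homogeneous:
  assumes c: "c \<in> koszul_chains m i" and W: "finite W"
  shows "sqfree_part K W c \<in> homogeneous (card W - i)"
    and "card W < i \<Longrightarrow> sqfree_part K W c = 0"
proof -
  have *: "card W = card \<sigma> + i" if "sqfree_part K W c \<sigma> \<noteq> 0" for \<sigma>
  proof -
    have "\<sigma> \<subseteq> W" "Poly_Mapping.lookup (c (W - \<sigma>)) (sqfree \<sigma>) \<noteq> 0"
      using that by (auto simp: sqfree_part_def restrict_complex_def split: if_splits)
    then show ?thesis
      using koszul_chainsD(2)[OF c] card_Diff_subset[of \<sigma> W] card_mono[of W \<sigma>] W finite_subset[of \<sigma> W]
      by fastforce
  qed
  show "sqfree_part K W c \<in> homogeneous (card W - i)" unfolding homogeneous_def using * by force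
  show "sqfree_part K W c = 0" if "card W < i"
    using * that by (metis (no_types, lifting) add_lessD1 ext not_add_less2 zero_fun_apply)
qed

text \<open>A right inverse of all \<open>sqfree_part\<close> maps at once: it assembles one cochain
  for each multidegree \<open>W\<close> into a Koszul chain.\<close>

definition sqfree_chain ::
    "nat \<Rightarrow> nat set set \<Rightarrow> (nat set \<Rightarrow> nat set \<Rightarrow> 'k) \<Rightarrow> 'k::field chain" where
  "sqfree_chain m K y J = (\<Sum>\<sigma>\<in>Pow {1..m}. Poly_Mapping.single (sqfree \<sigma>)
     (if J \<subseteq> {1..m} \<and> J \<inter> \<sigma> = {} \<and> \<sigma> \<in> K
      then koszul_sign (J \<union> \<sigma>) \<sigma> * y (J \<union> \<sigma>) \<sigma> else 0))"

lemma lookup_sqfree_chain: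
  "Poly_Mapping.lookup (sqfree_chain m K y J) a =
    (if J \<union> Poly_Mapping.keys a \<subseteq> {1..m} \<and> J \<inter> Poly_Mapping.keys a = {} \<and> Poly_Mapping.keys a \<in> K \<and>
        a = sqfree (Poly_Mapping.keys a)
     then koszul_sign (J \<union> Poly_Mapping.keys a) (Poly_Mapping.keys a) *
       y (J \<union> Poly_Mapping.keys a) (Poly_Mapping.keys a) else 0)"
proof -
  have iff: "sqfree \<sigma> = a \<longleftrightarrow> \<sigma> = Poly_Mapping.keys a \<and> a = sqfree (Poly_Mapping.keys a)"
    if "\<sigma> \<in> Pow {1..m}" for \<sigma>
    using that keys_sqfree finite_subset[of \<sigma> "{1..m}"] by auto
  have "Poly_Mapping.lookup (sqfree_chain m K y J) a =
    (\<Sum>\<sigma>\<in>Pow {1..m}. if \<sigma> = Poly_Mapping.keys a then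
      (if a = sqfree \<sigma> \<and> J \<subseteq> {1..m} \<and> J \<inter> \<sigma> = {} \<and> \<sigma> \<in> K
      then koszul_sign (J \<union> \<sigma>) \<sigma> * y (J \<union> \<sigma>) \<sigma> else 0) else 0)"
    unfolding sqfree_chain_def lookup_sum lookup_single
    by (rule sum.cong[OF refl]) (auto simp: iff when_def)
  then show ?thesis by auto
qed

lemma sqfree_part_sqfree_chain:
  assumes "W \<subseteq> {1..m}" "y W \<in> cochains (restrict_complex K W)"
  shows "sqfree_part K W (sqfree_chain m K y) = y W"
proof
  fix \<sigma>
  show "sqfree_part K W (sqfree_chain m K y) \<sigma> = y W \<sigma>"
  proof (cases "\<sigma> \<in> restrict_complex K W")
    case True
    then have \<sigma>: "\<sigma> \<subseteq> W" "\<sigma> \<in> K" by (auto simp: restrict_complex_def)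
    have "finite \<sigma>" using finite_subset[OF order_trans[OF \<sigma>(1) assms(1)]] by simp
    moreover have "W - \<sigma> \<union> \<sigma> = W" "(W - \<sigma>) \<inter> \<sigma> = {}" using \<sigma> by auto
    ultimately show ?thesis
      using True \<sigma> assms(1) by (simp add: sqfree_part_def lookup_sqfree_chain keys_sqfree)
  qed (use assms(2) in \<open>simp add: sqfree_part_def cochains_def\<close>)
qed

lemma sqfree_chain_in_chains:
  assumes "\<And>W \<sigma>. W \<subseteq> {1..m} \<Longrightarrow> y W \<sigma> \<noteq> 0 \<Longrightarrow> card W = card \<sigma> + i"
  shows "sqfree_chain m K y \<in> koszul_chains m i"
proof (rule koszul_chainsI)
  fix J a assume nz: "Poly_Mapping.lookup (sqfree_chain m K y J) a \<noteq> 0"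
  let ?\<sigma> = "Poly_Mapping.keys a"
  have *: "J \<union> ?\<sigma> \<subseteq> {1..m}" "J \<inter> ?\<sigma> = {}" "y (J \<union> ?\<sigma>) ?\<sigma> \<noteq> 0"
    using nz by (auto simp: lookup_sqfree_chain split: if_splits)
  then have "card (J \<union> ?\<sigma>) = card ?\<sigma> + i" using assms by blast
  moreover have "finite J" using * finite_subset by blast
  ultimately show "J \<subseteq> {1..m} \<and> card J = i \<and> ?\<sigma> \<subseteq> {1..m}"
    using * by (simp add: card_Un_disjoint)
qed

text \<open>Agreement is at exponents supported on faces, that is, modulo the ideal. The
  differential preserves the combined multidegree of \<open>J\<close> and \<open>a\<close>, so
  nothing arrives in a multidegree that is not squarefree.\<close>

lemma koszul_diff_sqfree_chain:
  assumes K: "abstract_simplicial_complex K" "\<Union>K \<subseteq> {1..m}"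
    and y: "\<And>W. W \<subseteq> {1..m} \<Longrightarrow> y W \<in> cochains (restrict_complex K W)"
    and a: "Poly_Mapping.keys a \<in> K"
  shows "Poly_Mapping.lookup (koszul_diff m (sqfree_chain m K y) J) a =
    Poly_Mapping.lookup (sqfree_chain m K (\<lambda>W. coboundary (restrict_complex K W) (y W)) J) a"
proof -
  let ?\<sigma> = "Poly_Mapping.keys a"
  have a_sub: "?\<sigma> \<subseteq> {1..m}" using a K by auto
  show ?thesis
  proof (cases "J \<subseteq> {1..m} \<and> J \<inter> ?\<sigma> = {} \<and> a = sqfree ?\<sigma>")
    case True
    define W where "W = J \<union> ?\<sigma>"
    have W: "W \<subseteq> {1..m}" "W - ?\<sigma> = J" using True a_sub by (auto simp: W_def)
    have \<sigma>: "?\<sigma> \<in> restrict_complex K W" using a by (simp add: W_def restrict_complex_def)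
    have "Poly_Mapping.lookup (koszul_diff m (sqfree_chain m K y) J) a =
        koszul_sign W ?\<sigma> * sqfree_part K W (koszul_diff m (sqfree_chain m K y)) ?\<sigma>"
      using \<sigma> True by (simp add: sqfree_part_def W(2))
    also have "\<dots> = koszul_sign W ?\<sigma> * coboundary (restrict_complex K W) (y W) ?\<sigma>"
      unfolding coboundary_sqfree_part[OF K(1) W(1), symmetric]
        sqfree_part_sqfree_chain[where y = y, OF W(1) y[OF W(1)]] ..
    also have "\<dots> = Poly_Mapping.lookup (sqfree_chain m K (\<lambda>W. coboundary (restrict_complex K W) (y W)) J) a"
      using True a a_sub by (simp add: lookup_sqfree_chain W_def)
    finally show ?thesis .
  next
    case False
    have "Poly_Mapping.lookup (sqfree_chain m K y (insert j J)) (a - Poly_Mapping.single j 1) = 0"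
      if j: "j \<in> {1..m} - J" "Poly_Mapping.lookup a j > 0" for j
    proof (rule ccontr)
      let ?b = "a - Poly_Mapping.single j 1"
      assume "Poly_Mapping.lookup (sqfree_chain m K y (insert j J)) ?b \<noteq> 0"
      then have *: "insert j J \<subseteq> {1..m}" "insert j J \<inter> Poly_Mapping.keys ?b = {}"
        "?b = sqfree (Poly_Mapping.keys ?b)"
        by (auto simp: lookup_sqfree_chain split: if_splits)
      have ab: "a = ?b + Poly_Mapping.single j 1"
        by (rule poly_mapping_eqI)
          (use j in \<open>auto simp: lookup_add lookup_minus lookup_single when_def\<close>)
      have keys: "?\<sigma> = insert j (Poly_Mapping.keys ?b)"
        using j(2) by (auto simp: in_keys_iff lookup_minus lookup_single when_def split: if_splits)
      have "a = sqfree ?\<sigma>"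
      proof (rule poly_mapping_eqI)
        fix x
        have "Poly_Mapping.lookup a x = Poly_Mapping.lookup (sqfree (Poly_Mapping.keys ?b)) x +
            Poly_Mapping.lookup (Poly_Mapping.single j 1) x"
          using ab *(3) by (metis lookup_add)
        then show "Poly_Mapping.lookup a x = Poly_Mapping.lookup (sqfree ?\<sigma>) x"
          unfolding keys using *(2) by (auto simp: lookup_sqfree lookup_single when_def)
      qed
      then show False using False * keys j by auto
    qed
    then have "Poly_Mapping.lookup (koszul_diff m (sqfree_chain m K y) J) a = 0"
      unfolding lookup_koszul_diff by (intro sum.neutral) auto
    then show ?thesis using False by (simp add: lookup_sqfree_chain) blast
  qed
qed

text \<open>A contracting homotopy on the multidegrees that are not squarefree: on \<open>v\<^sup>a u\<^sub>J\<close>, trade \<open>v\<^sub>p\<close>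
  for \<open>u\<^sub>p\<close>, where \<open>p\<close> is the least index occurring at least twice. Since \<open>v\<^sub>p\<close> keeps dividing the
  monomial, its support and hence membership in the ideal do not change.\<close>

definition repeated :: "nat set \<Rightarrow> (nat \<Rightarrow>\<^sub>0 nat) \<Rightarrow> nat set" where
  "repeated J a = {x. Poly_Mapping.lookup a x + (if x \<in> J then 1 else 0) \<ge> 2}"

definition sqfree_contract :: "'k::field chain \<Rightarrow> 'k chain" where
  "sqfree_contract c J = Poly_Mapping.Abs_poly_mapping (\<lambda>a.
     let p = Min (repeated J a) in
     if finite J \<and> repeated J a \<noteq> {} \<and> p \<in> J
     then (-1) ^ card {l\<in>J. l < p} * Poly_Mapping.lookup (c (J - {p})) (a + Poly_Mapping.single p 1)
     else 0)"

lemma lookup_sqfree_contract: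
  "Poly_Mapping.lookup (sqfree_contract c J) a =
    (let p = Min (repeated J a) in
     if finite J \<and> repeated J a \<noteq> {} \<and> p \<in> J
     then (-1) ^ card {l\<in>J. l < p} * Poly_Mapping.lookup (c (J - {p})) (a + Poly_Mapping.single p 1)
     else 0)" (is "_ = ?F a")
proof -
  have "{a. ?F a \<noteq> 0} \<subseteq> (\<Union>p\<in>(if finite J then J else {}).
      (\<lambda>b. b - Poly_Mapping.single p 1) ` Poly_Mapping.keys (c (J - {p})))" (is "?A \<subseteq> ?B")
  proof
    fix a assume "a \<in> ?A"
    define p where "p = Min (repeated J a)"
    have "finite J" "p \<in> J" "Poly_Mapping.lookup (c (J - {p})) (a + Poly_Mapping.single p 1) \<noteq> 0"
      using \<open>a \<in> ?A\<close> by (auto simp: p_def Let_def split: if_splits)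
    moreover have "a = (a + Poly_Mapping.single p 1) - Poly_Mapping.single p 1" by simp
    ultimately have "a \<in> (\<lambda>b. b - Poly_Mapping.single p 1) ` Poly_Mapping.keys (c (J - {p}))"
      by (metis image_eqI in_keys_iff)
    with \<open>finite J\<close> \<open>p \<in> J\<close> show "a \<in> ?B" by auto
  qed
  moreover have "finite ?B" by auto
  ultimately have "finite ?A" by (rule finite_subset)
  then show ?thesis unfolding sqfree_contract_def by (subst lookup_Abs_poly_mapping) auto
qed

lemma finite_repeated: "finite (repeated J a)"
proof (rule finite_subset)
  show "repeated J a \<subseteq> Poly_Mapping.keys a" by (auto simp: repeated_def in_keys_iff split: if_splits)
qed simp

lemma sqfree_contract_chain:
  assumes c: "c \<in> koszul_chains m i"
  shows "sqfree_contract c \<in> koszul_chains m (Suc i)"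
proof (rule koszul_chainsI)
  fix J a assume nz: "Poly_Mapping.lookup (sqfree_contract c J) a \<noteq> 0"
  define p where "p = Min (repeated J a)"
  have J: "finite J" "p \<in> J"
    and l: "Poly_Mapping.lookup (c (J - {p})) (a + Poly_Mapping.single p 1) \<noteq> 0"
    using nz by (auto simp: lookup_sqfree_contract Let_def p_def split: if_splits)
  note sub = koszul_chainsD[OF c l]
  have keys: "Poly_Mapping.keys (a + Poly_Mapping.single p 1) = insert p (Poly_Mapping.keys a)"
    by (auto simp: in_keys_iff lookup_add lookup_single when_def split: if_splits)
  then have "p \<in> {1..m}" using sub(3) by auto
  moreover have "card J = Suc i" using sub(2) card.remove[OF J] by simp
  ultimately show "J \<subseteq> {1..m} \<and> card J = Suc i \<and> Poly_Mapping.keys a \<subseteq> {1..m}"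
    using sub keys by auto
qed

text \<open>Trading v_j for u_j preserves the multidegree. Hence the differential does not disturb
  the choice of the index \<open>p\<close> in the homotopy.\<close>

lemma repeated_insert:
  assumes "j \<notin> J" "Poly_Mapping.lookup a j > 0"
  shows "repeated (insert j J) (a - Poly_Mapping.single j 1) = repeated J a"
  using assms by (auto simp: repeated_def lookup_minus lookup_single when_def split: if_splits)

text \<open>In the sum of both compositions everything cancels except one term with
  \<open>j = p\<close>, which restores \<open>c\<close>. It comes from the contraction of the
  differential if \<open>p\<close> is in \<open>J\<close> and from the differential of the
  contraction otherwise. Unlike in \<open>koszul_contract\<close>, smaller indices may lie in
  \<open>J\<close>, so the contraction needs a sign.\<close>

lemma sqfree_homotopy:
  fixes c :: "'k::field chain"
  assumes J: "J \<subseteq> {1..m}" and a: "Poly_Mapping.keys a \<subseteq> {1..m}" and rep: "repeated J a \<noteq> {}"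
  shows "Poly_Mapping.lookup (koszul_diff m (sqfree_contract c) J) a +
    Poly_Mapping.lookup (sqfree_contract (koszul_diff m c) J) a = Poly_Mapping.lookup (c J) a"
proof -
  define p where "p = Min (repeated J a)"
  have fin: "finite J" using finite_subset[OF J] by simp
  have p_in: "p \<in> repeated J a" unfolding p_def using Min_in[OF finite_repeated rep] .
  then have ap: "Poly_Mapping.lookup a p > 0" by (auto simp: repeated_def split: if_splits)
  then have "p \<in> Poly_Mapping.keys a" by (simp add: in_keys_iff)
  then have pm: "p \<in> {1..m}" using a by (rule subsetD[rotated])
  have sgn: "(-1) ^ card {l\<in>L. l < j} = (incidence L j :: 'k)" for L j by (simp add: incidence_def)
  have dh: "Poly_Mapping.lookup (koszul_diff m (sqfree_contract c) J) a =
    (\<Sum>j\<in>{1..m} - J. if Poly_Mapping.lookup a j > 0 \<and> p \<in> insert j J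
       then incidence J j * (incidence (insert j J) p * Poly_Mapping.lookup (c (insert j J - {p}))
         (a - Poly_Mapping.single j 1 + Poly_Mapping.single p 1))
       else 0)"
    unfolding lookup_koszul_diff sgn
  proof (rule sum.cong[OF refl])
    fix j assume j: "j \<in> {1..m} - J"
    show "(if Poly_Mapping.lookup a j > 0
       then incidence J j *
         Poly_Mapping.lookup (sqfree_contract c (insert j J)) (a - Poly_Mapping.single j 1)
       else 0) =
      (if Poly_Mapping.lookup a j > 0 \<and> p \<in> insert j J
       then incidence J j * (incidence (insert j J) p * Poly_Mapping.lookup (c (insert j J - {p}))
         (a - Poly_Mapping.single j 1 + Poly_Mapping.single p 1))
       else 0)"
    proof (cases "Poly_Mapping.lookup a j > 0")
      case True
      have "j \<notin> J" using j by simp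
      show ?thesis
        unfolding lookup_sqfree_contract repeated_insert[OF \<open>j \<notin> J\<close> True] p_def[symmetric] Let_def sgn
        using fin True rep by (simp del: insert_iff)
    qed simp
  qed
  show ?thesis
  proof (cases "p \<in> J")
    case True
    have "Poly_Mapping.lookup (sqfree_contract (koszul_diff m c) J) a =
        incidence J p * Poly_Mapping.lookup (koszul_diff m c (J - {p})) (a + Poly_Mapping.single p 1)"
      unfolding lookup_sqfree_contract p_def[symmetric] Let_def sgn using True fin rep by simp
    also have "Poly_Mapping.lookup (koszul_diff m c (J - {p})) (a + Poly_Mapping.single p 1) =
      (\<Sum>j\<in>insert p ({1..m} - J). if Poly_Mapping.lookup (a + Poly_Mapping.single p 1) j > 0
       then incidence (J - {p}) j * Poly_Mapping.lookup (c (insert j (J - {p})))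
         (a + Poly_Mapping.single p 1 - Poly_Mapping.single j 1)
       else 0)"
      unfolding lookup_koszul_diff sgn by (rule sum.cong) (use True pm in auto)
    \<comment> \<open>The summand \<open>j = p\<close> puts u_p back and removes the extra v_p; its
      sign cancels against the one in \<open>sqfree_contract\<close>.\<close>
    also have "\<dots> = incidence (J - {p}) p * Poly_Mapping.lookup (c J) a + (\<Sum>j\<in>{1..m} - J.
      if Poly_Mapping.lookup (a + Poly_Mapping.single p 1) j > 0
       then incidence (J - {p}) j * Poly_Mapping.lookup (c (insert j (J - {p})))
         (a + Poly_Mapping.single p 1 - Poly_Mapping.single j 1)
       else 0)"
      using True by (subst sum.insert) (simp, simp, simp add: lookup_add insert_absorb)
    also have "(\<Sum>j\<in>{1..m} - J.
      if Poly_Mapping.lookup (a + Poly_Mapping.single p 1) j > 0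
       then incidence (J - {p}) j * Poly_Mapping.lookup (c (insert j (J - {p})))
         (a + Poly_Mapping.single p 1 - Poly_Mapping.single j 1)
       else 0) = - (incidence J p * Poly_Mapping.lookup (koszul_diff m (sqfree_contract c) J) a)"
      unfolding dh sum_distrib_left sum_negf[symmetric]
    proof (rule sum.cong[OF refl])
      fix j assume j: "j \<in> {1..m} - J"
      then have pj: "p \<noteq> j" using True by auto
      show "(if Poly_Mapping.lookup (a + Poly_Mapping.single p 1) j > 0
         then incidence (J - {p}) j * Poly_Mapping.lookup (c (insert j (J - {p})))
           (a + Poly_Mapping.single p 1 - Poly_Mapping.single j 1)
         else 0) =
        - (incidence J p * (if Poly_Mapping.lookup a j > 0 \<and> p \<in> insert j J
         then incidence J j * (incidence (insert j J) p * Poly_Mapping.lookup (c (insert j J - {p}))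
           (a - Poly_Mapping.single j 1 + Poly_Mapping.single p 1))
         else 0))"
      proof (cases "Poly_Mapping.lookup a j > 0")
        case pos: True
        have ins: "insert j (J - {p}) = insert j J - {p}" "insert j J - {j} = J" using pj j by auto
        have "incidence (insert j J) j * incidence J p =
            - (incidence (insert j J) p * incidence (insert j J - {p}) j :: 'k)"
          using incidence_swap[of "insert j J" j p, where 'k='k] fin True pj by (simp add: ins)
        moreover have "incidence (insert j J) j = (incidence J j :: 'k)"
          using incidence_Diff[of "insert j J" j j, where 'k='k] fin by (simp add: ins)
        moreover have "incidence (insert j J - {p}) j = (incidence (J - {p}) j :: 'k)"
          using incidence_Diff[of "insert j J - {p}" j j, where 'k='k] fin pj j
          by (simp add: insert_Diff_if)
        ultimately have "incidence J j * incidence J p =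
            - (incidence (insert j J) p * incidence (J - {p}) j :: 'k)" by simp
        then have "incidence (insert j J) p * (incidence J j * incidence J p) =
            - (incidence (insert j J) p * incidence (insert j J) p * incidence (J - {p}) j :: 'k)"
          by simp
        then have s: "incidence (J - {p}) j =
            - (incidence J p * (incidence J j * incidence (insert j J) p) :: 'k)"
          by (simp add: ac_simps)
        have exp: "a + Poly_Mapping.single p 1 - Poly_Mapping.single j 1 =
            a - Poly_Mapping.single j 1 + Poly_Mapping.single p 1"
          by (rule poly_mapping_eqI)
            (use pj pos in \<open>auto simp: lookup_add lookup_minus lookup_single when_def\<close>)
        show ?thesis
          unfolding s exp ins(1) using pos True pj by (simp add: lookup_add mult.assoc)
      next
        case False
        then show ?thesis using pj by (simp add: lookup_add lookup_single_not_eq)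
      qed
    qed
    also have "incidence (J - {p}) p = (incidence J p :: 'k)"
      using incidence_Diff[OF fin True, of p, where 'k='k] by simp
    finally show ?thesis by (simp add: algebra_simps flip: mult.assoc)
  next
    case False
    have hd: "Poly_Mapping.lookup (sqfree_contract (koszul_diff m c) J) a = 0"
      using False by (simp add: lookup_sqfree_contract Let_def flip: p_def)
    have exp: "a - Poly_Mapping.single p 1 + Poly_Mapping.single p 1 = a"
      by (rule poly_mapping_eqI)
        (use ap in \<open>auto simp: lookup_add lookup_minus lookup_single when_def\<close>)
    have ins: "insert p J - {p} = J" using False by auto
    have "incidence (insert p J) p = (incidence J p :: 'k)"
      using incidence_Diff[of "insert p J" p p, where 'k='k] fin by (simp add: ins)
    then have sq: "incidence J p * (incidence (insert p J) p * x) = x" for x :: 'k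
      by (simp flip: mult.assoc)
    have "Poly_Mapping.lookup (koszul_diff m (sqfree_contract c) J) a =
      (\<Sum>j\<in>{1..m} - J. if j = p then Poly_Mapping.lookup (c J) a else 0)"
      unfolding dh
    proof (rule sum.cong[OF refl])
      fix j assume "j \<in> {1..m} - J"
      show "(if Poly_Mapping.lookup a j > 0 \<and> p \<in> insert j J
       then incidence J j * (incidence (insert j J) p * Poly_Mapping.lookup (c (insert j J - {p}))
         (a - Poly_Mapping.single j 1 + Poly_Mapping.single p 1))
       else 0) = (if j = p then Poly_Mapping.lookup (c J) a else 0)"
      proof (cases "j = p")
        case True
        then show ?thesis using ap by (simp only: exp ins sq) simp
      qed (use False in auto)
    qed
    also have "\<dots> = Poly_Mapping.lookup (c J) a"
      using pm False by (simp add: sum.delta)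
    finally show ?thesis using hd by simp
  qed
qed

section \<open>Tor as a sum of Betti numbers of full subcomplexes\<close>

lemma homogeneous_coboundary:
  assumes X: "face_family X" and c: "c \<in> coboundaries X" "c \<in> homogeneous k"
  obtains b where "b \<in> cochains X" "coboundary X b = c" "\<And>\<sigma>. b \<sigma> \<noteq> 0 \<Longrightarrow> k = Suc (card \<sigma>)"
proof -
  obtain b where b: "b \<in> cochains X" "c = coboundary X b" using c by (auto simp: coboundaries_def)
  have ck: "c = component k c" using component_of_homogeneous[OF c(2), of k] by simp
  show thesis
  proof (cases k)
    case 0
    have "coboundary X b \<sigma> = 0" if "card \<sigma> = 0" for \<sigma>
      using that X by (auto simp: coboundary_def face_family_def)
    then have "component k c = 0" using 0 b by (auto simp: component_def)
    then have "coboundary X 0 = c" using ck by (auto simp: coboundary_def fun_eq_iff)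
    then show thesis using that[of 0] by (simp add: cochains_def)
  next
    case (Suc l)
    then have "coboundary X (component l b) = c"
      using coboundary_component[OF X] b ck by metis
    moreover have "k = Suc (card \<sigma>)" if "component l b \<sigma> \<noteq> 0" for \<sigma>
      using that Suc by (simp add: component_def split: if_splits)
    ultimately show thesis using that[of "component l b"] b component_in_cochains by blast
  qed
qed

text \<open>The differential of a chain \<open>b0\<close>, assembled from primitives of the
  squarefree parts, is subtracted from \<open>z\<close>. The remainder \<open>w\<close> is still a
  cycle modulo the ideal and vanishes, modulo the ideal, in all squarefree multidegrees. In the
  other multidegrees \<open>sqfree_contract\<close> supplies its primitive
  \<open>b1\<close>.\<close>

lemma koszul_boundaryI:
  fixes z :: "'k::field chain"
  assumes K: "abstract_simplicial_complex K" "\<Union>K \<subseteq> {1..m}"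
    and z: "z \<in> koszul_cycles m (SR_ideal m K) i"
    and part: "\<And>W. W \<subseteq> {1..m} \<Longrightarrow> sqfree_part K W z \<in> coboundaries (restrict_complex K W)"
  shows "z \<in> koszul_boundaries m (SR_ideal m K) i"
proof -
  have zc: "z \<in> koszul_chains m i"
    and dz: "\<And>J a. Poly_Mapping.keys a \<in> K \<Longrightarrow> Poly_Mapping.lookup (koszul_diff m z J) a = 0"
    using z unfolding koszul_cycles_SR_ideal[OF K(1)] by auto
  have "\<exists>b. b \<in> cochains (restrict_complex K W) \<and>
      coboundary (restrict_complex K W) b = sqfree_part K W z \<and>
      (\<forall>\<sigma>. b \<sigma> \<noteq> 0 \<longrightarrow> card W = card \<sigma> + Suc i)" if W: "W \<subseteq> {1..m}" for W
  proof -
    have fin: "finite W" using finite_subset[OF W] by simp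
    note ff = face_family_restrict[OF K(1) fin]
    show ?thesis
    proof (cases "card W < i")
      case True
      have "coboundary (restrict_complex K W) 0 = (0 :: _ \<Rightarrow> 'k)"
        by (simp add: coboundary_def fun_eq_iff)
      then show ?thesis
        using sqfree_part_homogeneous(2)[OF zc fin True] by (intro exI[of _ 0]) (simp add: cochains_def)
    next
      case False
      \<comment> \<open>The primitive is homogeneous with one vertex fewer than the cocycle, so that
        the assembled chain has Koszul degree i + 1.\<close>
      obtain b where "b \<in> cochains (restrict_complex K W)"
        "coboundary (restrict_complex K W) b = sqfree_part K W z"
        "\<And>\<sigma>. b \<sigma> \<noteq> 0 \<Longrightarrow> card W - i = Suc (card \<sigma>)"
        using homogeneous_coboundary[OF ff part[OF W] sqfree_part_homogeneous(1)[OF zc fin]] by blast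
      then show ?thesis using False by (intro exI[of _ b]) force
    qed
  qed
  then obtain y where y: "\<And>W. W \<subseteq> {1..m} \<Longrightarrow> y W \<in> cochains (restrict_complex K W)"
    "\<And>W. W \<subseteq> {1..m} \<Longrightarrow> coboundary (restrict_complex K W) (y W) = sqfree_part K W z"
    "\<And>W \<sigma>. W \<subseteq> {1..m} \<Longrightarrow> y W \<sigma> \<noteq> 0 \<Longrightarrow> card W = card \<sigma> + Suc i"
    by metis
  define b0 where "b0 = sqfree_chain m K y"
  have b0: "b0 \<in> koszul_chains m (Suc i)" unfolding b0_def by (rule sqfree_chain_in_chains[OF y(3)])
  have db0: "Poly_Mapping.lookup (koszul_diff m b0 J) a = Poly_Mapping.lookup (z J) a"
    if a: "Poly_Mapping.keys a \<in> K" and J: "J \<subseteq> {1..m}" and rep: "repeated J a = {}" for J a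
  proof -
    let ?\<sigma> = "Poly_Mapping.keys a"
    have \<sigma>: "?\<sigma> \<subseteq> {1..m}" using K a by auto
    have le: "Poly_Mapping.lookup a x + (if x \<in> J then 1 else 0) \<le> 1" for x
    proof -
      have "\<not> 2 \<le> Poly_Mapping.lookup a x + (if x \<in> J then 1 else 0)"
        using rep unfolding repeated_def by blast
      then show ?thesis by linarith
    qed
    have "J \<inter> ?\<sigma> = {}"
    proof -
      have "x \<notin> ?\<sigma>" if "x \<in> J" for x using le[of x] that by (simp add: in_keys_iff)
      then show ?thesis by auto
    qed
    moreover have "a = sqfree ?\<sigma>"
    proof (rule poly_mapping_eqI)
      fix x show "Poly_Mapping.lookup a x = Poly_Mapping.lookup (sqfree ?\<sigma>) x"
        using le[of x] by (auto simp: lookup_sqfree in_keys_iff)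
    qed
    moreover define W where "W = J \<union> ?\<sigma>"
    ultimately have W: "W \<subseteq> {1..m}" "W - ?\<sigma> = J" "?\<sigma> \<in> restrict_complex K W"
      and *: "J \<inter> ?\<sigma> = {}" "a = sqfree ?\<sigma>"
      using J \<sigma> a by (auto simp: restrict_complex_def)
    have "Poly_Mapping.lookup (koszul_diff m b0 J) a =
        Poly_Mapping.lookup (sqfree_chain m K (\<lambda>W. coboundary (restrict_complex K W) (y W)) J) a"
      unfolding b0_def by (rule koszul_diff_sqfree_chain[OF K y(1) a])
    also have "\<dots> = koszul_sign W ?\<sigma> * sqfree_part K W z ?\<sigma>"
      using J \<sigma> * a y(2)[OF W(1)] by (simp add: lookup_sqfree_chain W_def)
    also have "\<dots> = Poly_Mapping.lookup (z J) a"
      using W(3) *(2) by (simp add: sqfree_part_def W(2))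
    finally show ?thesis .
  qed
  have dd: "koszul_diff m (koszul_diff m b0) = 0" by (simp add: koszul_diff_diff fun_eq_iff)
  define w where "w = z - koszul_diff m b0"
  have dw: "koszul_diff m w = koszul_diff m z"
    unfolding w_def using dd by (simp add: koszul_diff_minus fun_eq_iff)
  have wc: "w \<in> koszul_chains m i"
  proof -
    have "koszul_diff m b0 \<in> koszul_chains m i"
      by (rule koszul_chainsI) (use koszul_diffD[OF b0] in blast)
    then show ?thesis unfolding w_def using zc chain.subspace_diff[OF subspace_koszul_chains] by blast
  qed
  define b1 where "b1 = sqfree_contract w"
  have b1: "b1 \<in> koszul_chains m (Suc i)" unfolding b1_def by (rule sqfree_contract_chain[OF wc])
  have db1: "Poly_Mapping.lookup (koszul_diff m b1 J) a = Poly_Mapping.lookup (w J) a"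
    if a: "Poly_Mapping.keys a \<in> K" for J a
  proof (cases "J \<subseteq> {1..m}")
    case False
    then show ?thesis using koszul_diffD(1)[OF b1] koszul_chainsD(1)[OF wc] by metis
  next
    case J: True
    show ?thesis
    proof (cases "repeated J a = {}")
      case True
      have "Poly_Mapping.lookup (b1 (insert j J)) (a - Poly_Mapping.single j 1) = 0"
        if "j \<in> {1..m} - J" "Poly_Mapping.lookup a j > 0" for j
        using that True repeated_insert[of j J a] by (simp add: b1_def lookup_sqfree_contract)
      then have "Poly_Mapping.lookup (koszul_diff m b1 J) a = 0"
        unfolding lookup_koszul_diff by (intro sum.neutral) auto
      moreover have "Poly_Mapping.lookup (w J) a = 0"
        using db0[OF a J True] by (simp add: w_def lookup_minus)
      ultimately show ?thesis by simp
    next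
      case False
      have "Poly_Mapping.lookup (sqfree_contract (koszul_diff m w) J) a = 0"
      proof -
        let ?p = "Min (repeated J a)"
        have "repeated J a \<subseteq> Poly_Mapping.keys a"
          by (auto simp: repeated_def in_keys_iff split: if_splits)
        then have "?p \<in> Poly_Mapping.keys a" using Min_in[OF finite_repeated False] by blast
        then have "Poly_Mapping.keys (a + Poly_Mapping.single ?p 1) = Poly_Mapping.keys a"
          by (auto simp: in_keys_iff lookup_add lookup_single when_def split: if_splits)
        then have "Poly_Mapping.lookup (koszul_diff m w L) (a + Poly_Mapping.single ?p 1) = 0" for L
          unfolding dw using dz a by metis
        then show ?thesis by (simp add: lookup_sqfree_contract Let_def)
      qed
      moreover have "Poly_Mapping.keys a \<subseteq> {1..m}" using a K by auto
      ultimately show ?thesis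
        unfolding b1_def using sqfree_homotopy[OF J _ False, of w] by simp
    qed
  qed
  have "Poly_Mapping.lookup (z J) a = Poly_Mapping.lookup (koszul_diff m (b0 + b1) J) a"
    if "Poly_Mapping.keys a \<in> K" for J a
    using db1[OF that, of J] by (simp add: koszul_diff_add lookup_add w_def lookup_minus)
  then show ?thesis
    unfolding koszul_boundaries_SR_ideal[OF K(1)]
    using zc chain.subspace_add[OF subspace_koszul_chains b0 b1] by blast
qed

text \<open>The \<open>W\<close> with fewer than \<open>i\<close> elements are left out: no chain of
  Koszul degree \<open>i\<close> has multidegree \<open>W\<close>, and \<open>card W - i\<close>
  would be truncated to 0, counting the empty face wrongly.\<close>

theorem has_qdim_Tor:
  assumes K: "abstract_simplicial_complex K" "\<Union>K \<subseteq> {1..m}"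
  shows "has_qdim scale_chain (koszul_cycles m (SR_ideal m K :: 'k::field mpoly set) i)
    (koszul_boundaries m (SR_ideal m K) i)
    (\<Sum>W | W \<subseteq> {1..m} \<and> i \<le> card W. betti TYPE('k) (restrict_complex K W) (card W - i))"
proof (rule has_qdim_direct_sum[where f = "sqfree_part K" and
      Z' = "\<lambda>W. cocycles (restrict_complex K W) \<inter> homogeneous (card W - i)" and
      B' = "\<lambda>W. coboundaries (restrict_complex K W) \<inter> homogeneous (card W - i)"])
  let ?S = "{W. W \<subseteq> {1..m} \<and> i \<le> card W}"
  have fin: "finite W" if "W \<subseteq> {1..m}" for W using finite_subset[OF that] by simp
  have 0: "0 \<in> cochains X" "0 \<in> coboundaries X" for X :: "nat set set"
    using cochain.subspace_0 subspace_cochains subspace_coboundaries by blast+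
  show "has_qdim scale_fun (cocycles (restrict_complex K W) \<inter> homogeneous (card W - i) :: (_ \<Rightarrow> 'k) set)
    (coboundaries (restrict_complex K W) \<inter> homogeneous (card W - i))
    (betti TYPE('k) (restrict_complex K W) (card W - i))" if "W \<in> ?S" for W
    using has_qdim_betti face_family_restrict[OF K(1) fin] that by blast
  show "sqfree_part K W z \<in> cocycles (restrict_complex K W) \<inter> homogeneous (card W - i)"
    if W: "W \<in> ?S" and z: "z \<in> koszul_cycles m (SR_ideal m K :: 'k mpoly set) i" for W z
  proof -
    have zc: "z \<in> koszul_chains m i"
      and dz: "\<And>J a. Poly_Mapping.keys a \<in> K \<Longrightarrow> Poly_Mapping.lookup (koszul_diff m z J) a = 0"
      using z unfolding koszul_cycles_SR_ideal[OF K(1)] by auto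
    have "sqfree_part K W (koszul_diff m z) \<sigma> = 0" for \<sigma>
    proof (cases "\<sigma> \<in> restrict_complex K W")
      case True
      then have "\<sigma> \<in> K" "finite \<sigma>" using finite_subset[of \<sigma> W] fin[of W] W
        by (auto simp: restrict_complex_def)
      then show ?thesis by (simp add: sqfree_part_def dz keys_sqfree)
    qed (simp add: sqfree_part_def)
    then have "coboundary (restrict_complex K W) (sqfree_part K W z) = 0"
      using coboundary_sqfree_part[OF K(1), of W m z] W by (auto simp: fun_eq_iff)
    then show ?thesis
      using sqfree_part_homogeneous(1)[OF zc fin] sqfree_part_in_cochains W by (auto simp: cocycles_def)
  qed
  show "z \<in> koszul_boundaries m (SR_ideal m K) i \<longleftrightarrow>
      (\<forall>W\<in>?S. sqfree_part K W z \<in> coboundaries (restrict_complex K W) \<inter> homogeneous (card W - i))"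
    if z: "z \<in> koszul_cycles m (SR_ideal m K :: 'k mpoly set) i" for z
  proof
    assume "z \<in> koszul_boundaries m (SR_ideal m K) i"
    then obtain b where zc: "z \<in> koszul_chains m i" and b: "b \<in> koszul_chains m (Suc i)"
      "\<And>J a. Poly_Mapping.keys a \<in> K \<Longrightarrow>
        Poly_Mapping.lookup (z J) a = Poly_Mapping.lookup (koszul_diff m b J) a"
      unfolding koszul_boundaries_SR_ideal[OF K(1)] by blast
    show "\<forall>W\<in>?S. sqfree_part K W z \<in> coboundaries (restrict_complex K W) \<inter> homogeneous (card W - i)"
    proof
      fix W assume W: "W \<in> ?S"
      have "sqfree_part K W z \<sigma> = sqfree_part K W (koszul_diff m b) \<sigma>" for \<sigma>
      proof (cases "\<sigma> \<in> restrict_complex K W")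
        case True
        then have "\<sigma> \<in> K" "finite \<sigma>" using finite_subset[of \<sigma> W] fin[of W] W
          by (auto simp: restrict_complex_def)
        then show ?thesis by (simp add: sqfree_part_def b(2) keys_sqfree)
      qed (simp add: sqfree_part_def)
      then have "sqfree_part K W z = coboundary (restrict_complex K W) (sqfree_part K W b)"
        using coboundary_sqfree_part[OF K(1), of W m b] W by (auto simp: fun_eq_iff)
      then have "sqfree_part K W z \<in> coboundaries (restrict_complex K W)"
        unfolding coboundaries_def using sqfree_part_in_cochains by blast
      then show "sqfree_part K W z \<in> coboundaries (restrict_complex K W) \<inter> homogeneous (card W - i)"
        using sqfree_part_homogeneous(1)[OF zc fin] W by blast
    qed
  next
    assume part: "\<forall>W\<in>?S. sqfree_part K W z \<in> coboundaries (restrict_complex K W) \<inter> homogeneous (card W - i)"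
    have zc: "z \<in> koszul_chains m i" using z unfolding koszul_cycles_SR_ideal[OF K(1)] by auto
    show "z \<in> koszul_boundaries m (SR_ideal m K) i"
    proof (rule koszul_boundaryI[OF K z])
      fix W assume W: "W \<subseteq> {1..m}"
      show "sqfree_part K W z \<in> coboundaries (restrict_complex K W)"
      proof (cases "i \<le> card W")
        case False
        then have "sqfree_part K W z = 0" using sqfree_part_homogeneous(2)[OF zc fin[OF W]] by simp
        then show ?thesis using 0 by simp
      qed (use part W in auto)
    qed
  qed
  show "\<exists>z\<in>koszul_cycles m (SR_ideal m K) i. \<forall>W\<in>?S.
      sqfree_part K W z - y W \<in> coboundaries (restrict_complex K W) \<inter> homogeneous (card W - i)"
    if y: "\<And>W. W \<in> ?S \<Longrightarrow> y W \<in> cocycles (restrict_complex K W) \<inter> homogeneous (card W - i)"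
    for y :: "nat set \<Rightarrow> nat set \<Rightarrow> 'k"
  proof -
    \<comment> \<open>The family is arbitrary outside the index set. Zero values there keep the
      assembled chain in Koszul degree \<open>i\<close>.\<close>
    define y' where "y' W = (if i \<le> card W then y W else 0)" for W
    have y'c: "y' W \<in> cochains (restrict_complex K W)" if "W \<subseteq> {1..m}" for W
      using y[of W] that 0 by (auto simp: y'_def cocycles_def)
    have y'h: "card W = card \<sigma> + i" if "W \<subseteq> {1..m}" "y' W \<sigma> \<noteq> 0" for W \<sigma>
      using y[of W] that by (force simp: y'_def homogeneous_def split: if_splits)
    have dy: "coboundary (restrict_complex K W) (y' W) = 0" if "W \<subseteq> {1..m}" for W
      using y[of W] that by (auto simp: y'_def cocycles_def coboundary_def fun_eq_iff)
    let ?z = "sqfree_chain m K y'"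
    have "?z \<in> koszul_chains m i" by (rule sqfree_chain_in_chains[OF y'h])
    moreover have "Poly_Mapping.lookup (koszul_diff m ?z J) a = 0" if "Poly_Mapping.keys a \<in> K" for J a
    proof -
      have "Poly_Mapping.lookup (koszul_diff m ?z J) a = Poly_Mapping.lookup
          (sqfree_chain m K (\<lambda>W. coboundary (restrict_complex K W) (y' W)) J) a"
        by (rule koszul_diff_sqfree_chain[OF K y'c that])
      then show ?thesis using dy by (simp add: lookup_sqfree_chain)
    qed
    ultimately have "?z \<in> koszul_cycles m (SR_ideal m K) i"
      unfolding koszul_cycles_SR_ideal[OF K(1)] by blast
    moreover have "sqfree_part K W ?z - y W = 0" if "W \<in> ?S" for W
      using sqfree_part_sqfree_chain[where y = y', OF _ y'c] that by (simp add: y'_def)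
    ultimately show ?thesis using 0 by (intro bexI[of _ ?z]) (auto simp: homogeneous_def)
  qed
  show "koszul_boundaries m (SR_ideal m K :: 'k mpoly set) i \<subseteq> koszul_cycles m (SR_ideal m K) i"
    by (rule koszul_boundaries_subset_cycles[OF K(1)])
qed (use chain.vector_space_axioms cochain.vector_space_axioms linear_sqfree_part
    subspace_koszul_cycles[OF K(1)] subspace_koszul_boundaries[OF K(1)] in auto)

text \<open>For fixed \<open>W\<close>, letting \<open>i\<close> run up to \<open>card W\<close>
  lets \<open>card W - i\<close> run through all vertex counts of faces. The range up to
  \<open>m\<close> in the definition covers this since \<open>W\<close> has at most \<open>m\<close>
  elements.\<close>

theorem hochster_formula:
  assumes K: "abstract_simplicial_complex K" "\<Union>K \<subseteq> {1..m}"
  shows "total_bigraded_betti TYPE('k::field) m K =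
    (\<Sum>W\<in>Pow {1..m}. total_betti TYPE('k) (restrict_complex K W))"
proof -
  have card: "card W \<le> m" if "W \<in> Pow {1..m}" for W
    using card_mono[of "{1..m}" W] that by simp
  have "total_bigraded_betti TYPE('k) m K = (\<Sum>i\<le>m. \<Sum>W | W \<in> Pow {1..m} \<and> i \<le> card W.
      betti TYPE('k) (restrict_complex K W) (card W - i))"
    unfolding total_bigraded_betti_def Tor_dim_def
    using chain.has_qdim_quotient_dim[OF has_qdim_Tor[OF K, where 'k='k]] by simp
  also have "\<dots> = (\<Sum>W\<in>Pow {1..m}. \<Sum>i | i \<in> {..m} \<and> i \<le> card W.
      betti TYPE('k) (restrict_complex K W) (card W - i))"
    by (rule sum.swap_restrict) auto
  also have "\<dots> = (\<Sum>W\<in>Pow {1..m}. total_betti TYPE('k) (restrict_complex K W))"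
  proof (rule sum.cong[OF refl])
    fix W assume W: "W \<in> Pow {1..m}"
    have fin: "finite W" using finite_subset[of W "{1..m}"] W by simp
    have "(\<Sum>i | i \<in> {..m} \<and> i \<le> card W. betti TYPE('k) (restrict_complex K W) (card W - i)) =
        (\<Sum>k\<le>card W. betti TYPE('k) (restrict_complex K W) k)"
      by (rule sum.reindex_bij_witness[where i = "\<lambda>k. card W - k" and j = "\<lambda>i. card W - i"])
        (use card[OF W] in auto)
    also have "\<dots> = total_betti TYPE('k) (restrict_complex K W)"
      by (rule total_betti_eq_sum_betti[OF face_family_restrict[OF K(1) fin], symmetric])
        (use fin in \<open>auto simp: restrict_complex_def intro: card_mono\<close>)
    finally show "(\<Sum>i | i \<in> {..m} \<and> i \<le> card W. betti TYPE('k) (restrict_complex K W) (card W - i)) =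
        total_betti TYPE('k) (restrict_complex K W)" .
  qed
  finally show ?thesis .
qed

section \<open>Links and minimal non-faces\<close>

definition link :: "'v set set \<Rightarrow> 'v \<Rightarrow> 'v set set" where
  "link K v = {\<sigma>. v \<notin> \<sigma> \<and> insert v \<sigma> \<in> K}"

text \<open>Relative to a ground set: for a complex, a ghost vertex in \<open>M\<close> yields a
  singleton, and a subset of \<open>M\<close> has exactly those minimal non-faces that it
  contains.\<close>

definition min_nonfaces :: "'v set set \<Rightarrow> 'v set \<Rightarrow> 'v set set" where
  "min_nonfaces K M = {A. A \<subseteq> M \<and> A \<notin> K \<and> (\<forall>a\<in>A. A - {a} \<in> K)}"

text \<open>Hochster's sum over an arbitrary ground set. Links live on \<open>M - {v}\<close>, so an
  induction on \<open>total_bigraded_betti\<close> itself would require relabelling the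
  vertices.\<close>

definition betti_sum :: "'k::field itself \<Rightarrow> 'v::linorder set set \<Rightarrow> 'v set \<Rightarrow> nat" where
  "betti_sum F K M = (\<Sum>W\<in>Pow M. total_betti F (restrict_complex K W))"

lemma face_subset:
  "abstract_simplicial_complex K \<Longrightarrow> \<sigma> \<in> K \<Longrightarrow> \<tau> \<subseteq> \<sigma> \<Longrightarrow> \<tau> \<in> K"
  unfolding abstract_simplicial_complex_def by blast

lemma empty_face: "abstract_simplicial_complex K \<Longrightarrow> {} \<in> K"
  unfolding abstract_simplicial_complex_def by blast

lemma abstract_simplicial_complex_link:
  assumes "abstract_simplicial_complex K" "{v} \<in> K"
  shows "abstract_simplicial_complex (link K v)"
  unfolding abstract_simplicial_complex_def link_def
proof (intro conjI ballI allI impI)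
  fix \<sigma> \<tau> assume "\<sigma> \<in> {\<sigma>. v \<notin> \<sigma> \<and> insert v \<sigma> \<in> K}" "\<tau> \<subseteq> \<sigma>"
  then show "\<tau> \<in> {\<sigma>. v \<notin> \<sigma> \<and> insert v \<sigma> \<in> K}"
    using face_subset[OF assms(1), of "insert v \<sigma>" "insert v \<tau>"] by auto
next
  fix \<sigma> assume "\<sigma> \<in> {\<sigma>. v \<notin> \<sigma> \<and> insert v \<sigma> \<in> K}"
  then show "finite \<sigma>" using assms(1) unfolding abstract_simplicial_complex_def by auto
qed (use assms in auto)

lemma Union_link: "\<Union>(link K v) \<subseteq> \<Union>K - {v}"
  unfolding link_def by blast

lemma min_nonface_exists:
  assumes "finite \<tau>" "\<tau> \<notin> K"
  obtains A where "A \<in> min_nonfaces K \<tau>"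
proof -
  have "finite {A \<in> Pow \<tau>. A \<notin> K}" "{A \<in> Pow \<tau>. A \<notin> K} \<noteq> {}" using assms by auto
  from finite_has_minimal[OF this] obtain A where
    A: "A \<in> {A \<in> Pow \<tau>. A \<notin> K}" "\<forall>B\<in>{A \<in> Pow \<tau>. A \<notin> K}. B \<subseteq> A \<longrightarrow> A = B" ..
  have "A - {a} \<in> K" if "a \<in> A" for a
  proof (rule ccontr)
    assume "A - {a} \<notin> K"
    then have "A = A - {a}" using A(1) A(2)[rule_format, of "A - {a}"] by auto
    then show False using that by auto
  qed
  then show thesis using that[of A] A by (auto simp: min_nonfaces_def)
qed

lemma min_nonfaces_mono: "M \<subseteq> N \<Longrightarrow> min_nonfaces K M \<subseteq> min_nonfaces K N"
  by (auto simp: min_nonfaces_def)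

lemma min_nonface_subset_eq:
  assumes "abstract_simplicial_complex K" "A \<in> min_nonfaces K M" "B \<notin> K" "B \<subseteq> A"
  shows "B = A"
proof (rule ccontr)
  assume "B \<noteq> A"
  then obtain a where "a \<in> A" "B \<subseteq> A - {a}" using assms(4) by blast
  then have "B \<in> K" using assms(1,2) face_subset unfolding min_nonfaces_def by blast
  then show False using assms(3) by simp
qed

lemma face_iff_min_nonfaces:
  assumes K: "abstract_simplicial_complex K" "\<Union>K \<subseteq> M" and M: "finite M"
  shows "\<sigma> \<in> K \<longleftrightarrow> \<sigma> \<subseteq> M \<and> (\<forall>A\<in>min_nonfaces K M. \<not> A \<subseteq> \<sigma>)"
proof
  assume "\<sigma> \<in> K"
  then show "\<sigma> \<subseteq> M \<and> (\<forall>A\<in>min_nonfaces K M. \<not> A \<subseteq> \<sigma>)"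
    using K face_subset[OF K(1)] by (auto simp: min_nonfaces_def)
next
  assume *: "\<sigma> \<subseteq> M \<and> (\<forall>A\<in>min_nonfaces K M. \<not> A \<subseteq> \<sigma>)"
  show "\<sigma> \<in> K"
  proof (rule ccontr)
    assume "\<sigma> \<notin> K"
    then obtain A where "A \<in> min_nonfaces K \<sigma>"
      using min_nonface_exists[of \<sigma> K] * M finite_subset by metis
    then have "A \<in> min_nonfaces K M" "A \<subseteq> \<sigma>"
      using * by (auto simp: min_nonfaces_def)
    then show False using * by blast
  qed
qed

text \<open>The faces through \<open>v\<close> are upward closed and become the link when
  \<open>v\<close> is removed; the other faces form the full subcomplex on \<open>W\<close>. Here
  \<open>r2\<close> is the rank of the restriction from \<open>insert v W\<close> to
  \<open>W\<close>.\<close>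

lemma link_triangle:
  assumes K: "abstract_simplicial_complex K" and v: "{v} \<in> K" "v \<notin> W" and W: "finite W"
  obtains r1 r2 r3
  where "total_betti TYPE('k::field) (restrict_complex K (insert v W)) = r1 + r2"
    "total_betti TYPE('k) (restrict_complex K W) = r2 + r3"
    "total_betti TYPE('k) (restrict_complex (link K v) W) = r1 + r3"
    "r2 = 0 \<longleftrightarrow> (\<forall>c\<in>cocycles (restrict_complex K (insert v W)).
      (\<lambda>\<sigma>. if v \<in> \<sigma> then 0 else c \<sigma> :: 'k) \<in> coboundaries (restrict_complex K W))"
proof -
  let ?X = "restrict_complex K (insert v W)"
  let ?Y = "restrict_complex (link K v) W"
  let ?L = "insert v ` ?Y"
  have Y: "face_family ?Y"
    by (rule face_family_restrict[OF abstract_simplicial_complex_link[OF K v(1)] W])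
  have L: "?L = {\<sigma>\<in>?X. v \<in> \<sigma>}"
  proof (intro set_eqI iffI)
    fix \<sigma> assume \<sigma>: "\<sigma> \<in> {\<sigma>\<in>?X. v \<in> \<sigma>}"
    then have "\<sigma> - {v} \<in> ?Y" "\<sigma> = insert v (\<sigma> - {v})"
      by (auto simp: restrict_complex_def link_def insert_absorb)
    then show "\<sigma> \<in> ?L" by blast
  qed (auto simp: restrict_complex_def link_def)
  have Q: "?X - ?L = restrict_complex K W"
    unfolding L using v(2) by (auto simp: restrict_complex_def)
  have bL: "total_betti TYPE('k) ?L = total_betti TYPE('k) ?Y"
    by (rule total_betti_insert_image[OF Y]) (auto simp: restrict_complex_def link_def)
  have X: "face_family ?X" by (rule face_family_restrict[OF K]) (use W in simp)
  obtain r1 r2 r3 where r: "total_betti TYPE('k) ?X = r1 + r2"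
    "total_betti TYPE('k) (?X - ?L) = r2 + r3" "total_betti TYPE('k) ?L = r1 + r3"
    "r2 = 0 \<longleftrightarrow> (\<forall>c\<in>cocycles ?X. (\<lambda>\<sigma>. if \<sigma> \<in> ?L then 0 else c \<sigma> :: 'k) \<in> coboundaries (?X - ?L))"
  proof (rule total_betti_triangle[OF X, of ?L])
    show "?L \<subseteq> ?X" unfolding L by auto
    show "\<tau> \<in> ?L" if "\<sigma> \<in> ?L" "\<tau> \<in> ?X" "\<sigma> \<subseteq> \<tau>" for \<sigma> \<tau> using that unfolding L by auto
  qed
  have "(\<lambda>\<sigma>. if \<sigma> \<in> ?L then 0 else c \<sigma>) = (\<lambda>\<sigma>. if v \<in> \<sigma> then 0 else c \<sigma>)"
    if "c \<in> cocycles ?X" for c :: "_ \<Rightarrow> 'k"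
    using that unfolding L by (auto simp: fun_eq_iff cocycles_def cochains_def)
  then have "r2 = 0 \<longleftrightarrow> (\<forall>c\<in>cocycles ?X.
      (\<lambda>\<sigma>. if v \<in> \<sigma> then 0 else c \<sigma> :: 'k) \<in> coboundaries (restrict_complex K W))"
    using r(4) unfolding Q by simp
  then show thesis using that r(1-3) unfolding Q bL by blast
qed

section \<open>Betti sums under passage to a link\<close>

lemma betti_sum_insert:
  assumes M: "finite M" "v \<in> M"
  shows "betti_sum F K M = (\<Sum>W\<in>Pow (M - {v}).
    total_betti F (restrict_complex K W) + total_betti F (restrict_complex K (insert v W)))"
proof -
  have "Pow M = Pow (M - {v}) \<union> insert v ` Pow (M - {v})"
    using Pow_insert[of v "M - {v}"] M(2) by (simp add: insert_absorb)
  moreover have "Pow (M - {v}) \<inter> insert v ` Pow (M - {v}) = {}" by auto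
  moreover have "inj_on (insert v) (Pow (M - {v}))"
    by (rule inj_onI) (metis Diff_insert_absorb PowD insertI1 mk_disjoint_insert subset_Diff_insert)
  ultimately show ?thesis
    using M(1) by (simp add: betti_sum_def sum.union_disjoint sum.reindex sum.distrib)
qed

text \<open>Termwise in \<open>W\<close>, r1 + r3 is compared with (r1 + r2) + (r2 + r3).\<close>

lemma betti_sum_link_le:
  assumes K: "abstract_simplicial_complex K" and v: "{v} \<in> K" "v \<in> M" and M: "finite M"
  shows "betti_sum TYPE('k::field) (link K v) (M - {v}) \<le> betti_sum TYPE('k) K M"
  unfolding betti_sum_insert[OF M v(2), of _ K] betti_sum_def[of _ "link K v"]
proof (rule sum_mono)
  fix W assume "W \<in> Pow (M - {v})"
  then have "v \<notin> W" "finite W" using finite_subset[of W M] M by auto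
  then show "total_betti TYPE('k) (restrict_complex (link K v) W) \<le>
      total_betti TYPE('k) (restrict_complex K W) + total_betti TYPE('k) (restrict_complex K (insert v W))"
    using link_triangle[OF K v(1), of W, where 'k='k] by (metis add.commute add_le_mono le_add2 le_add1)
qed

text \<open>If passing to the link preserves the sum of the Betti numbers, then all the restriction maps
  \<open>H(K\<^bsub>W\<union>v\<^esub>) \<rightarrow> H(K\<^bsub>W\<^esub>)\<close> vanish. The cochain that is the indicator of \<open>A - a\<close> shows that this
  fails for \<open>W = A\<close> unless \<open>A - a \<union> v\<close> is a face.\<close>

lemma face_of_betti_sum_link_eq:
  assumes K: "abstract_simplicial_complex K" and v: "{v} \<in> K" "v \<in> M" and M: "finite M"
    and eq: "betti_sum TYPE('k::field) (link K v) (M - {v}) = betti_sum TYPE('k) K M"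
    and A: "A \<in> min_nonfaces K M" "v \<notin> A" "a \<in> A"
  shows "insert v (A - {a}) \<in> K"
proof (rule ccontr)
  assume notK: "insert v (A - {a}) \<notin> K"
  have A': "A \<subseteq> M" "A \<notin> K" "\<And>b. b \<in> A \<Longrightarrow> A - {b} \<in> K" using A(1) by (auto simp: min_nonfaces_def)
  have finA: "finite A" using A' M finite_subset by blast
  let ?b = "\<lambda>W. total_betti TYPE('k) (restrict_complex K W)"
  let ?l = "\<lambda>W. total_betti TYPE('k) (restrict_complex (link K v) W)"
  have le: "?l W \<le> ?b W + ?b (insert v W)" if "W \<in> Pow (M - {v})" for W
  proof -
    have "v \<notin> W" "finite W" using finite_subset[of W M] M that by auto
    then show ?thesis
      using link_triangle[OF K v(1), of W, where 'k='k] by (metis add.commute add_le_mono le_add2 le_add1)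
  qed
  \<comment> \<open>The Betti sums compare term by term, so equality of the sums forces equality at
    every \<open>W\<close>, in particular at \<open>A\<close>.\<close>
  have lA: "?l A = ?b A + ?b (insert v A)"
  proof (rule ccontr)
    assume "?l A \<noteq> ?b A + ?b (insert v A)"
    then have "?l A < ?b A + ?b (insert v A)" using le[of A] A' A by force
    then have "(\<Sum>W\<in>Pow (M - {v}). ?l W) < (\<Sum>W\<in>Pow (M - {v}). ?b W + ?b (insert v W))"
      using le A A' M by (intro sum_strict_mono_ex1) auto
    then show False
      using eq unfolding betti_sum_insert[OF M v(2), of _ K] betti_sum_def[of _ "link K v"] by simp
  qed
  \<comment> \<open>A cocycle: the only sets inside \<open>insert v A\<close> covering
    \<open>A - {a}\<close> are \<open>A\<close> and \<open>insert v (A - {a})\<close>, and neither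
    is a face.\<close>
  define e where "e = (\<lambda>\<sigma>. if \<sigma> = A - {a} then 1 else 0 :: 'k)"
  have "e \<in> cocycles (restrict_complex K (insert v A))"
  proof -
    have "coboundary (restrict_complex K (insert v A)) e \<sigma> = 0" for \<sigma>
    proof (cases "\<sigma> \<in> restrict_complex K (insert v A)")
      case True
      have "e (\<sigma> - {j}) = 0" if "j \<in> \<sigma>" for j
      proof (rule ccontr)
        assume "e (\<sigma> - {j}) \<noteq> 0"
        then have "\<sigma> - {j} = A - {a}" by (auto simp: e_def split: if_splits)
        then have \<sigma>: "\<sigma> = insert j (A - {a})" "j \<notin> A - {a}" using that by auto
        then have "j = a \<or> j = v" using True by (auto simp: restrict_complex_def)
        then have "\<sigma> = A \<or> \<sigma> = insert v (A - {a})" using \<sigma> A by auto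
        then show False using True notK A' by (auto simp: restrict_complex_def)
      qed
      then show ?thesis by (simp add: coboundary_def)
    qed (simp add: coboundary_def)
    moreover have "e \<in> cochains (restrict_complex K (insert v A))"
      using A'(3)[OF A(3)] by (auto simp: e_def cochains_def restrict_complex_def)
    ultimately show ?thesis by (auto simp: cocycles_def fun_eq_iff)
  qed
  moreover have "(\<lambda>\<sigma>. if v \<in> \<sigma> then 0 else e \<sigma>) = e" using A by (auto simp: e_def fun_eq_iff)
  ultimately have "e \<in> coboundaries (restrict_complex K A)"
  proof -
    obtain r1 r2 r3 where r: "?b (insert v A) = r1 + r2" "?b A = r2 + r3" "?l A = r1 + r3"
      "r2 = 0 \<longleftrightarrow> (\<forall>c\<in>cocycles (restrict_complex K (insert v A)).
        (\<lambda>\<sigma>. if v \<in> \<sigma> then 0 else c \<sigma> :: 'k) \<in> coboundaries (restrict_complex K A))"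
      using link_triangle[OF K v(1) A(2) finA, where 'k='k] by blast
    have "r2 = 0" using lA r(1-3) by simp
    then have "(\<lambda>\<sigma>. if v \<in> \<sigma> then 0 else e \<sigma>) \<in> coboundaries (restrict_complex K A)"
      using r(4) \<open>e \<in> cocycles _\<close> by blast
    then show ?thesis using \<open>_ = e\<close> by simp
  qed
  then obtain y where y: "y \<in> cochains (restrict_complex K A)" "e = coboundary (restrict_complex K A) y"
    by (auto simp: coboundaries_def)
  \<comment> \<open>Every \<open>A - {b}\<close> is a face of \<open>K\<close>, so on these sets the
    coboundary of \<open>y\<close> in the full simplex on \<open>A\<close> still equals
    \<open>e\<close>. Applying the coboundary once more must give 0 at \<open>A\<close>, but
    \<open>e\<close> gives a sign.\<close>
  have ff: "face_family (Pow A)" using finA by (auto simp: face_family_def intro: finite_subset)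
  have yP: "y \<in> cochains (Pow A)" using y(1) by (auto simp: cochains_def restrict_complex_def)
  have "coboundary (Pow A) y (A - {b}) = e (A - {b})" if "b \<in> A" for b
  proof -
    have "A - {b} \<in> restrict_complex K A" using A'(3)[OF that] by (auto simp: restrict_complex_def)
    moreover have "A - {b} \<in> Pow A" by auto
    ultimately show ?thesis unfolding y(2) coboundary_def by simp
  qed
  then have "coboundary (Pow A) (coboundary (Pow A) y) A = (\<Sum>b\<in>A. incidence A b * e (A - {b}))"
    by (subst (1) coboundary_def) simp
  also have "\<dots> = (\<Sum>b\<in>A. if b = a then incidence A b else 0)"
    by (rule sum.cong[OF refl]) (use A(3) in \<open>auto simp: e_def\<close>)
  also have "\<dots> = incidence A a" using finA A(3) by simp
  finally have "incidence A a = (0 :: 'k)" using coboundary_coboundary[OF ff yP] by simp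
  moreover have "incidence A a * incidence A a = (1 :: 'k)" by (rule incidence_square)
  ultimately show False by simp
qed

text \<open>The number \<open>t\<close> of ground vertices outside the facet stays fixed while facet
  and ground set shrink together. The facet is an arbitrary maximal face, which suits links, where
  only a bound on the size of faces is at hand.\<close>

lemma two_power_le_betti_sum:
  assumes "abstract_simplicial_complex K" "finite M" "\<Union>K \<subseteq> M" "\<sigma> \<in> K"
    and "\<And>\<tau>. \<tau> \<in> K \<Longrightarrow> \<sigma> \<subseteq> \<tau> \<Longrightarrow> \<tau> = \<sigma>" and "card M = card \<sigma> + t"
  shows "2 ^ t \<le> betti_sum TYPE('k::field) K M"
  using assms
proof (induction "card \<sigma>" arbitrary: \<sigma> K M)
  case 0
  then have "finite \<sigma>" unfolding abstract_simplicial_complex_def by blast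
  then have "\<sigma> = {}" using 0 by simp
  then have "K = {{}}" using 0 by blast
  then have "restrict_complex K W = {{}}" for W by (auto simp: restrict_complex_def)
  then show ?case using 0 by (simp add: betti_sum_def total_betti_empty_face card_Pow)
next
  case (Suc n)
  then obtain v where v: "v \<in> \<sigma>" by force
  have fin: "finite \<sigma>" using Suc.prems unfolding abstract_simplicial_complex_def by blast
  have vK: "{v} \<in> K" "v \<in> M" using face_subset[OF Suc.prems(1,4), of "{v}"] v Suc.prems by auto
  have "2 ^ t \<le> betti_sum TYPE('k) (link K v) (M - {v})"
  proof (rule Suc.hyps(1)[of "\<sigma> - {v}"])
    show "abstract_simplicial_complex (link K v)"
      by (rule abstract_simplicial_complex_link[OF Suc.prems(1) vK(1)])
    show "\<sigma> - {v} \<in> link K v" using v Suc.prems by (auto simp: link_def insert_absorb)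
    show "\<tau> = \<sigma> - {v}" if "\<tau> \<in> link K v" "\<sigma> - {v} \<subseteq> \<tau>" for \<tau>
      using Suc.prems(5)[of "insert v \<tau>"] that by (auto simp: link_def)
    show "\<Union>(link K v) \<subseteq> M - {v}" using Union_link[of K v] Suc.prems(3) by blast
  qed (use Suc.hyps(2) Suc.prems(2,6) v fin vK in \<open>simp_all add: card_Diff_singleton_if\<close>)
  also have "\<dots> \<le> betti_sum TYPE('k) K M"
    by (rule betti_sum_link_le[OF Suc.prems(1) vK Suc.prems(2)])
  finally show ?case .
qed

section \<open>Tight complexes have disjoint minimal non-faces\<close>

lemma facet_exists:
  assumes K: "abstract_simplicial_complex K" "\<Union>K \<subseteq> M" "finite M"
  obtains \<sigma> where "\<sigma> \<in> K" "\<And>\<tau>. \<tau> \<in> K \<Longrightarrow> \<sigma> \<subseteq> \<tau> \<Longrightarrow> \<tau> = \<sigma>"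
proof -
  have "K \<subseteq> Pow M" using K(2) by auto
  then have "finite K" using K(3) finite_subset by blast
  then show thesis using finite_has_maximal[of K] empty_face[OF K(1)] that by blast
qed

text \<open>Tightness is split into two inequalities: every face misses at least \<open>t\<close>
  ground vertices, and the Betti sum is at most the power of two. In this form it passes to links
  without determining their dimension.\<close>

lemma disjnt_min_nonfaces_of_betti_sum_le:
  assumes "abstract_simplicial_complex K" "finite M" "\<Union>K \<subseteq> M"
    and "\<And>\<sigma>. \<sigma> \<in> K \<Longrightarrow> card \<sigma> + t \<le> card M" and "betti_sum TYPE('k::field) K M \<le> 2 ^ t"
    and "A \<in> min_nonfaces K M" "B \<in> min_nonfaces K M" "A \<noteq> B"
  shows "disjnt A B"
  using assms
proof (induction "card M" arbitrary: K M A B)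
  case 0
  then have "A = {}" "B = {}" by (auto simp: min_nonfaces_def)
  then show ?case by simp
next
  case (Suc n)
  note K = Suc.prems(1) and A = Suc.prems(6) and B = Suc.prems(7)
  show ?case
  proof (rule ccontr)
    assume meet: "\<not> disjnt A B"
    have "\<not> B \<subseteq> A" using min_nonface_subset_eq[OF K A, of B] B Suc.prems(8) by (auto simp: min_nonfaces_def)
    then obtain v where v: "v \<in> B" "v \<notin> A" by blast
    \<comment> \<open>A common vertex of \<open>A\<close> and \<open>B\<close> differs from
      \<open>v\<close>. So \<open>{v}\<close> is a proper subset of \<open>B\<close>, hence a face,
      and \<open>v\<close> is not a ghost vertex.\<close>
    have "B \<noteq> {v}" using meet v by auto
    then obtain w where "w \<in> B" "w \<noteq> v" using v by blast
    then have vK: "{v} \<in> K" using B face_subset[OF K, of "B - {w}" "{v}"] v by (auto simp: min_nonfaces_def)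
    have vM: "v \<in> M" using v B by (auto simp: min_nonfaces_def)
    let ?L = "link K v"
    note L = abstract_simplicial_complex_link[OF K vK]
    have LM: "\<Union>?L \<subseteq> M - {v}" using Union_link[of K v] Suc.prems(3) by blast
    have cM: "card (M - {v}) = n" "card M = Suc (card (M - {v}))"
      using Suc.hyps(2) vM Suc.prems(2) by (simp_all add: card_Diff_singleton_if)
    have cL: "card \<sigma> + t \<le> card (M - {v})" if "\<sigma> \<in> ?L" for \<sigma>
    proof -
      have "finite \<sigma>" using L that unfolding abstract_simplicial_complex_def by blast
      then show ?thesis using Suc.prems(4)[of "insert v \<sigma>"] that cM by (auto simp: link_def)
    qed
    have le: "betti_sum TYPE('k) ?L (M - {v}) \<le> betti_sum TYPE('k) K M"
      by (rule betti_sum_link_le[OF K vK vM Suc.prems(2)])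
    obtain \<sigma> where \<sigma>: "\<sigma> \<in> ?L" "\<And>\<tau>. \<tau> \<in> ?L \<Longrightarrow> \<sigma> \<subseteq> \<tau> \<Longrightarrow> \<tau> = \<sigma>"
      using facet_exists[OF L LM] Suc.prems(2) by blast
    \<comment> \<open>The Betti sum of the link is squeezed between the bound from one of its facets
      and the Betti sum of \<open>K\<close>, which is at most \<open>2 ^ t\<close>.\<close>
    have "(2::nat) ^ t \<le> 2 ^ (card (M - {v}) - card \<sigma>)"
      using cL[OF \<sigma>(1)] by (intro power_increasing) auto
    also have "\<dots> \<le> betti_sum TYPE('k) ?L (M - {v})"
      using two_power_le_betti_sum[OF L _ LM \<sigma>, of "card (M - {v}) - card \<sigma>", where 'k='k]
        cL[OF \<sigma>(1)] Suc.prems(2) by simp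
    finally have eq: "betti_sum TYPE('k) ?L (M - {v}) = betti_sum TYPE('k) K M"
      using le Suc.prems(5) by linarith
    have "A \<in> min_nonfaces ?L (M - {v})"
    proof -
      have "A \<notin> ?L" using A face_subset[OF K, of "insert v A" A] by (auto simp: link_def min_nonfaces_def)
      moreover have "A - {a} \<in> ?L" if "a \<in> A" for a
        using face_of_betti_sum_link_eq[OF K vK vM Suc.prems(2) eq A v(2) that] v(2) by (simp add: link_def)
      ultimately show ?thesis using A v by (auto simp: min_nonfaces_def)
    qed
    moreover have "B - {v} \<in> min_nonfaces ?L (M - {v})"
    proof -
      have "insert v (B - {v} - {b}) = B - {b}" if "b \<in> B - {v}" for b using v that by auto
      then show ?thesis using B v by (auto simp: min_nonfaces_def link_def insert_absorb)
    qed
    \<comment> \<open>\<open>B - {v}\<close> is a face of \<open>K\<close> and \<open>A\<close> is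
      not. The two sets still meet because \<open>v\<close> is outside \<open>A\<close>, which
      contradicts the induction hypothesis.\<close>
    moreover have "A \<noteq> B - {v}"
    proof
      assume "A = B - {v}"
      then show False using A B v by (auto simp: min_nonfaces_def)
    qed
    ultimately have "disjnt A (B - {v})"
      using Suc.hyps(1)[of "M - {v}" ?L A "B - {v}"] cM L LM cL eq Suc.prems(2,5) by simp
    then show False using meet v by (auto simp: disjnt_def)
  qed
qed

section \<open>Complexes with disjoint minimal non-faces\<close>

lemma min_nonface_link:
  assumes K: "abstract_simplicial_complex K" and W: "finite W" "v \<notin> W"
    and C: "C \<in> min_nonfaces (link K v) W"
  obtains A where "A \<in> min_nonfaces K (insert v W)" "C = A - {v}"
proof -
  have C': "C \<subseteq> W" "C \<notin> link K v" "\<And>c. c \<in> C \<Longrightarrow> C - {c} \<in> link K v"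
    using C by (auto simp: min_nonfaces_def)
  have vC: "v \<notin> C" using C' W by auto
  then have "insert v C \<notin> K" using C' by (auto simp: link_def)
  moreover have "finite (insert v C)" using C' W finite_subset by auto
  ultimately obtain A where A: "A \<in> min_nonfaces K (insert v C)" using min_nonface_exists by blast
  \<comment> \<open>If \<open>A\<close> missed some \<open>c\<close> in \<open>C\<close>, it would
    lie in the face \<open>insert v (C - {c})\<close>. So minimal non-faces of the link arise by
    deleting \<open>v\<close>, and disjointness is inherited.\<close>
  have "A - {v} = C"
  proof (rule ccontr)
    assume "A - {v} \<noteq> C"
    moreover have sub: "A - {v} \<subseteq> C" using A by (auto simp: min_nonfaces_def)
    ultimately obtain c where c: "c \<in> C" "A - {v} \<subseteq> C - {c}" by blast
    have "insert v (C - {c}) \<in> K" using C'(3)[OF c(1)] by (simp add: link_def)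
    moreover have "A \<subseteq> insert v (C - {c})" using c by auto
    ultimately have "A \<in> K" using face_subset[OF K] by blast
    then show False using A by (simp add: min_nonfaces_def)
  qed
  moreover have "A \<in> min_nonfaces K (insert v W)"
    using A min_nonfaces_mono[of "insert v C" "insert v W" K] C' by auto
  ultimately show thesis using that by blast
qed

text \<open>If the minimal non-faces cover \<open>W\<close>, take a vertex \<open>v\<close> in one
  of them, \<open>A\<close>. By disjointness any other vertex of \<open>A\<close> is in no minimal
  non-face inside \<open>W - {v}\<close>, so the full subcomplex there is a cone. The triangle then
  bounds the Betti number by that of the link, to which induction applies.\<close>

lemma total_betti_le_of_disjnt:
  assumes "abstract_simplicial_complex K" "finite W"
    and "pairwise disjnt (min_nonfaces K W)"
  shows "total_betti TYPE('k::field) (restrict_complex K W) \<le>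
    (if W = \<Union>(min_nonfaces K W) then 1 else 0)"
  using assms
proof (induction "card W" arbitrary: K W)
  case 0
  then have "W = {}" by simp
  then have "restrict_complex K W = {{}}"
    using empty_face[OF 0(2)] by (auto simp: restrict_complex_def)
  moreover have "\<Union>(min_nonfaces K {}) = {}" by (auto simp: min_nonfaces_def)
  ultimately show ?case using \<open>W = {}\<close> by (simp add: total_betti_empty_face)
next
  case (Suc n)
  note K = Suc.prems(1) and W = Suc.prems(2)
  have sub: "\<Union>(min_nonfaces K W) \<subseteq> W" by (auto simp: min_nonfaces_def)
  show ?case
  proof (cases "W = \<Union>(min_nonfaces K W)")
    case False
    then obtain w where w: "w \<in> W" "w \<notin> \<Union>(min_nonfaces K W)" using sub by blast
    have "total_betti TYPE('k) (restrict_complex K W) = 0"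
    proof (rule total_betti_cone[OF face_family_restrict[OF K W], of w])
      fix \<sigma> assume "\<sigma> \<in> restrict_complex K W"
      then have \<sigma>: "\<sigma> \<in> K" "\<sigma> \<subseteq> W" by (auto simp: restrict_complex_def)
      have "insert w \<sigma> \<in> K"
      proof (rule ccontr)
        assume "insert w \<sigma> \<notin> K"
        moreover have "finite (insert w \<sigma>)" using \<sigma> finite_subset[OF _ W] by auto
        ultimately obtain A where A: "A \<in> min_nonfaces K (insert w \<sigma>)" using min_nonface_exists by blast
        then have "A \<in> min_nonfaces K W" using min_nonfaces_mono[of "insert w \<sigma>" W K] \<sigma> w by auto
        then have "w \<notin> A" using w by auto
        then have "A \<subseteq> \<sigma>" using A by (auto simp: min_nonfaces_def)
        then show False using A \<sigma> face_subset[OF K] by (auto simp: min_nonfaces_def)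
      qed
      then show "insert w \<sigma> \<in> restrict_complex K W \<and> \<sigma> - {w} \<in> restrict_complex K W"
        using \<sigma> w face_subset[OF K, of \<sigma> "\<sigma> - {w}"] by (auto simp: restrict_complex_def)
    qed
    then show ?thesis by simp
  next
    case True
    obtain v where v: "v \<in> W" using Suc.hyps(2) by fastforce
    then obtain A where A: "A \<in> min_nonfaces K W" "v \<in> A" using True by blast
    define W' where "W' = W - {v}"
    have W': "finite W'" "v \<notin> W'" "W = insert v W'"
      using v W by (simp_all add: W'_def insert_absorb)
    moreover have "card W' = n" using Suc.hyps(2) W' by simp
    ultimately have W': "finite W'" "v \<notin> W'" "W = insert v W'" "card W' = n" by blast+
    have sub': "min_nonfaces K W' \<subseteq> min_nonfaces K W"
      by (rule min_nonfaces_mono) (simp add: W'_def)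
    have disj': "pairwise disjnt (min_nonfaces K W')"
      by (rule pairwise_subset[OF Suc.prems(3) sub'])
    have le': "total_betti TYPE('k) (restrict_complex K W') \<le>
        (if W' = \<Union>(min_nonfaces K W') then 1 else 0)"
      using Suc.hyps(1)[of W' K] W'(1,4) K disj' by simp
    show ?thesis
    proof (cases "{v} \<in> K")
      case False
      \<comment> \<open>Here \<open>v\<close> is a ghost vertex and \<open>A\<close> may be just
        \<open>{v}\<close>. The faces do not change when \<open>v\<close> is dropped, and the bound
        for \<open>W'\<close> is at most 1.\<close>
      have "restrict_complex K W = restrict_complex K W'"
        using False face_subset[OF K, of _ "{v}"] unfolding W'(3) restrict_complex_def by blast
      then show ?thesis using le' True by (auto split: if_splits)
    next
      case vK: True
      have "A \<noteq> {v}" using A vK by (auto simp: min_nonfaces_def)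
      then obtain w where w: "w \<in> A" "w \<noteq> v" using A by blast
      have "w \<in> W'" using w A by (auto simp: W'_def min_nonfaces_def)
      moreover have "w \<notin> \<Union>(min_nonfaces K W')"
      proof
        assume "w \<in> \<Union>(min_nonfaces K W')"
        then obtain B where B: "B \<in> min_nonfaces K W'" "w \<in> B" by blast
        then have "B \<in> min_nonfaces K W" using sub' by blast
        then have "A = B" using Suc.prems(3) A w B by (auto simp: pairwise_def disjnt_def)
        then show False using A(2) B(1) W'(2) by (auto simp: min_nonfaces_def)
      qed
      ultimately have "W' \<noteq> \<Union>(min_nonfaces K W')" by blast
      then have "total_betti TYPE('k) (restrict_complex K W') = 0" using le' by simp
      moreover have "total_betti TYPE('k) (restrict_complex (link K v) W') \<le> 1"
      proof -
        have "pairwise disjnt (min_nonfaces (link K v) W')"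
        proof (rule pairwiseI)
          fix C D assume C: "C \<in> min_nonfaces (link K v) W'" and D: "D \<in> min_nonfaces (link K v) W'"
            and "C \<noteq> D"
          obtain C' where C': "C' \<in> min_nonfaces K W" "C = C' - {v}"
            using min_nonface_link[OF K W'(1,2) C] W'(3) by metis
          obtain D' where D': "D' \<in> min_nonfaces K W" "D = D' - {v}"
            using min_nonface_link[OF K W'(1,2) D] W'(3) by metis
          have "disjnt C' D'"
            using Suc.prems(3) C' D' \<open>C \<noteq> D\<close> by (auto simp: pairwise_def)
          then show "disjnt C D" using C' D' by (auto simp: disjnt_def)
        qed
        then have "total_betti TYPE('k) (restrict_complex (link K v) W') \<le>
            (if W' = \<Union>(min_nonfaces (link K v) W') then 1 else 0)"
          using Suc.hyps(1)[of W' "link K v"] W'(1,4) abstract_simplicial_complex_link[OF K vK] by simp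
        then show ?thesis by (auto split: if_splits)
      qed
      moreover obtain r1 r2 r3 where "total_betti TYPE('k) (restrict_complex K W) = r1 + r2"
        "total_betti TYPE('k) (restrict_complex K W') = r2 + r3"
        "total_betti TYPE('k) (restrict_complex (link K v) W') = r1 + r3"
        using link_triangle[OF K vK W'(2,1), where 'k='k] W'(3) by metis
      ultimately show ?thesis using True by simp
    qed
  qed
qed

lemma finite_min_nonfaces: "finite M \<Longrightarrow> finite (min_nonfaces K M)"
  by (rule finite_subset[of _ "Pow M"]) (auto simp: min_nonfaces_def)

text \<open>Only unions of minimal non-faces can contribute, each at most 1, and there are at most
  as many unions as families of minimal non-faces.\<close>

lemma betti_sum_le_of_disjnt:
  assumes K: "abstract_simplicial_complex K" "finite M" and disj: "pairwise disjnt (min_nonfaces K M)"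
  shows "betti_sum TYPE('k::field) K M \<le> 2 ^ card (min_nonfaces K M)"
proof -
  have "betti_sum TYPE('k) K M \<le> (\<Sum>W\<in>Pow M. if W = \<Union>(min_nonfaces K W) then 1 else 0)"
    unfolding betti_sum_def
  proof (rule sum_mono)
    fix W assume W: "W \<in> Pow M"
    have "pairwise disjnt (min_nonfaces K W)"
      by (rule pairwise_subset[OF disj min_nonfaces_mono]) (use W in auto)
    then show "total_betti TYPE('k) (restrict_complex K W) \<le> (if W = \<Union>(min_nonfaces K W) then 1 else 0)"
      using total_betti_le_of_disjnt[OF K(1), of W] W finite_subset[OF _ K(2)] by blast
  qed
  also have "\<dots> = card {W \<in> Pow M. W = \<Union>(min_nonfaces K W)}"
    using K(2) by (simp add: sum.If_cases Int_def)
  also have "\<dots> \<le> card (Union ` Pow (min_nonfaces K M))"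
  proof (rule card_mono)
    show "finite (Union ` Pow (min_nonfaces K M))" using finite_min_nonfaces[OF K(2)] by simp
    show "{W \<in> Pow M. W = \<Union>(min_nonfaces K W)} \<subseteq> Union ` Pow (min_nonfaces K M)"
      using min_nonfaces_mono[of _ M K] by blast
  qed
  also have "\<dots> \<le> card (Pow (min_nonfaces K M))"
    by (rule card_image_le) (use finite_min_nonfaces[OF K(2)] in simp)
  finally show ?thesis by (simp add: card_Pow finite_min_nonfaces[OF K(2)])
qed

theorem tight_complex_iff:
  assumes K: "abstract_simplicial_complex K" "\<Union>K \<subseteq> {1..m}"
  shows "tight_complex TYPE('k::field) m K \<longleftrightarrow> pairwise disjnt (min_nonfaces K {1..m})"
proof -
  let ?M = "{1..m}"
  have "K \<subseteq> Pow ?M" using K(2) by auto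
  then have finK: "finite K" by (rule finite_subset) simp
  have fin: "finite \<sigma>" if "\<sigma> \<in> K" for \<sigma> using K that unfolding abstract_simplicial_complex_def by blast
  have sub: "\<sigma> \<subseteq> ?M" if "\<sigma> \<in> K" for \<sigma> using K that by blast
  define s where "s = Max (card ` K)"
  have s_le: "card \<sigma> \<le> s" if "\<sigma> \<in> K" for \<sigma> unfolding s_def using finK that by simp
  have "s \<in> card ` K" unfolding s_def by (rule Max_in) (use finK empty_face[OF K(1)] in auto)
  then obtain \<rho> where \<rho>: "\<rho> \<in> K" "card \<rho> = s" by auto
  have sm: "s \<le> m" using card_mono[OF _ sub[OF \<rho>(1)]] \<rho> by simp
  have exponent: "nat (int m - sc_dimension K - 1) = m - s"
    unfolding sc_dimension_def s_def[symmetric] using sm by simp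
  have D: "total_bigraded_betti TYPE('k) m K = betti_sum TYPE('k) K ?M"
    unfolding hochster_formula[OF K] betti_sum_def ..
  have lower: "2 ^ (m - s) \<le> betti_sum TYPE('k) K ?M"
  proof (rule two_power_le_betti_sum[OF K(1) _ K(2) \<rho>(1)])
    fix \<tau> assume "\<tau> \<in> K" "\<rho> \<subseteq> \<tau>"
    then show "\<tau> = \<rho>" using card_seteq[OF fin, of \<tau> \<rho>] s_le \<rho> by auto
  qed (use \<rho> sm in auto)
  show ?thesis
  proof
    assume "tight_complex TYPE('k) m K"
    then have "betti_sum TYPE('k) K ?M \<le> 2 ^ (m - s)"
      unfolding tight_complex_def exponent D by simp
    moreover have "card \<sigma> + (m - s) \<le> card ?M" if "\<sigma> \<in> K" for \<sigma> using s_le[OF that] sm by simp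
    ultimately show "pairwise disjnt (min_nonfaces K ?M)"
      using disjnt_min_nonfaces_of_betti_sum_le[OF K(1) _ K(2)] by (intro pairwiseI) blast
  next
    assume disj: "pairwise disjnt (min_nonfaces K ?M)"
    \<comment> \<open>The largest face \<rho> misses a vertex of every minimal non-face. By
      disjointness these vertices are distinct, so there are at most m - s minimal non-faces, where
      s = d + 1.\<close>
    have "\<exists>x. x \<in> A - \<rho>" if "A \<in> min_nonfaces K ?M" for A
      using face_subset[OF K(1) \<rho>(1), of A] that by (auto simp: min_nonfaces_def)
    then obtain x where x: "\<And>A. A \<in> min_nonfaces K ?M \<Longrightarrow> x A \<in> A - \<rho>" by metis
    have "inj_on x (min_nonfaces K ?M)"
    proof (rule inj_onI)
      fix A B assume "A \<in> min_nonfaces K ?M" "B \<in> min_nonfaces K ?M" "x A = x B"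
      then have "\<not> disjnt A B" "A \<in> min_nonfaces K ?M" "B \<in> min_nonfaces K ?M"
        using x[of A] x[of B] by (auto simp: disjnt_def)
      then show "A = B" using disj by (auto simp: pairwise_def)
    qed
    moreover have "x ` min_nonfaces K ?M \<subseteq> ?M - \<rho>" using x by (auto simp: min_nonfaces_def)
    ultimately have "card (min_nonfaces K ?M) \<le> card (?M - \<rho>)" by (intro card_inj_on_le) auto
    also have "\<dots> = m - s" using card_Diff_subset[OF fin[OF \<rho>(1)] sub[OF \<rho>(1)]] \<rho> by simp
    finally have "(2::nat) ^ card (min_nonfaces K ?M) \<le> 2 ^ (m - s)" by (intro power_increasing) auto
    then have "betti_sum TYPE('k) K ?M \<le> 2 ^ (m - s)"
      using order_trans[OF betti_sum_le_of_disjnt[OF K(1) _ disj, where 'k='k]] by simp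
    then have "betti_sum TYPE('k) K ?M = 2 ^ (m - s)" using lower by (rule antisym)
    then show "tight_complex TYPE('k) m K" unfolding tight_complex_def exponent D .
  qed
qed

section \<open>Joins of simplices and boundaries of simplices\<close>

text \<open>Read as a relation, \<tau> has the image of \<open>{i}\<close> as its slice in the
  factor with index \<open>i\<close>; membership is decided slice by slice.\<close>

lemma simplicial_join_iff:
  "\<tau> \<in> simplicial_join Ks \<longleftrightarrow>
    fst ` \<tau> \<subseteq> {..<length Ks} \<and> (\<forall>i<length Ks. \<tau> `` {i} \<in> Ks ! i)"
proof
  assume "\<tau> \<in> simplicial_join Ks"
  then obtain \<sigma> where \<sigma>: "\<tau> = (\<Union>i<length Ks. {i} \<times> \<sigma> i)" "\<forall>i<length Ks. \<sigma> i \<in> Ks ! i"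
    unfolding simplicial_join_def by blast
  have "\<tau> `` {i} = \<sigma> i" if "i < length Ks" for i using that unfolding \<sigma>(1) by auto
  then show "fst ` \<tau> \<subseteq> {..<length Ks} \<and> (\<forall>i<length Ks. \<tau> `` {i} \<in> Ks ! i)"
    using \<sigma> by auto
next
  assume *: "fst ` \<tau> \<subseteq> {..<length Ks} \<and> (\<forall>i<length Ks. \<tau> `` {i} \<in> Ks ! i)"
  then have "\<tau> = (\<Union>i<length Ks. {i} \<times> \<tau> `` {i})" by force
  then show "\<tau> \<in> simplicial_join Ks"
    unfolding simplicial_join_def using * by (intro CollectI exI[of _ "\<lambda>i. \<tau> `` {i}"]) blast
qed

text \<open>Every minimal non-face is the set of all vertices of one factor, and different factors
  have disjoint vertex sets. Simplices and boundaries are treated together through the two shapes of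
  a factor.\<close>

lemma disjnt_min_nonfaces_of_join:
  assumes K: "abstract_simplicial_complex K"
    and iso: "simplicially_isomorphic K (simplicial_join Ks)"
    and Ks: "\<And>i. i < length Ks \<Longrightarrow> \<exists>V. Ks ! i = Pow V \<or> Ks ! i = Pow V - {V}"
  shows "pairwise disjnt (min_nonfaces K (\<Union>K))"
proof -
  let ?M = "\<Union>K" and ?J = "simplicial_join Ks"
  obtain f where bij: "bij_betw f ?M (\<Union>?J)" and im: "image f ` K = ?J"
    using iso unfolding simplicially_isomorphic_def by blast
  have inj: "inj_on f ?M" using bij by (rule bij_betw_imp_inj_on)
  have face: "f ` \<sigma> \<in> ?J \<longleftrightarrow> \<sigma> \<in> K" if "\<sigma> \<subseteq> ?M" for \<sigma>
  proof
    assume "f ` \<sigma> \<in> ?J"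
    then obtain \<rho> where \<rho>: "\<rho> \<in> K" "f ` \<sigma> = f ` \<rho>" unfolding im[symmetric] by (rule imageE)
    have "\<sigma> = \<rho>"
      using inj_on_image_eq_iff[OF inj that Union_upper[OF \<rho>(1)]] \<rho>(2) by simp
    then show "\<sigma> \<in> K" using \<rho>(1) by simp
  next
    assume "\<sigma> \<in> K"
    then show "f ` \<sigma> \<in> ?J" unfolding im[symmetric] by (rule imageI)
  qed
  define block where "block i = {x \<in> ?M. fst (f x) = i}" for i
  have *: "\<exists>i. A = block i" if A: "A \<in> min_nonfaces K ?M" for A
  proof -
    have A': "A \<subseteq> ?M" "A \<notin> K" using A by (auto simp: min_nonfaces_def)
    have "f ` ?M = \<Union>?J" using bij by (simp add: bij_betw_def)
    then have sub: "f ` A \<subseteq> \<Union>?J" using image_mono[OF A'(1), of f] by simp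
    have "fst ` \<tau> \<subseteq> {..<length Ks}" if "\<tau> \<in> ?J" for \<tau> using that by (simp add: simplicial_join_iff)
    then have "fst ` \<Union>?J \<subseteq> {..<length Ks}" by blast
    then have "fst ` f ` A \<subseteq> {..<length Ks}" using image_mono[OF sub, of fst] by (rule order_trans[rotated])
    moreover have "f ` A \<notin> ?J" using face[OF A'(1)] A'(2) by simp
    ultimately obtain i where i: "i < length Ks" "(f ` A) `` {i} \<notin> Ks ! i"
      unfolding simplicial_join_iff by blast
    obtain V where V: "Ks ! i = Pow V \<or> Ks ! i = Pow V - {V}" using Ks[OF i(1)] by blast
    \<comment> \<open>Vertices over \<open>i\<close> lie in \<open>V\<close>. So a slice of
      \<open>A\<close> can fail to be a face only by being all of \<open>V\<close>, with the factor
      a boundary.\<close>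
    have in_V: "y \<in> V" if "(i, y) \<in> \<Union>?J" for y
    proof -
      from that obtain \<tau> where "\<tau> \<in> ?J" "(i, y) \<in> \<tau>" by blast
      then have "\<tau> `` {i} \<in> Ks ! i" "y \<in> \<tau> `` {i}" using i(1) by (auto simp: simplicial_join_iff)
      then show ?thesis using V by auto
    qed
    have "(f ` A) `` {i} \<subseteq> V" using sub in_V by blast
    then have full: "(f ` A) `` {i} = V" "Ks ! i = Pow V - {V}" using i(2) V by auto
    have "block i \<subseteq> A"
    proof
      fix x assume x: "x \<in> block i"
      then have xM: "x \<in> ?M" and fx: "f x = (i, snd (f x))" unfolding block_def by (simp_all add: prod_eq_iff)
      have "f x \<in> \<Union>?J" using bij xM by (rule bij_betwE[THEN bspec])
      then have "(i, snd (f x)) \<in> \<Union>?J" using fx by simp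
      then have "snd (f x) \<in> (f ` A) `` {i}" unfolding full(1) by (rule in_V)
      then have "f x \<in> f ` A" using fx by simp
      then show "x \<in> A" using inj_on_image_mem_iff[OF inj xM A'(1)] by simp
    qed
    moreover have "V \<subseteq> (f ` block i) `` {i}"
    proof
      fix y assume "y \<in> V"
      then obtain x where "x \<in> A" "f x = (i, y)" using full(1) by (auto simp: Image_def)
      then have "x \<in> block i" using A'(1) by (auto simp: block_def)
      then show "y \<in> (f ` block i) `` {i}" using \<open>f x = (i, y)\<close> by force
    qed
    then have "(f ` block i) `` {i} \<notin> Ks ! i" using full(2) by auto
    then have "f ` block i \<notin> ?J" using i(1) by (auto simp: simplicial_join_iff)
    then have "block i \<notin> K" using face[of "block i"] by (auto simp: block_def)
    ultimately have "block i = A" using min_nonface_subset_eq[OF K A] by blast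
    then show ?thesis by blast
  qed
  show ?thesis
  proof (rule pairwiseI)
    fix A B assume "A \<in> min_nonfaces K ?M" "B \<in> min_nonfaces K ?M" "A \<noteq> B"
    then obtain i j where "A = block i" "B = block j" "i \<noteq> j" using * by metis
    then show "disjnt A B" by (auto simp: disjnt_def block_def)
  qed
qed

text \<open>The list cuts \<open>M\<close> into parts, and \<open>F\<close> marks those that become
  boundaries; the others become full simplices. Disjointness is by position, so an empty part may be
  used as padding. A set is a face iff it contains no marked part, which is a condition on each
  slice separately.\<close>

lemma isomorphic_join:
  fixes Ps :: "'v set list"
  assumes M: "finite M" "\<Union>(set Ps) = M"
    and disj: "\<And>i j. i < length Ps \<Longrightarrow> j < length Ps \<Longrightarrow> i \<noteq> j \<Longrightarrow> Ps ! i \<inter> Ps ! j = {}"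
    and K: "\<And>\<sigma>. \<sigma> \<in> K \<longleftrightarrow> \<sigma> \<subseteq> M \<and> (\<forall>A\<in>F. \<not> A \<subseteq> \<sigma>)" and F: "F \<subseteq> set Ps"
    and Ks: "length Ks = length Ps" "\<And>i. i < length Ps \<Longrightarrow> Ks ! i =
      (if Ps ! i \<in> F then boundary_simplex (card (Ps ! i)) else full_simplex (card (Ps ! i)))"
  shows "simplicially_isomorphic K (simplicial_join Ks)"
proof -
  let ?J = "simplicial_join Ks"
  have fin: "finite (Ps ! i)" if "i < length Ps" for i
    by (rule finite_subset[OF _ M(1)]) (use M(2) that nth_mem in blast)
  then have "\<forall>i<length Ps. \<exists>h. bij_betw h (Ps ! i) {1..card (Ps ! i)}"
    by (intro allI impI finite_same_card_bij) auto
  then obtain g where g: "\<And>i. i < length Ps \<Longrightarrow> bij_betw (g i) (Ps ! i) {1..card (Ps ! i)}" by metis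
  define idx where "idx x = (THE i. i < length Ps \<and> x \<in> Ps ! i)" for x
  have idx: "idx x = i" if "i < length Ps" "x \<in> Ps ! i" for x i
    unfolding idx_def using that disj by (intro the_equality) blast+
  define f where "f x = (idx x, g (idx x) x)" for x
  have f: "f x = (i, g i x)" if "i < length Ps" "x \<in> Ps ! i" for x i
    using idx[OF that] by (simp add: f_def)
  have block: "\<exists>i<length Ps. x \<in> Ps ! i" if "x \<in> M" for x
    using that M(2) by (metis Union_iff in_set_conv_nth)
  have slice: "(f ` \<sigma>) `` {i} = g i ` (\<sigma> \<inter> Ps ! i)" if "\<sigma> \<subseteq> M" "i < length Ps" for \<sigma> i
  proof (intro set_eqI iffI)
    fix y assume "y \<in> (f ` \<sigma>) `` {i}"
    then obtain x where x: "x \<in> \<sigma>" "f x = (i, y)" by force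
    have "x \<in> M" using x(1) that(1) by blast
    then obtain j where "j < length Ps" "x \<in> Ps ! j" using block by blast
    then show "y \<in> g i ` (\<sigma> \<inter> Ps ! i)" using f[of j x] x by auto
  next
    fix y assume "y \<in> g i ` (\<sigma> \<inter> Ps ! i)"
    then show "y \<in> (f ` \<sigma>) `` {i}" using f that(2) by force
  qed
  have face: "f ` \<sigma> \<in> ?J \<longleftrightarrow> \<sigma> \<in> K" if \<sigma>: "\<sigma> \<subseteq> M" for \<sigma>
  proof -
    have "(f ` \<sigma>) `` {i} \<in> Ks ! i \<longleftrightarrow> (Ps ! i \<in> F \<longrightarrow> \<not> Ps ! i \<subseteq> \<sigma>)" if i: "i < length Ps" for i
    proof -
      have "g i ` (\<sigma> \<inter> Ps ! i) \<subseteq> {1..card (Ps ! i)}" using g[OF i] by (auto simp: bij_betw_def)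
      moreover have "g i ` (\<sigma> \<inter> Ps ! i) = {1..card (Ps ! i)} \<longleftrightarrow> Ps ! i \<subseteq> \<sigma>"
        using inj_on_image_eq_iff[of "g i" "Ps ! i" "\<sigma> \<inter> Ps ! i" "Ps ! i"] g[OF i]
        unfolding bij_betw_def by auto
      ultimately show ?thesis
        unfolding Ks(2)[OF i] slice[OF \<sigma> i] by (simp add: boundary_simplex_def full_simplex_def)
    qed
    moreover have "fst ` f ` \<sigma> \<subseteq> {..<length Ps}" using block \<sigma> f by fastforce
    moreover have "(\<forall>i<length Ps. Ps ! i \<in> F \<longrightarrow> \<not> Ps ! i \<subseteq> \<sigma>) \<longleftrightarrow> (\<forall>A\<in>F. \<not> A \<subseteq> \<sigma>)"
      using F by (metis in_set_conv_nth subsetD)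
    ultimately show ?thesis using K \<sigma> Ks(1) by (simp add: simplicial_join_iff)
  qed
  have onto: "\<exists>\<sigma>\<subseteq>M. \<tau> = f ` \<sigma>" if \<tau>: "\<tau> \<in> ?J" for \<tau>
  proof -
    have "\<tau> \<subseteq> f ` M"
    proof
      fix p assume p: "p \<in> \<tau>"
      obtain i y where iy: "p = (i, y)" by (cases p)
      then have i: "i < length Ps" "\<tau> `` {i} \<in> Ks ! i"
        using \<tau> p Ks(1) by (auto simp: simplicial_join_iff)
      then have "\<tau> `` {i} \<subseteq> {1..card (Ps ! i)}"
        unfolding Ks(2)[OF i(1)] by (auto simp: boundary_simplex_def full_simplex_def split: if_splits)
      then have "y \<in> {1..card (Ps ! i)}" using p iy by blast
      then have "y \<in> g i ` (Ps ! i)" using bij_betw_imp_surj_on[OF g[OF i(1)]] by simp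
      then obtain x where x: "x \<in> Ps ! i" "y = g i x" by blast
      moreover have "x \<in> M" using x M(2) i(1) nth_mem by blast
      ultimately show "p \<in> f ` M" using f[OF i(1)] iy by (metis imageI)
    qed
    then show ?thesis by (metis subset_imageE)
  qed
  have im: "image f ` K = ?J"
  proof (intro set_eqI iffI)
    fix \<tau> assume "\<tau> \<in> image f ` K"
    then obtain \<sigma> where \<sigma>: "\<sigma> \<in> K" "\<tau> = f ` \<sigma>" by blast
    then have "\<sigma> \<subseteq> M" using K by simp
    then show "\<tau> \<in> ?J" using face \<sigma> by simp
  next
    fix \<tau> assume \<tau>: "\<tau> \<in> ?J"
    then obtain \<sigma> where \<sigma>: "\<sigma> \<subseteq> M" "\<tau> = f ` \<sigma>" using onto by blast
    then have "\<sigma> \<in> K" using face \<tau> by simp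
    then show "\<tau> \<in> image f ` K" using \<sigma>(2) by simp
  qed
  have "inj_on f M"
  proof (rule inj_onI)
    fix x y assume "x \<in> M" "y \<in> M" and eq: "f x = f y"
    then obtain i j where ij: "i < length Ps" "x \<in> Ps ! i" "j < length Ps" "y \<in> Ps ! j"
      using block by blast
    then have "i = j" "g i x = g i y" using f[of i x] f[of j y] eq by auto
    then show "x = y" using g[OF ij(1)] ij by (auto simp: bij_betw_def inj_on_def)
  qed
  moreover have "\<Union>K \<subseteq> M" using K by auto
  ultimately have "inj_on f (\<Union>K)" by (rule inj_on_subset)
  moreover have "f ` \<Union>K = \<Union>?J" unfolding im[symmetric] by blast
  ultimately show ?thesis
    unfolding simplicially_isomorphic_def bij_betw_def using im by blast
qed

text \<open>An unmarked empty part becomes \<open>full_simplex 0\<close>; this turns it into the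
  neutral boundary factor.\<close>

lemma boundary_simplex_1: "boundary_simplex 1 = full_simplex 0"
  by (auto simp: boundary_simplex_def full_simplex_def)

text \<open>Each minimal non-face yields a boundary factor; the vertices in none of them form the
  simplex factor, which is absent when there are none.\<close>

lemma join_of_disjnt_min_nonfaces:
  assumes K: "abstract_simplicial_complex K" and fin: "finite (\<Union>K)"
    and disj: "pairwise disjnt (min_nonfaces K (\<Union>K))"
  shows "\<exists>ns. ns \<noteq> [] \<and> (\<forall>n\<in>set ns. n > 0) \<and>
    (simplicially_isomorphic K (simplicial_join (map boundary_simplex ns)) \<or>
     (\<exists>r>0. simplicially_isomorphic K
        (simplicial_join (full_simplex r # map boundary_simplex ns))))"
proof -
  let ?M = "\<Union>K"
  let ?F = "min_nonfaces K ?M"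
  let ?R = "?M - \<Union>?F"
  obtain As where As: "set As = ?F" "distinct As"
    using finite_distinct_list[OF finite_min_nonfaces[OF fin]] by blast
  have ne: "{} \<notin> ?F" using empty_face[OF K] by (simp add: min_nonfaces_def)
  have sub: "A \<subseteq> ?M" if "A \<in> ?F" for A using that by (simp add: min_nonfaces_def)
  have card: "card A > 0" if "A \<in> ?F" for A
    using that ne finite_subset[OF sub fin] by (auto simp: card_gt_0_iff)
  have As_disj: "As ! i \<inter> As ! j = {}" if "i < length As" "j < length As" "i \<noteq> j" for i j
  proof -
    have "As ! i \<in> ?F" "As ! j \<in> ?F" "As ! i \<noteq> As ! j"
      using that As nth_mem nth_eq_iff_index_eq by metis+
    then show ?thesis using disj by (auto simp: pairwise_def disjnt_def)
  qed
  have As_F: "As ! i \<in> ?F" if "i < length As" for i using that As nth_mem by metis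
  note face = face_iff_min_nonfaces[OF K subset_refl fin]
  \<comment> \<open>The leading 1 keeps the list nonempty when there are no minimal non-faces; it
    corresponds to the empty part put in front of \<open>As\<close>.\<close>
  let ?ns = "1 # map card As"
  have pos: "?ns \<noteq> [] \<and> (\<forall>n\<in>set ?ns. n > 0)" using card As by auto
  show ?thesis
  proof (cases "?R = {}")
    case True
    have "simplicially_isomorphic K (simplicial_join (map boundary_simplex ?ns))"
    proof (rule isomorphic_join[OF fin _ _ face])
      let ?Ps = "{} # As"
      have "\<Union>?F \<subseteq> ?M" using sub by blast
      then show "\<Union>(set ?Ps) = ?M" using True As(1) by simp
      show "?Ps ! i \<inter> ?Ps ! j = {}" if "i < length ?Ps" "j < length ?Ps" "i \<noteq> j" for i j
        using that As_disj by (auto simp: nth_Cons split: nat.splits)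
      show "map boundary_simplex ?ns ! i = (if ?Ps ! i \<in> ?F then boundary_simplex (card (?Ps ! i))
          else full_simplex (card (?Ps ! i)))" if "i < length ?Ps" for i
        using that ne As_F by (auto simp: nth_Cons boundary_simplex_1[simplified] split: nat.splits)
    qed (use As in auto)
    then show ?thesis using pos by blast
  next
    case False
    have R: "?R \<notin> ?F" using False by blast
    have R_disj: "?R \<inter> As ! i = {}" "As ! i \<inter> ?R = {}" if "i < length As" for i
      using As_F[OF that] by blast+
    have "simplicially_isomorphic K
        (simplicial_join (full_simplex (card ?R) # map boundary_simplex ?ns))"
    proof (rule isomorphic_join[OF fin _ _ face])
      let ?Ps = "?R # {} # As"
      have "\<Union>?F \<subseteq> ?M" using sub by blast
      then show "\<Union>(set ?Ps) = ?M" using As(1) by auto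
      show "?Ps ! i \<inter> ?Ps ! j = {}" if "i < length ?Ps" "j < length ?Ps" "i \<noteq> j" for i j
        using that As_disj R_disj unfolding nth_Cons by (simp split: nat.splits)
      show "(full_simplex (card ?R) # map boundary_simplex ?ns) ! i =
          (if ?Ps ! i \<in> ?F then boundary_simplex (card (?Ps ! i)) else full_simplex (card (?Ps ! i)))"
        if "i < length ?Ps" for i
        using that ne R As_F unfolding nth_Cons
        by (simp add: boundary_simplex_1[simplified] split: nat.splits)
    qed (use As in auto)
    moreover have "card ?R > 0" using False fin by (simp add: card_gt_0_iff)
    ultimately show ?thesis using pos by blast
  qed
qed

theorem theorem1p6:
  fixes K :: "nat set set" and m :: nat
  assumes "abstract_simplicial_complex K" and "\<Union>K = {1..m}"
  shows "tight_complex TYPE('k::field) m K \<longleftrightarrow>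
    (\<exists>ns. ns \<noteq> [] \<and> (\<forall>n\<in>set ns. n > 0) \<and>
      (simplicially_isomorphic K (simplicial_join (map boundary_simplex ns)) \<or>
       (\<exists>r>0. simplicially_isomorphic K
          (simplicial_join (full_simplex r # map boundary_simplex ns)))))"
    (is "_ \<longleftrightarrow> (\<exists>ns. ?form ns)")
proof -
  have iff: "tight_complex TYPE('k) m K \<longleftrightarrow> pairwise disjnt (min_nonfaces K (\<Union>K))"
    using tight_complex_iff[OF assms(1), of m, where 'k='k] assms(2) by simp
  show ?thesis
  proof
    assume "tight_complex TYPE('k) m K"
    then show "\<exists>ns. ?form ns"
      using join_of_disjnt_min_nonfaces[OF assms(1)] assms(2) unfolding iff by simp
  next
    assume "\<exists>ns. ?form ns"
    then obtain ns Ks where iso: "simplicially_isomorphic K (simplicial_join Ks)"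
      and Ks: "Ks = map boundary_simplex ns \<or> (\<exists>r. Ks = full_simplex r # map boundary_simplex ns)"
      by blast
    have "\<exists>V. Ks ! i = Pow V \<or> Ks ! i = Pow V - {V}" if "i < length Ks" for i
    proof -
      have "Ks ! i \<in> set Ks" using that by simp
      then have "(\<exists>n. Ks ! i = boundary_simplex n) \<or> (\<exists>n. Ks ! i = full_simplex n)"
        using Ks by fastforce
      then show ?thesis unfolding boundary_simplex_def full_simplex_def by blast
    qed
    then show "tight_complex TYPE('k) m K"
      unfolding iff using disjnt_min_nonfaces_of_join[OF assms(1) iso] by blast
  qed
qed

end
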